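(* Let $f$ be a conformal map of the unit disk $\mathbb{D}$ onto the exterior of an $(n+2)$-gon with $f(0)=\infty$, and let $B_1,B_2$ be the finite Blaschke products without common zeros, of respective degrees $d_1,d_2$ with $d_1+d_2=n$, such that $$z\frac{f''}{f'}(z)=\frac{2}{z^2(B_1(z)/B_2(z))-1},\qquad z\in\mathbb{D}.$$ Then $d_2$ is equal to the number of concave vertices of the polygon, while $d_1+2$ is equal to the number of convex vertices.
   Context: $\mathbb{D}=\{|z|<1\}$. A Schwarz-Christoffel mapping onto the exterior of an $(n+2)$-gon is a conformal (meromorphic, univalent) map $f$ of $\mathbb{D}$ onto the complement, in the extended complex plane, of a bounded polygon with $n+2$ vertices, normalized by $f(0)=\infty$. It satisfies $$\frac{f''}{f'}(z)=2\left(\sum_{k=1}^{n+2}\frac{\beta_k}{z-z_k}-\frac1z\right),\qquad \sum_{k=1}^{n+2}\beta_k=1,$$ where the distinct points $z_k\in\partial\mathbb{D}$ are the pre-vertices (the preimages of the vertices) and $2\pi\beta_k\ne0$ are the exterior angles of the polygon, $2\pi\beta_k=\pi-\alpha_k$, with $\alpha_k$ the interior angle of the polygon at the vertex $f(z_k)$. The vertex $f(z_k)$ is convex if $\beta_k>0$ and concave if $\beta_k<0$. A finite Blaschke product of degree $d$ is a function $c\prod_{k=1}^{d}\frac{z-a_k}{1-\overline{a_k}z}$ with $|c|=1$ and all $|a_k|<1$ (a unimodular constant if $d=0$). It is known that for every such $f$ the function $zf''/f'$ has the stated representation with finite Blaschke products $B_1,B_2$ without common zeros and $d_1+d_2=n$.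 *)

theory Defs
  imports "HOL-Complex_Analysis.Complex_Analysis"
begin

definition polygon_boundary :: "complex list \<Rightarrow> complex set" where
  "polygon_boundary vs =
     (\<Union>i<length vs. closed_segment (vs ! i) (vs ! (Suc i mod length vs)))"

definition polygon_exterior :: "complex list \<Rightarrow> complex set" where
  "polygon_exterior vs = outside (polygon_boundary vs)"

definition polygon_region :: "complex list \<Rightarrow> complex set" where
  "polygon_region vs = - polygon_exterior vs"

text \<open>
  The angle of \<open>P\<close> at \<open>w\<close> is \<open>\<alpha>\<close> if \<open>P\<close> coincides near \<open>w\<close> with a closed circular sector of
  opening \<open>\<alpha>\<close> and apex \<open>w\<close>; \<open>\<alpha> > pi\<close> is a reflex angle, and \<open>\<alpha> = 0\<close> is the tip of a slit.
\<close>

definition has_interior_angle :: "complex set \<Rightarrow> complex \<Rightarrow> real \<Rightarrow> bool" where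
  "has_interior_angle P w \<alpha> \<longleftrightarrow> 0 \<le> \<alpha> \<and> \<alpha> < 2 * pi \<and>
     (\<exists>\<phi>. \<exists>r>0. P \<inter> ball w r =
        {w + of_real \<rho> * cis \<theta> |\<rho> \<theta>. 0 \<le> \<rho> \<and> \<rho> < r \<and> \<phi> \<le> \<theta> \<and> \<theta> \<le> \<phi> + \<alpha>})"

definition interior_angle :: "complex set \<Rightarrow> complex \<Rightarrow> real" where
  "interior_angle P w = (THE \<alpha>. has_interior_angle P w \<alpha>)"

lemma has_interior_angle_le:
  assumes "has_interior_angle P w a" and "has_interior_angle P w b"
  shows "b \<le> a"
proof (rule ccontr)
  assume ba: "\<not> b \<le> a"
  have ab: "0 \<le> a" "a < 2 * pi" "0 \<le> b"
    using assms by (auto simp: has_interior_angle_def)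
  obtain p r where r: "r > 0" and P1: "P \<inter> ball w r =
      {w + of_real \<rho> * cis \<theta> |\<rho> \<theta>. 0 \<le> \<rho> \<and> \<rho> < r \<and> p \<le> \<theta> \<and> \<theta> \<le> p + a}"
    using assms(1) unfolding has_interior_angle_def by blast
  obtain q s where s: "s > 0" and P2: "P \<inter> ball w s =
      {w + of_real \<rho> * cis \<theta> |\<rho> \<theta>. 0 \<le> \<rho> \<and> \<rho> < s \<and> q \<le> \<theta> \<and> \<theta> \<le> q + b}"
    using assms(2) unfolding has_interior_angle_def by blast
  define \<rho> where "\<rho> = min r s / 2"
  have \<rho>: "0 < \<rho>" "\<rho> < r" "\<rho> < s" using r s by (auto simp: \<rho>_def)
  have ex: "\<exists>k::int. p + 2 * pi * k \<le> t \<and> t \<le> p + a + 2 * pi * k"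
    if "q \<le> t" "t \<le> q + b" for t
  proof -
    have "w + of_real \<rho> * cis t \<in> P \<inter> ball w s"
      unfolding P2 using \<rho> that by force
    then have "w + of_real \<rho> * cis t \<in> P \<inter> ball w r"
      using \<rho> by (auto simp: dist_norm norm_mult)
    then obtain \<sigma> \<theta> where \<sigma>: "of_real \<rho> * cis t = of_real \<sigma> * cis \<theta>" "0 \<le> \<sigma>"
        "p \<le> \<theta>" "\<theta> \<le> p + a"
      unfolding P1 by auto
    have "norm (of_real \<rho> * cis t) = norm (of_real \<sigma> * cis \<theta>)" using \<sigma>(1) by simp
    then have "\<rho> = \<sigma>" using \<rho> \<sigma>(2) by (simp add: norm_mult)
    then have "cis t = cis \<theta>" using \<sigma>(1) \<rho> by simp
    then have "sin t = sin \<theta> \<and> cos t = cos \<theta>" by (simp add: complex_eq_iff)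
    then obtain k :: int where "t = \<theta> + 2 * pi * k"
      unfolding sin_cos_eq_iff by (auto simp: algebra_simps)
    then show ?thesis using \<sigma> by (intro exI[of _ k]) auto
  qed
  obtain k :: int where k: "p + 2 * pi * k \<le> q" "q \<le> p + a + 2 * pi * k"
    using ex[of q] ab by auto
  define e where "e = min (2 * pi * (k + 1) + p) (q + b)"
  define t where "t = (p + a + 2 * pi * k + e) / 2"
  have "p + a + 2 * pi * k < e"
    using k ab ba by (auto simp: e_def algebra_simps)
  then have t: "p + a + 2 * pi * k < t" "t < e" by (auto simp: t_def)
  then obtain j :: int where j: "p + 2 * pi * j \<le> t" "t \<le> p + a + 2 * pi * j"
    using ex[of t] k by (auto simp: e_def)
  have "2 * pi * k < 2 * pi * j" using j t by linarith
  then have "k + 1 \<le> j" by simp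
  then have "2 * pi * real_of_int (k + 1) \<le> 2 * pi * real_of_int j"
    by (intro mult_left_mono) (simp_all only: of_int_le_iff, simp)
  moreover have "e \<le> 2 * pi * real_of_int (k + 1) + p" by (simp add: e_def)
  ultimately show False using j t by linarith
qed

lemma interior_angle_eq:
  assumes "has_interior_angle P w \<alpha>"
  shows "interior_angle P w = \<alpha>"
  unfolding interior_angle_def
  using assms by (blast intro: the_equality antisym has_interior_angle_le)

text \<open>The exterior angle at \<open>w\<close> is \<open>2 * pi * angle_beta P w\<close>.\<close>

definition angle_beta :: "complex set \<Rightarrow> complex \<Rightarrow> real" where
  "angle_beta P w = (pi - interior_angle P w) / (2 * pi)"

definition convex_vertex :: "complex set \<Rightarrow> complex \<Rightarrow> bool" where
  "convex_vertex P w \<longleftrightarrow> angle_beta P w > 0"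

definition concave_vertex :: "complex set \<Rightarrow> complex \<Rightarrow> bool" where
  "concave_vertex P w \<longleftrightarrow> angle_beta P w < 0"

text \<open>
  The vertices are listed in cyclic order along a polygonal Jordan curve, and none of them has a
  straight angle. The case of two vertices is the degenerate polygon consisting of a single
  segment, whose two edges coincide and whose interior angles are both \<open>0\<close>.
\<close>

definition polygon :: "complex list \<Rightarrow> bool" where
  "polygon vs \<longleftrightarrow> length vs \<ge> 2 \<and> distinct vs \<and>
     (length vs > 2 \<longrightarrow>
       (\<forall>i<length vs. \<forall>j<length vs. i \<noteq> j \<longrightarrow>
          closed_segment (vs ! i) (vs ! (Suc i mod length vs)) \<inter>
          closed_segment (vs ! j) (vs ! (Suc j mod length vs))
          \<subseteq> {vs ! i, vs ! (Suc i mod length vs)} \<inter> {vs ! j, vs ! (Suc j mod length vs)})) \<and>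
     (\<forall>w\<in>set vs. angle_beta (polygon_region vs) w \<noteq> 0)"

text \<open>
  A univalent meromorphic map of the unit disk with \<open>f 0 = \<infinity>\<close> has no pole other than \<open>0\<close>, so it
  is given by a holomorphic function on the punctured disk with a pole at \<open>0\<close>; the value of the
  HOL function \<open>f\<close> at \<open>0\<close> plays no role. The point at infinity is the image of \<open>0\<close>.
\<close>

definition conformal_onto_exterior :: "(complex \<Rightarrow> complex) \<Rightarrow> complex list \<Rightarrow> bool" where
  "conformal_onto_exterior f vs \<longleftrightarrow>
     f holomorphic_on ball 0 1 - {0} \<and> is_pole f 0 \<and>
     inj_on f (ball 0 1 - {0}) \<and> f ` (ball 0 1 - {0}) = polygon_exterior vs"

definition finite_blaschke :: "nat \<Rightarrow> (complex \<Rightarrow> complex) \<Rightarrow> bool" where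
  "finite_blaschke d B \<longleftrightarrow>
     (\<exists>c a. norm c = 1 \<and> (\<forall>k<d. norm (a k) < 1) \<and>
        (\<forall>z\<in>ball 0 1. B z = c * (\<Prod>k<d. (z - a k) / (1 - cnj (a k) * z))))"

end

theory Submission
  imports Defs
begin

text \<open>
  Write \<open>B\<^sub>1 = p\<^sub>1 / q\<^sub>1\<close>, \<open>B\<^sub>2 = p\<^sub>2 / q\<^sub>2\<close> with polynomials, and put \<open>A = p\<^sub>2 q\<^sub>1\<close> and \<open>B = z\<^sup>2 p\<^sub>1 q\<^sub>2\<close>, so
  that \<open>|A| = |B|\<close> on the circle and \<open>f'' / f' = 2 A / (z (B - A))\<close>. Univalence of \<open>f\<close> forces the
  poles of \<open>f'' / f'\<close> on the circle to be simple: near a pole of higher order, suitable rescalings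
  of \<open>f\<close> converge to the exponential function, which is not injective. Since \<open>Re (z f'' / f') = -1\<close>
  on the circle, \<open>f\<close> maps the disc near a boundary point \<open>\<zeta>\<close> with residue \<open>2 \<beta>\<close> onto a sector of
  opening \<open>pi (1 + 2 \<beta>)\<close>. Near a vertex \<open>v\<close> the exterior of the polygon is connected, so it coincides
  with such a sector for any cluster point \<open>\<zeta>\<close> of the preimages of points tending to \<open>v\<close>. Hence the
  exterior angle at \<open>v\<close> is \<open>2 pi \<beta>\<close> with \<open>\<beta> = A / (\<zeta> (B - A)')\<close>, and \<open>v\<close> is the limit of \<open>f\<close> at \<open>\<zeta>\<close>,
  so that distinct vertices have distinct prevertices.

  For \<open>s < 1\<close> close to \<open>1\<close>, the equation \<open>A = s B\<close> has a root in the disc near each prevertex with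
  \<open>\<beta> < 0\<close>, and \<open>B = s A\<close> has one near each prevertex with \<open>\<beta> > 0\<close>. By Rouche's theorem these equations
  have at most \<open>d\<^sub>2\<close> and \<open>d\<^sub>1 + 2\<close> roots in the disc. As there are \<open>d\<^sub>1 + d\<^sub>2 + 2\<close> vertices, both
  bounds are attained.
\<close>

section \<open>Pre-Schwarzians of univalent functions\<close>

text \<open>On the circle the direction of the image curve turns at the rate
  \<open>1 + Re (z f'' / f')\<close>, so the value \<open>- 1\<close> says that the boundary arcs
  between the poles are straight. This is what makes a corner an exact sector and not merely an
  asymptotic one, and \<open>has_interior_angle\<close> asks for exact coincidence near the vertex.
  Behaviour of \<open>f\<close> at the boundary is not assumed: the differential equation itself
  yields a limit at each single point of the circle. The roots that matter lie on the circle, where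
  \<open>|A| = |B|\<close> and Rouche's theorem gives nothing. The factor \<open>s < 1\<close> makes
  the inequality strict, and the sign of \<beta> decides which of the two equations pushes the root
  at a prevertex into the disc. That is why there are two equations, one for each kind of vertex,
  and why multiplicities need not be controlled.\<close>

lemma holomorphic_on_imp_isCont:
  assumes "f holomorphic_on S" "open S" "z \<in> S"
  shows "isCont f z"
  using assms continuous_on_eq_continuous_at holomorphic_on_imp_continuous_on by blast

lemma field_derivative_bound_ball:
  fixes f :: "complex \<Rightarrow> complex"
  assumes "\<And>z. z \<in> ball 0 R \<Longrightarrow> (f has_field_derivative f' z) (at z)"
    and "\<And>z. z \<in> ball 0 R \<Longrightarrow> norm (f' z) \<le> B" and "u \<in> ball 0 R" "f 0 = 0"
  shows "norm (f u) \<le> B * R"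
proof -
  have R: "R > 0" using assms(3) by (auto simp: dist_norm intro: le_less_trans[OF norm_ge_zero])
  have "norm (f u - f 0) \<le> B * norm (u - 0)"
    using R assms by (intro field_differentiable_bound[where S="ball 0 R" and f'=f'])
      (auto intro: has_field_derivative_at_within)
  moreover have "B \<ge> 0" using assms(2)[OF assms(3)] norm_ge_zero order_trans by blast
  moreover have "norm u \<le> R" using assms(3) by simp
  ultimately show ?thesis using assms(4) by simp (meson mult_left_mono order_trans)
qed

lemma norm_exp_diff_1_le:
  fixes z :: complex
  shows "norm (exp z - 1) \<le> exp (norm z) * norm z"
proof -
  have "norm (exp z - exp 0) \<le> exp (norm z) * norm (z - 0)"
  proof (rule field_differentiable_bound[where S="cball 0 (norm z)" and f'=exp])
    show "norm (exp x) \<le> exp (norm z)" if "x \<in> cball 0 (norm z)" for x :: complex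
      using norm_exp[of x] that by (simp add: order_trans[OF norm_exp])
  qed (auto intro!: derivative_eq_intros)
  then show ?thesis by simp
qed

lemma holomorphic_primitive_ball:
  fixes h :: "complex \<Rightarrow> complex"
  assumes "h holomorphic_on ball 0 R"
  obtains l where "l 0 = 0" "\<And>z. z \<in> ball 0 R \<Longrightarrow> (l has_field_derivative h z) (at z)"
proof -
  obtain l0 where l0: "\<And>z. z \<in> ball 0 R \<Longrightarrow> (l0 has_field_derivative h z) (at z within ball 0 R)"
    using holomorphic_convex_primitive'[OF convex_ball open_ball assms] by metis
  show ?thesis
  proof (rule that[of "\<lambda>z. l0 z - l0 0"])
    show "((\<lambda>z. l0 z - l0 0) has_field_derivative h z) (at z)" if "z \<in> ball 0 R" for z
      using DERIV_diff[OF l0[OF that] DERIV_const] that by (simp add: at_within_open[OF _ open_ball])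
  qed simp
qed

text \<open>A function with constant pre-Schwarzian 1 is affine in \<open>exp\<close>, so the
  normalised maps converge to \<open>exp u - 1\<close>. By Hurwitz's theorem the limit would be
  injective. The radius 4 exceeds pi, so the disc contains \<open>\<i> * pi\<close> and
  \<open>- (\<i> * pi)\<close>, at which \<open>exp\<close> agrees.\<close>

lemma not_inj_pre_schwarzian_tendsto_1:
  fixes g :: "nat \<Rightarrow> complex \<Rightarrow> complex"
  assumes hol: "\<And>n. g n holomorphic_on ball 0 4" and inj: "\<And>n. inj_on (g n) (ball 0 4)"
    and \<delta>: "\<delta> \<longlonglongrightarrow> 0"
    and bd: "\<And>n u. u \<in> ball 0 4 \<Longrightarrow> norm (deriv (deriv (g n)) u / deriv (g n) u - 1) \<le> \<delta> n"
  shows False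
proof -
  define a where "a n = deriv (g n)" for n
  define G where "G n u = (g n u - g n 0) / a n 0" for n u
  define \<eta> where "\<eta> n = exp 4 * (exp (\<delta> n * 4) * (\<delta> n * 4))" for n
  have a0: "a n u \<noteq> 0" if "u \<in> ball 0 4" for n u
    unfolding a_def using holomorphic_injective_imp_regular[OF hol open_ball inj that] .
  have ahol: "a n holomorphic_on ball 0 4" for n
    unfolding a_def by (intro holomorphic_deriv hol open_ball)
  have Gd: "(G n has_field_derivative a n u / a n 0) (at u)" if "u \<in> ball 0 4" for n u
    unfolding G_def a_def using that a0[of 0 n]
    by (auto intro!: derivative_eq_intros holomorphic_derivI[OF hol] simp: a_def field_simps)
  have est: "norm (a n u / a n 0 - exp u) \<le> \<eta> n" if u: "u \<in> ball 0 4" for n u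
  proof -
    have "(\<lambda>z. deriv (a n) z / a n z - 1) holomorphic_on ball 0 4"
      by (intro holomorphic_intros holomorphic_deriv ahol open_ball a0)
    then obtain l where l0: "l 0 = 0" and l: "\<And>z. z \<in> ball 0 4 \<Longrightarrow>
        (l has_field_derivative (deriv (a n) z / a n z - 1)) (at z)"
      by (rule holomorphic_primitive_ball) auto
    have ln: "norm (l z) \<le> \<delta> n * 4" if "z \<in> ball 0 4" for z
      by (rule field_derivative_bound_ball[OF l _ that]) (use bd in \<open>auto simp: a_def l0\<close>)
    \<comment> \<open>Integrating factor: \<open>l\<close> is a primitive of
      \<open>a' / a - 1\<close>, so \<open>a n z\<close> is a constant multiple of
      \<open>exp (z + l z)\<close>, with \<open>l\<close> small.\<close>
    have "((\<lambda>z. a n z * exp (- z - l z)) has_field_derivative 0) (at z within ball 0 4)"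
      if "z \<in> ball 0 4" for z
    proof -
      have "((\<lambda>z. a n z * exp (- z - l z)) has_field_derivative
          deriv (a n) z * exp (- z - l z) +
          exp (- z - l z) * (- 1 - (deriv (a n) z / a n z - 1)) * a n z) (at z)"
        by (rule DERIV_mult[OF holomorphic_derivI[OF ahol open_ball that]
              DERIV_chain2[OF DERIV_exp DERIV_diff[OF DERIV_minus[OF DERIV_ident] l[OF that]]]])
      also have "deriv (a n) z * exp (- z - l z) +
          exp (- z - l z) * (- 1 - (deriv (a n) z / a n z - 1)) * a n z = 0"
        using a0[OF that, of n] by (simp add: field_simps)
      finally show ?thesis by (rule has_field_derivative_at_within)
    qed
    from has_field_derivative_zero_constant[OF convex_ball this]
    obtain C where C: "\<And>x. x \<in> ball 0 4 \<Longrightarrow> a n x * exp (- x - l x) = C" by blast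
    have "a n u * exp (- u - l u) = a n 0 * exp (- 0 - l 0)"
      using C[OF u] C[of 0] by simp
    then have "a n u * exp (- u - l u) = a n 0" by (simp add: l0)
    then have "a n u / a n 0 = exp (u + l u)"
      using a0[of 0 n] by (auto simp: exp_minus exp_diff exp_add field_simps)
    then have "norm (a n u / a n 0 - exp u) = norm (exp u) * norm (exp (l u) - 1)"
      by (simp add: exp_add right_diff_distrib flip: norm_mult norm_exp_eq_Re)
    also have "\<dots> \<le> exp 4 * (exp (\<delta> n * 4) * (\<delta> n * 4))"
    proof (intro mult_mono)
      show "norm (exp u) \<le> exp 4" using u norm_exp[of u] by (simp add: order_trans[OF norm_exp])
      have "norm (exp (l u) - 1) \<le> exp (norm (l u)) * norm (l u)" by (rule norm_exp_diff_1_le)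
      also have "\<dots> \<le> exp (\<delta> n * 4) * (\<delta> n * 4)" using ln[OF u] by (intro mult_mono) auto
      finally show "norm (exp (l u) - 1) \<le> exp (\<delta> n * 4) * (\<delta> n * 4)" .
    qed auto
    finally show ?thesis by (simp add: \<eta>_def)
  qed
  have Gest: "norm (G n u - (exp u - 1)) \<le> \<eta> n * 4" if "u \<in> ball 0 4" for n u
  proof (rule field_derivative_bound_ball[OF _ est that])
    show "((\<lambda>u. G n u - (exp u - 1)) has_field_derivative a n z / a n 0 - exp z) (at z)"
      if "z \<in> ball 0 4" for z
      using DERIV_diff[OF Gd[OF that] DERIV_diff[OF DERIV_exp DERIV_const]] by simp
  qed (simp_all add: G_def)
  have "inj_on (\<lambda>u. exp u - 1 :: complex) (ball 0 4)"
  proof (rule Hurwitz_injective[of _ G])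
    show "G n holomorphic_on ball 0 4" for n
      using Gd by (meson field_differentiable_at_within field_differentiable_def holomorphic_on_def)
    show "inj_on (G n) (ball 0 4)" for n
      using inj[of n] a0[of 0 n] by (auto simp: inj_on_def G_def)
    show "\<not> (\<lambda>u. exp u - 1 :: complex) constant_on ball 0 4"
    proof
      assume "(\<lambda>u. exp u - 1 :: complex) constant_on ball 0 4"
      then obtain y where y: "\<And>u. u \<in> ball 0 4 \<Longrightarrow> exp u - 1 = (y::complex)"
        unfolding constant_on_def by blast
      have "exp (1::complex) = exp 0" using y[of 0] y[of 1] by simp
      then have "norm (exp (1::complex)) = norm (exp (0::complex))" by metis
      then show False by simp
    qed
    fix K :: "complex set" assume K: "compact K" "K \<subseteq> ball 0 4"
    have "(\<lambda>n. \<eta> n * 4) \<longlonglongrightarrow> exp 4 * (exp (0 * 4) * (0 * 4)) * 4"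
      unfolding \<eta>_def by (intro tendsto_intros \<delta>)
    then have e: "\<forall>\<^sub>F n in sequentially. \<eta> n * 4 < e" if "e > 0" for e
      using order_tendstoD(2) that by fastforce
    show "uniform_limit K G (\<lambda>u. exp u - 1) sequentially"
      unfolding uniform_limit_iff
    proof (intro allI impI)
      fix e :: real assume "e > 0"
      from e[OF this] show "\<forall>\<^sub>F n in sequentially. \<forall>x\<in>K. dist (G n x) (exp x - 1) < e"
      proof eventually_elim
        case (elim n)
        show ?case using Gest[of _ n] K(2) elim by (force simp: dist_norm subset_iff intro: le_less_trans)
      qed
    qed
  qed (auto intro!: holomorphic_intros)
  moreover have "\<i> * pi \<in> ball 0 4" "- (\<i> * pi) \<in> ball 0 4"
    using pi_less_4 by (auto simp: norm_mult)
  moreover have "exp (\<i> * pi) - 1 = exp (- (\<i> * pi)) - 1"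
    by (simp add: exp_minus)
  ultimately have "\<i> * pi = - (\<i> * complex_of_real pi)" unfolding inj_on_def by blast
  then show False by simp
qed

text \<open>Near \<open>s = \<i> * t\<close> the pre-Schwarzian is about
  \<open>L = K s / s ^ m\<close>, so in the length scale \<open>1 / L\<close> it is about 1. In this
  scale a disc of radius 4 moves \<open>s\<close> by a relative amount of order
  \<open>t ^ (m - 1)\<close>. For \<open>m \<ge> 2\<close> this tends to 0, so the disc stays in the
  half disc and the pre-Schwarzian hardly varies on it. A simple pole is invariant under scaling and
  admits no such zoom.\<close>

lemma univalent_pre_schwarzian_pole_order_le_1:
  fixes \<phi> K :: "complex \<Rightarrow> complex"
  defines "H \<equiv> \<lambda>\<epsilon>. ball 0 \<epsilon> \<inter> {s. Im s > 0}"
  assumes \<epsilon>: "\<epsilon> > 0" and hol: "\<phi> holomorphic_on H \<epsilon>" and inj: "inj_on \<phi> (H \<epsilon>)"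
    and K: "K holomorphic_on ball 0 \<epsilon>" "K 0 \<noteq> 0"
    and ode: "\<And>s. s \<in> H \<epsilon> \<Longrightarrow> deriv (deriv \<phi>) s / deriv \<phi> s = K s / s ^ m"
  shows "m \<le> 1"
proof (rule ccontr)
  assume m: "\<not> m \<le> 1"
  have oH: "open (H \<epsilon>)"
    unfolding H_def by (intro open_Int open_ball open_halfspace_Im_gt)
  have K0: "isCont K 0"
    using K(1) \<epsilon> by (intro holomorphic_on_imp_isCont[OF _ open_ball]) auto
  have step: "\<exists>g. g holomorphic_on ball 0 4 \<and> inj_on g (ball 0 4) \<and>
      (\<forall>u\<in>ball 0 4. norm (deriv (deriv g) u / deriv g u - 1) \<le> e)" if e: "e > 0" for e
  proof -
    \<comment> \<open>The ratio of the pre-Schwarzian at \<open>s * (1 + \<eta>)\<close> to that at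
      \<open>s\<close>, as a function of the pair \<open>(s, \<eta>)\<close>. It is continuous at
      the origin with value 1, although both terms of the ratio blow up.\<close>
    define q where "q p = K (fst p * (1 + snd p)) / K (fst p) / (1 + snd p) ^ m" for p
    have "isCont (\<lambda>p. K (fst p * (1 + snd p))) (0, 0)"
      by (rule isCont_o2[where g=K]) (auto intro!: continuous_intros simp: K0)
    moreover have "isCont (\<lambda>p. K (fst p)) ((0::complex), (0::complex))"
      by (rule isCont_o2[where g=K]) (auto intro!: continuous_intros simp: K0)
    ultimately have "isCont q (0, 0)"
      unfolding q_def using K(2) by (auto intro!: continuous_intros)
    then have "\<forall>\<^sub>F p in nhds (0,0). dist (q p) (q (0,0)) < e"
      unfolding isCont_def tendsto_at_iff_tendsto_nhds using e by (simp add: tendsto_iff)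
    then obtain d where d: "d > 0" "\<And>p. dist p (0,0) < d \<Longrightarrow> dist (q p) (q (0,0)) < e"
      unfolding eventually_nhds_metric by auto
    have "\<forall>\<^sub>F s in nhds 0. dist (K s) (K 0) < norm (K 0) / 2"
      using K0 K(2) unfolding isCont_def tendsto_at_iff_tendsto_nhds by (intro tendstoD) simp_all
    then obtain d' where d': "d' > 0" "\<And>s. dist s 0 < d' \<Longrightarrow> dist (K s) (K 0) < norm (K 0) / 2"
      unfolding eventually_nhds_metric by auto
    define k where "k = norm (K 0)"
    have k: "k > 0" using K(2) by (simp add: k_def)
    \<comment> \<open>The last two entries turn \<open>norm (\<eta> u) \<le> 8 * t / k\<close> into
      the bounds \<open>d / 4\<close> and \<open>1 / 4\<close>; the entry 1 keeps the powers of
      \<open>t\<close> at most 1.\<close>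
    define S where "S = {1, \<epsilon> / 2, d' / 2, d / 4, d * k / 32, k / 32}"
    define t where "t = Min S"
    have tS: "x \<in> S \<Longrightarrow> t \<le> x" for x unfolding t_def by (rule Min_le) (simp add: S_def)
    have t: "t \<le> 1" "t \<le> \<epsilon> / 2" "t \<le> d' / 2" "t \<le> d / 4" "t \<le> d * k / 32" "t \<le> k / 32"
      by (rule tS, simp add: S_def)+
    have "t \<in> S" unfolding t_def by (rule Min_in) (auto simp: S_def)
    moreover have "\<forall>x\<in>S. x > 0" using \<epsilon> d(1) d'(1) k by (simp add: S_def)
    ultimately have t0: "t > 0" by blast
    note t = t0 t
    define s where "s = \<i> * complex_of_real t"
    have s: "norm s = t" "s \<noteq> 0" using t by (auto simp: s_def norm_mult)
    have Ks: "norm (K s) \<ge> k / 2"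
    proof -
      have "norm (K 0 - K s) < k / 2"
        using d'(2)[of s] t s d' by (simp add: dist_norm k_def norm_minus_commute)
      then show ?thesis using norm_triangle_sub[of "K 0" "K s"] by (simp add: k_def)
    qed
    then have Ks0: "K s \<noteq> 0" using k by auto
    define L where "L = K s / s ^ m"
    have L0: "L \<noteq> 0" using Ks0 s by (simp add: L_def)
    define \<eta> where "\<eta> u = u / (L * s)" for u
    have su: "s + u / L = s * (1 + \<eta> u)" for u
      using L0 s by (simp add: \<eta>_def field_simps)
    have \<eta>: "norm (\<eta> u) \<le> 8 * t / k" if "u \<in> ball 0 4" for u
    proof -
      \<comment> \<open>The place where \<open>m \<ge> 2\<close> enters:
        \<open>norm (L * s) * t\<close> is \<open>norm (K s)\<close> over a nonnegative power of
        \<open>t\<close>, hence at least \<open>k / 2\<close>.\<close>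
      obtain m' where m': "m = Suc (Suc m')" using m by (metis One_nat_def Suc_le_mono bot_nat_0.extremum not0_implies_Suc)
      have "norm (L * s) * t = norm (K s) / t ^ m'"
        using s t by (simp add: L_def m' norm_mult norm_divide norm_power)
      moreover have "norm (K s) / t ^ m' \<ge> (k / 2) / 1"
        using Ks t k by (intro frac_le) (auto intro: power_le_one)
      ultimately have L: "norm (L * s) * t \<ge> k / 2" by simp
      then have Lp: "norm (L * s) > 0" using k t L0 s by simp
      have "norm u * k \<le> 4 * (norm (L * s) * t * 2)"
        using that L k by (intro mult_mono) auto
      then show ?thesis using Lp k by (simp add: \<eta>_def norm_divide field_simps)
    qed
    have \<eta>2: "norm (\<eta> u) \<le> 1 / 4" "norm (\<eta> u) \<le> d / 4" if "u \<in> ball 0 4" for u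
    proof -
      have "8 * t / k \<le> 1 / 4" "8 * t / k \<le> d / 4" using t k by (simp_all add: field_simps)
      then show "norm (\<eta> u) \<le> 1 / 4" "norm (\<eta> u) \<le> d / 4" using \<eta>[OF that] by linarith+
    qed
    have inH: "s + u / L \<in> H \<epsilon>" if u: "u \<in> ball 0 4" for u
    proof -
      have "norm (s * (1 + \<eta> u)) \<le> t * (1 + 1 / 4)"
        unfolding norm_mult s using \<eta>2(1)[OF u] t norm_triangle_ineq[of 1 "\<eta> u"]
        by (intro mult_mono) auto
      also have "\<dots> < \<epsilon>" using t \<epsilon> by simp
      finally have "norm (s * (1 + \<eta> u)) < \<epsilon>" .
      moreover have "Im (s * (1 + \<eta> u)) = t * (1 + Re (\<eta> u))" by (simp add: s_def)
      moreover have "\<bar>Re (\<eta> u)\<bar> \<le> 1 / 4" using \<eta>2(1)[OF u] abs_Re_le_cmod order_trans by blast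
      ultimately show ?thesis unfolding su H_def using t by (simp add: abs_if split: if_splits)
    qed
    define g where "g u = \<phi> (s + u / L)" for u
    have dg: "(g has_field_derivative deriv \<phi> (s + u / L) / L) (at u)" if "u \<in> ball 0 4" for u
    proof -
      have "((\<lambda>u. s + u / L) has_field_derivative 1 / L) (at u)"
        using L0 by (auto intro!: derivative_eq_intros)
      from DERIV_chain2[OF holomorphic_derivI[OF hol oH inH[OF that]] this]
      show ?thesis by (simp add: g_def[abs_def])
    qed
    have dg': "deriv g u = deriv \<phi> (s + u / L) / L" if "u \<in> ball 0 4" for u
      using DERIV_imp_deriv[OF dg[OF that]] .
    have ddg: "deriv (deriv g) u = deriv (deriv \<phi>) (s + u / L) / L / L" if u: "u \<in> ball 0 4" for u
    proof -
      have "((\<lambda>u. s + u / L) has_field_derivative 1 / L) (at u)"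
        using L0 by (auto intro!: derivative_eq_intros)
      from DERIV_cdivide[OF DERIV_chain2[OF holomorphic_derivI[OF holomorphic_deriv[OF hol oH] oH inH[OF u]] this], of L]
      have "((\<lambda>u. deriv \<phi> (s + u / L) / L) has_field_derivative deriv (deriv \<phi>) (s + u / L) / L / L) (at u)"
        by simp
      then have "(deriv g has_field_derivative deriv (deriv \<phi>) (s + u / L) / L / L) (at u)"
        by (rule has_field_derivative_transform_within_open[OF _ open_ball u])
           (simp add: dg')
      then show ?thesis by (rule DERIV_imp_deriv)
    qed
    have "g holomorphic_on ball 0 4"
      unfolding holomorphic_on_open[OF open_ball] using dg by blast
    moreover have "inj_on g (ball 0 4)"
    proof
      fix u v assume uv: "u \<in> ball 0 4" "v \<in> ball 0 4" "g u = g v"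
      have "s + u / L = s + v / L"
        by (rule inj_onD[OF inj uv(3)[unfolded g_def] inH[OF uv(1)] inH[OF uv(2)]])
      then show "u = v" using L0 by simp
    qed
    moreover have "norm (deriv (deriv g) u / deriv g u - 1) \<le> e" if u: "u \<in> ball 0 4" for u
    proof -
      have "deriv (deriv g) u / deriv g u = deriv (deriv \<phi>) (s + u / L) / deriv \<phi> (s + u / L) / L"
        using L0 by (simp add: ddg[OF u] dg'[OF u])
      also have "\<dots> = K (s * (1 + \<eta> u)) / (s * (1 + \<eta> u)) ^ m / L"
        using ode[OF inH[OF u]] by (simp add: su)
      also have "\<dots> = q (s, \<eta> u)"
        using s Ks0 by (simp add: q_def L_def power_mult_distrib)
      finally have *: "deriv (deriv g) u / deriv g u = q (s, \<eta> u)" .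
      have "dist (s, \<eta> u) (0, 0) \<le> norm s + norm (\<eta> u)"
        by (simp add: dist_Pair_Pair sqrt_sum_squares_le_sum)
      also have "\<dots> < d" using \<eta>2[OF u] t s d(1) by linarith
      finally have "dist (q (s, \<eta> u)) (q (0, 0)) < e" by (rule d(2))
      moreover have "q (0, 0) = 1" using K(2) by (simp add: q_def)
      ultimately show ?thesis using * by (simp add: dist_norm)
    qed
    ultimately show ?thesis by blast
  qed
  have "\<forall>n. \<exists>g. g holomorphic_on ball 0 4 \<and> inj_on g (ball 0 4) \<and>
      (\<forall>u\<in>ball 0 4. norm (deriv (deriv g) u / deriv g u - 1) \<le> inverse (real (Suc n)))"
    by (intro allI step) simp
  then obtain G where G: "\<And>n. G n holomorphic_on ball 0 4" "\<And>n. inj_on (G n) (ball 0 4)"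
      "\<And>n u. u \<in> ball 0 4 \<Longrightarrow> norm (deriv (deriv (G n)) u / deriv (G n) u - 1) \<le> inverse (real (Suc n))"
    by metis
  show False
    by (rule not_inj_pre_schwarzian_tendsto_1[OF G(1,2) LIMSEQ_inverse_real_of_nat G(3)])
qed

section \<open>Fuchsian equations with real coefficients\<close>

text \<open>The complex derivative can be computed along the real axis, where the difference
  quotients are real, and the reals are closed.\<close>

lemma deriv_in_Reals:
  fixes K :: "complex \<Rightarrow> complex"
  assumes K: "K holomorphic_on ball 0 \<epsilon>" and r: "\<And>x. x \<in> \<real> \<Longrightarrow> x \<in> ball 0 \<epsilon> \<Longrightarrow> K x \<in> \<real>"
    and x: "x \<in> \<real>" "x \<in> ball 0 \<epsilon>"
  shows "deriv K x \<in> \<real>"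
proof -
  obtain t where t: "x = of_real t" using x(1) by (auto elim: Reals_cases)
  have D: "((\<lambda>y. (K y - K x) / (y - x)) \<longlongrightarrow> deriv K x) (at x)"
    using holomorphic_derivI[OF K open_ball x(2)] unfolding has_field_derivative_iff .
  have "filterlim complex_of_real (at x) (at t)"
    unfolding filterlim_at t by (auto intro!: tendsto_intros simp: eventually_at_filter)
  then have L: "((\<lambda>u. (K (of_real u) - K x) / (of_real u - x)) \<longlongrightarrow> deriv K x) (at t)"
    by (rule filterlim_compose[OF D])
  have "\<forall>\<^sub>F u in at t. complex_of_real u \<in> ball 0 \<epsilon>"
    by (rule topological_tendstoD[OF tendsto_of_real[OF tendsto_ident_at]]) (use x t in auto)
  then have "\<forall>\<^sub>F u in at t. (K (of_real u) - K x) / (of_real u - x) \<in> \<real>"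
    by eventually_elim (use r x in \<open>auto intro!: Reals_divide Reals_diff\<close>)
  then show ?thesis
    by (rule Lim_in_closed_set[OF closed_complex_Reals _ _ L]) simp
qed

lemma higher_deriv_in_Reals:
  fixes K :: "complex \<Rightarrow> complex"
  assumes K: "K holomorphic_on ball 0 \<epsilon>" and r: "\<And>x. x \<in> \<real> \<Longrightarrow> x \<in> ball 0 \<epsilon> \<Longrightarrow> K x \<in> \<real>"
    and x: "x \<in> \<real>" "x \<in> ball 0 \<epsilon>"
  shows "(deriv ^^ n) K x \<in> \<real>"
  using x
proof (induction n arbitrary: x)
  case (Suc n)
  have "deriv ((deriv ^^ n) K) x \<in> \<real>"
    by (rule deriv_in_Reals[OF holomorphic_higher_deriv[OF K open_ball]]) (use Suc in auto)
  then show ?case by simp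
qed (use r in auto)

lemma primitive_in_Reals:
  fixes l h :: "complex \<Rightarrow> complex"
  assumes d: "\<And>z. z \<in> ball 0 \<epsilon> \<Longrightarrow> (l has_field_derivative h z) (at z)" and l0: "l 0 \<in> \<real>"
    and r: "\<And>x. x \<in> \<real> \<Longrightarrow> x \<in> ball 0 \<epsilon> \<Longrightarrow> h x \<in> \<real>" and x: "x \<in> \<real>" "x \<in> ball 0 \<epsilon>"
  shows "l x \<in> \<real>"
proof -
  obtain t where t: "x = of_real t" using x(1) by (auto elim: Reals_cases)
  have "((\<lambda>u. Im (l (of_real u))) has_vector_derivative 0) (at u within {-\<epsilon><..<\<epsilon>})" if "u \<in> {-\<epsilon><..<\<epsilon>}" for u
  proof -
    have u: "complex_of_real u \<in> ball 0 \<epsilon>" using that by auto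
    have "((\<lambda>u. l (of_real u)) has_vector_derivative (h (of_real u))) (at u within {-\<epsilon><..<\<epsilon>})"
      by (rule has_vector_derivative_real_field[OF d[OF u]])
    then have "((\<lambda>u. Im (l (of_real u))) has_vector_derivative Im (h (of_real u))) (at u within {-\<epsilon><..<\<epsilon>})"
      by (rule bounded_linear.has_vector_derivative[OF bounded_linear_Im])
    moreover have "Im (h (of_real u)) = 0" using r[OF _ u] by (simp add: complex_is_Real_iff)
    ultimately show ?thesis by simp
  qed
  then obtain c where "\<And>u. u \<in> {-\<epsilon><..<\<epsilon>} \<Longrightarrow> Im (l (of_real u)) = c"
    by (rule has_vector_derivative_zero_constant[rotated]) auto
  moreover have "t \<in> {-\<epsilon><..<\<epsilon>}" "0 \<in> {-\<epsilon><..<\<epsilon>}" using x(2) by (auto simp: t)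
  ultimately have "Im (l x) = Im (l 0)" by (metis t of_real_0)
  then show ?thesis using l0 by (simp add: complex_is_Real_iff)
qed

text \<open>Frobenius' method: \<open>s powr c * G s\<close> is then a primitive of \<open>s powr (c - 1) * g s\<close>.\<close>

lemma frobenius_primitive:
  fixes g :: "complex \<Rightarrow> complex"
  assumes g: "g holomorphic_on ball 0 \<epsilon>" and \<epsilon>: "\<epsilon> > 0" and c: "c > 0"
    and r: "\<And>x. x \<in> \<real> \<Longrightarrow> x \<in> ball 0 \<epsilon> \<Longrightarrow> g x \<in> \<real>"
  obtains G \<delta> where "\<delta> > 0" "\<delta> \<le> \<epsilon>" "G holomorphic_on ball 0 \<delta>"
    "\<And>x. x \<in> \<real> \<Longrightarrow> x \<in> ball 0 \<delta> \<Longrightarrow> G x \<in> \<real>"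
    "\<And>s. s \<in> ball 0 \<delta> \<Longrightarrow> of_real c * G s + s * deriv G s = g s"
proof -
  define F where "F = fps_expansion g 0"
  \<comment> \<open>The operator sending \<open>G\<close> to \<open>c * G + s * G'\<close>
    multiplies the coefficient of index \<open>n\<close> by \<open>n + c\<close>, which never
    vanishes because \<open>c > 0\<close>.\<close>
  define FG where "FG = Abs_fps (\<lambda>n. fps_nth F n / (of_nat n + of_real c))"
  have "g analytic_on {0}"
    using g \<epsilon> by (auto simp: analytic_at intro!: exI[of _ "ball 0 \<epsilon>"])
  then have gF: "g has_fps_expansion F"
    unfolding F_def by (rule analytic_at_imp_has_fps_expansion_0)
  have nz: "of_nat n + complex_of_real c \<noteq> 0" for n
    using c by (metis add_nonneg_pos of_nat_0_le_iff of_real_add of_real_eq_0_iff of_real_of_nat_eq order_less_irrefl)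
  have "fps_conv_radius F \<le> fps_conv_radius FG"
    unfolding fps_conv_radius_def
  proof (rule conv_radius_geI_ex')
    fix r :: real assume r: "0 < r" "ereal r < conv_radius (fps_nth F)"
    have "summable (\<lambda>n. norm (fps_nth F n * of_real r ^ n))"
      using r by (intro abs_summable_in_conv_radius) simp
    \<comment> \<open>At index 0 the divisor \<open>c\<close> may be less than 1, so the comparison
      starts at index 1.\<close>
    moreover have "norm (fps_nth FG n * of_real r ^ n) \<le> norm (fps_nth F n * of_real r ^ n)"
      if n: "1 \<le> n" for n
    proof -
      have "norm (of_nat n + complex_of_real c) = real n + c"
        using c by (metis abs_of_nonneg add_nonneg_nonneg less_imp_le norm_of_real of_nat_0_le_iff of_real_add of_real_of_nat_eq)
      moreover have "norm (fps_nth F n) * 1 \<le> norm (fps_nth F n) * (real n + c)"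
        using n c by (intro mult_left_mono) auto
      ultimately have "norm (fps_nth FG n) \<le> norm (fps_nth F n)"
        using n c by (simp add: FG_def norm_divide divide_le_eq)
      then show ?thesis by (simp add: norm_mult mult_right_mono)
    qed
    ultimately show "summable (\<lambda>n. fps_nth FG n * of_real r ^ n)"
      by (rule summable_comparison_test'[where N=1])
  qed
  then have rad: "fps_conv_radius FG > 0"
    using gF by (auto simp: has_fps_expansion_def)
  define G where "G = eval_fps FG"
  have GF: "G has_fps_expansion FG" unfolding G_def using rad by (rule eval_fps_has_fps_expansion)
  have "(\<lambda>s. of_real c * G s + s * deriv G s) has_fps_expansion
      (fps_const (of_real c) * FG + fps_X * fps_deriv FG)"
    by (intro fps_expansion_intros GF)
  also have "fps_const (of_real c) * FG + fps_X * fps_deriv FG = F"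
  proof (rule fps_ext)
    fix n
    have "fps_nth (fps_const (of_real c) * FG + fps_X * fps_deriv FG) n =
        (of_nat n + of_real c) * fps_nth FG n"
      by (cases n) (simp_all add: algebra_simps)
    then show "fps_nth (fps_const (of_real c) * FG + fps_X * fps_deriv FG) n = fps_nth F n"
      using nz[of n] by (simp add: FG_def)
  qed
  finally have "\<forall>\<^sub>F s in nhds 0. of_real c * G s + s * deriv G s = g s"
    using gF unfolding has_fps_expansion_def by (auto elim: eventually_elim2)
  then obtain d where d: "d > 0" "\<And>s. dist s 0 < d \<Longrightarrow> of_real c * G s + s * deriv G s = g s"
    unfolding eventually_nhds_metric by blast
  obtain e where e: "e > 0" "ereal e < fps_conv_radius FG"
    using rad by (metis ereal_dense2 ereal_less(2) zero_ereal_def less_ereal.simps(1))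
  define \<delta> where "\<delta> = min \<epsilon> (min d e)"
  have in_rad: "ereal (norm s) < fps_conv_radius FG" if "s \<in> ball 0 \<delta>" for s :: complex
    using that e by (auto simp: \<delta>_def intro: less_trans[of _ "ereal e"])
  show ?thesis
  proof (rule that[of \<delta> G])
    show "\<delta> > 0" "\<delta> \<le> \<epsilon>" using d e \<epsilon> by (auto simp: \<delta>_def)
    show "G holomorphic_on ball 0 \<delta>"
      unfolding G_def by (rule holomorphic_on_eval_fps) (use in_rad in \<open>simp add: subset_iff in_eball_iff\<close>)
    show "of_real c * G s + s * deriv G s = g s" if "s \<in> ball 0 \<delta>" for s
      using that d(2) by (auto simp: \<delta>_def)
    fix x :: complex assume x: "x \<in> \<real>" "x \<in> ball 0 \<delta>"
    have FR: "fps_nth F n \<in> \<real>" for n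
    proof -
      have "(deriv ^^ n) g 0 \<in> \<real>" by (rule higher_deriv_in_Reals[OF g r]) (use \<epsilon> in simp_all)
      moreover have "(fact n :: complex) \<in> \<real>" by (metis of_nat_fact Reals_of_nat)
      ultimately show ?thesis unfolding F_def fps_expansion_def fps_nth_Abs_fps by (rule Reals_divide)
    qed
    have "of_nat n + complex_of_real c \<in> \<real>" for n by (intro Reals_add Reals_of_nat Reals_of_real)
    then have "fps_nth FG n * x ^ n \<in> \<real>" for n
      unfolding FG_def fps_nth_Abs_fps by (intro Reals_mult Reals_divide Reals_power FR x(1))
    then have A: "(\<Sum>k<n. fps_nth FG k * x ^ k) \<in> \<real>" for n by (intro sum_in_Reals) auto
    have B: "(\<lambda>n. \<Sum>k<n. fps_nth FG k * x ^ k) \<longlonglongrightarrow> G x"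
      using sums_eval_fps[OF in_rad[OF x(2)]] by (simp add: sums_def G_def)
    show "G x \<in> \<real>"
      by (rule closed_sequentially[OF closed_complex_Reals A B])
  qed
qed

section \<open>Singular equations on a half disc\<close>

lemma upper_half_disc:
  fixes \<epsilon> :: real
  defines "H \<equiv> ball 0 \<epsilon> \<inter> {s. Im s > 0}"
  shows "open H" "convex H" "\<epsilon> > 0 \<Longrightarrow> \<i> * of_real (\<epsilon> / 2) \<in> H"
proof -
  show "open H" unfolding H_def by (intro open_Int open_ball open_halfspace_Im_gt)
  show "convex H" unfolding H_def by (intro convex_Int convex_ball convex_halfspace_Im_gt)
qed (auto simp: H_def norm_mult)

lemma upper_half_plane_Ln:
  assumes "Im s > 0"
  shows "s \<notin> \<real>\<^sub>\<le>\<^sub>0" "s \<noteq> 0"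
  using assms by (auto simp: complex_nonpos_Reals_iff)

text \<open>\<open>K s / s\<close> is \<open>(c - 1) / s\<close> plus a holomorphic function.
  Integration turns the first term into the power and the second into the exponential of a
  primitive, which inherits reality on the axis.\<close>

lemma fuchsian_deriv_form:
  fixes \<phi> K :: "complex \<Rightarrow> complex" and \<epsilon> c :: real
  defines "H \<equiv> ball 0 \<epsilon> \<inter> {s. Im s > 0}"
  assumes \<epsilon>: "\<epsilon> > 0" and hol: "\<phi> holomorphic_on H" and inj: "inj_on \<phi> H"
    and K: "K holomorphic_on ball 0 \<epsilon>" "\<And>x. x \<in> \<real> \<Longrightarrow> x \<in> ball 0 \<epsilon> \<Longrightarrow> K x \<in> \<real>"
    and c: "K 0 = of_real (c - 1)"
    and ode: "\<And>s. s \<in> H \<Longrightarrow> deriv (deriv \<phi>) s / deriv \<phi> s = K s / s"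
  obtains C g where "C \<noteq> 0" "g holomorphic_on ball 0 \<epsilon>" "g 0 = 1"
    "\<And>x. x \<in> \<real> \<Longrightarrow> x \<in> ball 0 \<epsilon> \<Longrightarrow> g x \<in> \<real>"
    "\<And>s. s \<in> H \<Longrightarrow> deriv \<phi> s = C * s powr of_real (c - 1) * g s"
proof -
  note H = upper_half_disc[of \<epsilon>, folded H_def]
  define \<psi> where "\<psi> s = (if s = 0 then deriv K 0 else (K s - K 0) / (s - 0))" for s
  have "\<psi> holomorphic_on ball 0 \<epsilon>"
    unfolding \<psi>_def by (rule pole_lemma[OF K(1)]) (use \<epsilon> in auto)
  then obtain l where l: "l 0 = 0" "\<And>z. z \<in> ball 0 \<epsilon> \<Longrightarrow> (l has_field_derivative \<psi> z) (at z)"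
    by (rule holomorphic_primitive_ball) auto
  have "\<psi> x \<in> \<real>" if "x \<in> \<real>" "x \<in> ball 0 \<epsilon>" for x
    using deriv_in_Reals[OF K, of 0] K(2)[OF that] \<epsilon> c that by (auto simp: \<psi>_def intro!: Reals_divide Reals_diff)
  then have lr: "l x \<in> \<real>" if "x \<in> \<real>" "x \<in> ball 0 \<epsilon>" for x
    by (intro primitive_in_Reals[OF l(2) _ _ that]) (simp_all add: l(1))
  have reg: "deriv \<phi> s \<noteq> 0" if "s \<in> H" for s
    by (rule holomorphic_injective_imp_regular[OF hol H(1) inj that])
  \<comment> \<open>The reciprocal of the expected \<open>s powr (c - 1) * exp (l s)\<close>, so the
    claim becomes that \<open>deriv \<phi> s * q s\<close> is constant.\<close>
  define q where "q s = exp (- (of_real (c - 1) * Ln s) - l s)" for s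
  have "((\<lambda>s. deriv \<phi> s * q s) has_field_derivative 0) (at s within H)" if s: "s \<in> H" for s
  proof -
    have s0: "s \<notin> \<real>\<^sub>\<le>\<^sub>0" "s \<noteq> 0" "s \<in> ball 0 \<epsilon>"
      using s upper_half_plane_Ln[of s] by (auto simp: H_def)
    have "(q has_field_derivative q s * (- (of_real (c - 1) * inverse s) - \<psi> s)) (at s)"
      unfolding q_def[abs_def]
      by (rule DERIV_chain2[OF DERIV_exp DERIV_diff[OF DERIV_minus[OF DERIV_cmult[OF
          has_field_derivative_Ln[OF s0(1)]]] l(2)[OF s0(3)]]])
    from DERIV_mult[OF holomorphic_derivI[OF holomorphic_deriv[OF hol H(1)] H(1) s] this]
    have "((\<lambda>s. deriv \<phi> s * q s) has_field_derivative
        deriv (deriv \<phi>) s * q s + q s * (- (of_real (c - 1) * inverse s) - \<psi> s) * deriv \<phi> s) (at s)" .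
    also have "deriv (deriv \<phi>) s = K s / s * deriv \<phi> s"
      using ode[OF s] reg[OF s] by (simp add: field_simps)
    also have "K s / s * deriv \<phi> s * q s + q s * (- (of_real (c - 1) * inverse s) - \<psi> s) * deriv \<phi> s = 0"
      using s0 by (simp add: \<psi>_def c field_simps)
    finally show ?thesis by (rule has_field_derivative_at_within)
  qed
  from has_field_derivative_zero_constant[OF H(2) this]
  obtain C where C: "\<And>s. s \<in> H \<Longrightarrow> deriv \<phi> s * q s = C" by blast
  show ?thesis
  proof (rule that[of C "\<lambda>s. exp (l s)"])
    show "C \<noteq> 0" using C[OF H(3)[OF \<epsilon>]] reg[OF H(3)[OF \<epsilon>]] by (auto simp: q_def)
    show "(\<lambda>s. exp (l s)) holomorphic_on ball 0 \<epsilon>"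
    proof -
      have "l holomorphic_on ball 0 \<epsilon>"
        using l(2) unfolding holomorphic_on_open[OF open_ball] by blast
      then show ?thesis by (rule holomorphic_on_exp')
    qed
    show "deriv \<phi> s = C * s powr of_real (c - 1) * exp (l s)" if "s \<in> H" for s
    proof -
      have "C * s powr of_real (c - 1) * exp (l s) = deriv \<phi> s * (q s * (s powr of_real (c - 1) * exp (l s)))"
        by (simp add: C[OF that, symmetric])
      also have "q s * (s powr of_real (c - 1) * exp (l s)) = 1"
        using that by (auto simp: q_def powr_def H_def simp flip: exp_add)
      finally show ?thesis by simp
    qed
    show "exp (l x) \<in> \<real>" if "x \<in> \<real>" "x \<in> ball 0 \<epsilon>" for x
      using lr[OF that] by (auto elim!: Reals_cases simp: exp_of_real)
  qed (simp add: l)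
qed

text \<open>Down the imaginary axis the derivative of \<phi> is a constant times
  \<open>y powr (c - 1) * g (\<i> * y)\<close>. If \<open>c \<le> 0\<close> and \<open>g\<close> is
  near 1, its real part, after normalisation, is at least \<open>1 / (2 * y)\<close>, whose
  primitive is unbounded near 0.\<close>

lemma bounded_fuchsian_exponent_pos:
  fixes \<phi> g :: "complex \<Rightarrow> complex" and \<epsilon> c :: real
  defines "H \<equiv> ball 0 \<epsilon> \<inter> {s. Im s > 0}"
  assumes \<epsilon>: "\<epsilon> > 0" and hol: "\<phi> holomorphic_on H" and bd: "bounded (\<phi> ` H)"
    and C: "C \<noteq> 0" and g: "g holomorphic_on ball 0 \<epsilon>" "g 0 = 1"
    and d: "\<And>s. s \<in> H \<Longrightarrow> deriv \<phi> s = C * s powr of_real (c - 1) * g s"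
  shows "c > 0"
proof (rule ccontr)
  assume c: "\<not> c > 0"
  note H = upper_half_disc[of \<epsilon>, folded H_def]
  have "isCont g 0"
    using g(1) \<epsilon> by (intro holomorphic_on_imp_isCont[OF _ open_ball]) auto
  then have "\<forall>\<^sub>F s in nhds 0. dist (g s) (g 0) < 1 / 2"
    unfolding isCont_def tendsto_at_iff_tendsto_nhds by (intro tendstoD) simp_all
  then obtain d0 where d0: "d0 > 0" "\<And>s. dist s 0 < d0 \<Longrightarrow> dist (g s) (g 0) < 1 / 2"
    unfolding eventually_nhds_metric by auto
  define \<delta> where "\<delta> = min (min d0 \<epsilon>) 1 / 2"
  have \<delta>: "\<delta> > 0" "\<delta> < d0" "\<delta> < \<epsilon>" "\<delta> < 1" using d0(1) \<epsilon> by (auto simp: \<delta>_def)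
  \<comment> \<open>This is \<open>\<i> powr (c - 1)\<close>. Dividing by
    \<open>A = \<i> * C * u\<close> makes the derivative along the axis nearly real and
    positive.\<close>
  define u where "u = exp (of_real (c - 1) * (\<i> * of_real (pi / 2)))"
  define A where "A = \<i> * C * u"
  have A: "A \<noteq> 0" using C by (simp add: A_def u_def)
  define E where "E y = Re (\<phi> (\<i> * of_real y) / A) - ln y / 2" for y
  have iyH: "\<i> * of_real y \<in> H" if "0 < y" "y \<le> \<delta>" for y
    using that \<delta> by (simp add: H_def norm_mult)
  have E': "(E has_real_derivative y powr (c - 1) * Re (g (\<i> * of_real y)) - 1 / (2 * y)) (at y)"
    if y: "0 < y" "y \<le> \<delta>" for y
  proof -
    have Ln: "Ln (\<i> * of_real y) = of_real (ln y) + \<i> * of_real (pi / 2)"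
      using y by (simp add: Ln_times_of_real mult.commute[of \<i>] Ln_Reals_eq)
    have pw: "(\<i> * of_real y) powr of_real (c - 1) = of_real (y powr (c - 1)) * u"
      using y by (simp add: powr_def Ln u_def distrib_left exp_add exp_of_real[symmetric])
    have "((\<lambda>y. \<phi> (\<i> * of_real y)) has_vector_derivative \<i> * deriv \<phi> (\<i> * of_real y)) (at y)"
    proof -
      have "((\<lambda>z. \<phi> (\<i> * z)) has_field_derivative deriv \<phi> (\<i> * of_real y) * \<i>) (at (of_real y))"
        by (rule DERIV_chain2[where g="\<lambda>z. \<i> * z", OF holomorphic_derivI[OF hol H(1) iyH[OF y]]])
           (auto intro!: derivative_eq_intros)
      from has_vector_derivative_real_field[OF this] show ?thesis by (simp add: mult.commute)
    qed
    then have "((\<lambda>y. \<phi> (\<i> * of_real y) / A) has_vector_derivative \<i> * deriv \<phi> (\<i> * of_real y) / A) (at y)"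
      by (rule has_vector_derivative_divide)
    also have "\<i> * deriv \<phi> (\<i> * of_real y) / A = of_real (y powr (c - 1)) * g (\<i> * of_real y)"
    proof -
      have "\<i> * deriv \<phi> (\<i> * of_real y) = A * (of_real (y powr (c - 1)) * g (\<i> * of_real y))"
        unfolding d[OF iyH[OF y]] pw A_def by (simp only: mult_ac)
      then show ?thesis using A by simp
    qed
    finally have "((\<lambda>y. Re (\<phi> (\<i> * of_real y) / A)) has_vector_derivative
        Re (of_real (y powr (c - 1)) * g (\<i> * of_real y))) (at y)"
      by (rule bounded_linear.has_vector_derivative[OF bounded_linear_Re])
    then have "((\<lambda>y. Re (\<phi> (\<i> * of_real y) / A)) has_real_derivative
        y powr (c - 1) * Re (g (\<i> * of_real y))) (at y)"
      by (simp add: has_real_derivative_iff_has_vector_derivative)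
    from DERIV_diff[OF this DERIV_cdivide[OF DERIV_ln_divide[OF y(1)], of 2]]
    show ?thesis by (simp add: E_def[abs_def] mult.commute)
  qed
  have E'nn: "y powr (c - 1) * Re (g (\<i> * of_real y)) - 1 / (2 * y) \<ge> 0" if y: "0 < y" "y \<le> \<delta>" for y
  proof -
    have "dist (g (\<i> * of_real y)) 1 < 1 / 2" using d0(2)[of "\<i> * of_real y"] y \<delta> g(2) by (simp add: norm_mult)
    then have "\<bar>Re (g (\<i> * of_real y) - 1)\<bar> < 1 / 2"
      unfolding dist_norm using abs_Re_le_cmod le_less_trans by blast
    then have "Re (g (\<i> * of_real y)) \<ge> 1 / 2" by (auto simp: abs_if split: if_splits)
    moreover have "y powr (c - 1) \<ge> y powr (- 1)"
      using y \<delta> c by (intro powr_mono') auto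
    ultimately have "y powr (- 1) * (1 / 2) \<le> y powr (c - 1) * Re (g (\<i> * of_real y))"
      by (intro mult_mono) auto
    then show ?thesis using y by (simp add: powr_minus field_simps)
  qed
  obtain M where M: "\<And>s. s \<in> H \<Longrightarrow> norm (\<phi> s) \<le> M"
    using bd by (auto simp: bounded_iff)
  \<comment> \<open>Since \<open>ln y \<le> - 2 * B\<close> and
    \<open>norm (\<phi> s) \<le> M\<close>, the choice gives
    \<open>E y \<ge> E \<delta> + 1\<close>, against the monotonicity of \<open>E\<close>.\<close>
  define B where "B = E \<delta> + M / norm A + 1"
  define y where "y = min \<delta> (exp (- 2 * B))"
  have y: "0 < y" "y \<le> \<delta>" using \<delta> by (auto simp: y_def)
  have "E y \<le> E \<delta>"
  proof (rule DERIV_nonneg_imp_nondecreasing[OF y(2)])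
    fix x assume "y \<le> x" "x \<le> \<delta>"
    then have x: "0 < x" "x \<le> \<delta>" using y(1) by auto
    show "\<exists>D. DERIV E x :> D \<and> D \<ge> 0" using E'[OF x] E'nn[OF x] by blast
  qed
  moreover have "\<bar>Re (\<phi> (\<i> * of_real y) / A)\<bar> \<le> norm (\<phi> (\<i> * of_real y)) / norm A"
    using abs_Re_le_cmod[of "\<phi> (\<i> * of_real y) / A"] by (simp add: norm_divide)
  moreover have "norm (\<phi> (\<i> * of_real y)) / norm A \<le> M / norm A"
    using M[OF iyH[OF y]] by (intro divide_right_mono) auto
  moreover have "ln y \<le> ln (exp (- 2 * B))" using y(1) by (intro ln_mono) (auto simp: y_def)
  ultimately show False by (simp add: E_def B_def)
qed

section \<open>Corners of conformal maps\<close>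

text \<open>The two rays bounding the sector are boundary values of \<open>\<phi>\<close> at points of \<open>\<Gamma>\<close>.\<close>

definition covers_sector ::
    "(complex \<Rightarrow> complex) \<Rightarrow> complex set \<Rightarrow> complex set \<Rightarrow> complex \<Rightarrow> real \<Rightarrow> real \<Rightarrow> real \<Rightarrow> bool" where
  "covers_sector \<phi> H \<Gamma> w \<alpha> L \<rho> \<longleftrightarrow>
     (\<forall>x \<theta>. 0 < x \<and> x < \<rho> \<and> \<alpha> < \<theta> \<and> \<theta> < \<alpha> + L \<longrightarrow> w + of_real x * cis \<theta> \<in> \<phi> ` H) \<and>
     (\<forall>x \<theta>. 0 < x \<and> x < \<rho> \<and> (\<theta> = \<alpha> \<or> \<theta> = \<alpha> + L) \<longrightarrow>
        (\<exists>\<sigma> s0. (\<forall>n::nat. \<sigma> n \<in> H) \<and> \<sigma> \<longlonglongrightarrow> s0 \<and> s0 \<in> \<Gamma> \<and>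
           (\<lambda>n. \<phi> (\<sigma> n)) \<longlonglongrightarrow> w + of_real x * cis \<theta>))"

text \<open>
  With \<open>F s = s * (c * G s) powr (1 / c)\<close> the map becomes \<open>w + D * F s powr c\<close>, where \<open>F\<close> is conformal
  at \<open>0\<close> and real on the real axis, so it straightens the half disc without bending its boundary.
\<close>

lemma fuchsian_corner_sector:
  fixes \<phi> g :: "complex \<Rightarrow> complex" and \<epsilon> c :: real
  defines "H \<equiv> ball 0 \<epsilon> \<inter> {s. Im s > 0}"
  assumes \<epsilon>: "\<epsilon> > 0" and hol: "\<phi> holomorphic_on H" and c: "c > 0"
    and C: "C \<noteq> 0" and g: "g holomorphic_on ball 0 \<epsilon>" "g 0 = 1"
    and gr: "\<And>x. x \<in> \<real> \<Longrightarrow> x \<in> ball 0 \<epsilon> \<Longrightarrow> g x \<in> \<real>"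
    and d: "\<And>s. s \<in> H \<Longrightarrow> deriv \<phi> s = C * s powr of_real (c - 1) * g s"
  obtains w \<alpha> \<rho> where "\<rho> > 0" "(\<phi> \<longlongrightarrow> w) (at 0 within H)"
    "covers_sector \<phi> H (\<real> \<inter> ball 0 \<epsilon>) w \<alpha> (pi * c) \<rho>"
proof -
  note H = upper_half_disc[of \<epsilon>, folded H_def]
  obtain G \<delta> where \<delta>: "\<delta> > 0" "\<delta> \<le> \<epsilon>" and G: "G holomorphic_on ball 0 \<delta>"
    "\<And>x. x \<in> \<real> \<Longrightarrow> x \<in> ball 0 \<delta> \<Longrightarrow> G x \<in> \<real>"
    "\<And>s. s \<in> ball 0 \<delta> \<Longrightarrow> of_real c * G s + s * deriv G s = g s"
    by (rule frobenius_primitive[OF g(1) \<epsilon> c gr]) auto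
  define H' where "H' = ball 0 \<delta> \<inter> {s. Im s > 0}"
  note H' = upper_half_disc[of \<delta>, folded H'_def]
  have HH: "H' \<subseteq> H" using \<delta> by (auto simp: H_def H'_def)
  have "((\<lambda>s. \<phi> s - C * (s powr of_real c * G s)) has_field_derivative 0) (at s within H')" if s: "s \<in> H'" for s
  proof -
    have s0: "s \<notin> \<real>\<^sub>\<le>\<^sub>0" "s \<noteq> 0" "s \<in> ball 0 \<delta>" "s \<in> H"
      using s upper_half_plane_Ln[of s] HH by (auto simp: H'_def)
    have p: "s powr of_real c = s * s powr of_real (c - 1)"
      using s0 powr_add[of s 1 "of_real (c - 1)"] by simp
    have "((\<lambda>s. \<phi> s - C * (s powr of_real c * G s)) has_field_derivative
       deriv \<phi> s - C * (of_real c * s powr (of_real c - 1) * G s + deriv G s * s powr of_real c)) (at s)"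
      by (intro DERIV_diff DERIV_cmult DERIV_mult holomorphic_derivI[OF hol H(1) s0(4)]
          has_field_derivative_powr[OF s0(1)] holomorphic_derivI[OF G(1) open_ball s0(3)])
    also have "deriv \<phi> s - C * (of_real c * s powr (of_real c - 1) * G s + deriv G s * s powr of_real c)
      = C * s powr of_real (c - 1) * (g s - (of_real c * G s + s * deriv G s))"
      unfolding d[OF s0(4)] p by (simp add: algebra_simps)
    also have "\<dots> = 0" using G(3)[OF s0(3)] by simp
    finally show ?thesis by (rule has_field_derivative_at_within)
  qed
  from has_field_derivative_zero_constant[OF H'(2) this]
  obtain w where w: "\<And>s. s \<in> H' \<Longrightarrow> \<phi> s = w + C * (s powr of_real c * G s)"
    by (metis diff_add_cancel)
  have Gc: "isCont G 0"
    using G(1) \<delta> by (intro holomorphic_on_imp_isCont[OF _ open_ball]) auto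
  have G0: "of_real c * G 0 = 1" using G(3)[of 0] \<delta> g(2) by simp
  have lim0: "(\<phi> \<longlongrightarrow> w) (at 0 within H)"
  proof -
    have "((\<lambda>s::complex. s powr of_real c) \<longlongrightarrow> 0) (at 0 within H)"
    proof (rule tendsto_norm_zero_cancel)
      have "((\<lambda>s::complex. norm s powr c) \<longlongrightarrow> 0 powr c) (at 0 within H)"
        by (rule tendsto_powr') (auto intro!: tendsto_eq_intros simp: c)
      then show "((\<lambda>s::complex. norm (s powr of_real c)) \<longlongrightarrow> 0) (at 0 within H)"
        by (simp add: norm_powr_real_powr')
    qed
    moreover have "(G \<longlongrightarrow> G 0) (at 0 within H)"
      using Gc continuous_at_imp_continuous_at_within continuous_within by blast
    ultimately have "((\<lambda>s. w + C * (s powr of_real c * G s)) \<longlongrightarrow> w + C * (0 * G 0)) (at 0 within H)"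
      by (intro tendsto_intros)
    then have "((\<lambda>s. w + C * (s powr of_real c * G s)) \<longlongrightarrow> w) (at 0 within H)" by simp
    moreover have "\<forall>\<^sub>F s in at 0 within H. w + C * (s powr of_real c * G s) = \<phi> s"
      unfolding eventually_at using \<delta> w by (auto simp: H_def H'_def intro!: exI[of _ \<delta>])
    ultimately show ?thesis by (rule Lim_transform_eventually)
  qed
  \<comment> \<open>\<open>exp (L s)\<close> is \<open>(c * G s) powr (1 / c)\<close>; the principal
    branch is available near 0 because \<open>c * G 0 = 1\<close>.\<close>
  define L where "L s = Ln (of_real c * G s) / of_real c" for s
  have "\<forall>\<^sub>F s in nhds 0. dist (of_real c * G s) (of_real c * G 0) < 1"
    using Gc unfolding isCont_def tendsto_at_iff_tendsto_nhds by (intro tendstoD tendsto_intros) simp_all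
  then obtain d1 where d1: "d1 > 0" "\<And>s. dist s 0 < d1 \<Longrightarrow> dist (of_real c * G s) 1 < 1"
    unfolding eventually_nhds_metric G0 by auto
  define \<eta>0 where "\<eta>0 = min \<delta> d1"
  have nonneg: "of_real c * G s \<notin> \<real>\<^sub>\<le>\<^sub>0" if "s \<in> ball 0 \<eta>0" for s
  proof
    assume "of_real c * G s \<in> \<real>\<^sub>\<le>\<^sub>0"
    then have "Re (of_real c * G s) \<le> 0" by (simp only: complex_nonpos_Reals_iff)
    moreover have "norm (of_real c * G s - 1) < 1" using d1(2)[of s] that by (simp add: \<eta>0_def dist_norm)
    ultimately show False using abs_Re_le_cmod[of "of_real c * G s - 1"] by simp
  qed
  have Lhol: "L holomorphic_on ball 0 \<eta>0"
    unfolding L_def using nonneg c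
    by (intro holomorphic_intros holomorphic_on_subset[OF G(1)]) (auto simp: \<eta>0_def)
  have \<eta>0: "\<eta>0 > 0" "\<eta>0 \<le> \<delta>" using \<delta> d1 by (auto simp: \<eta>0_def)
  have L0: "L 0 = 0" by (simp add: L_def G0)
  have "isCont L 0"
    using Lhol \<eta>0 by (intro holomorphic_on_imp_isCont[OF _ open_ball]) auto
  then have "\<forall>\<^sub>F s in nhds 0. dist (L s) (L 0) < 1"
    unfolding isCont_def tendsto_at_iff_tendsto_nhds by (intro tendstoD) simp_all
  \<comment> \<open>The bound 1 on \<open>L\<close> is below pi, which later excludes a jump between
    branches of \<open>Ln\<close>.\<close>
  then obtain d2 where d2: "d2 > 0" "\<And>s. dist s 0 < d2 \<Longrightarrow> norm (L s) < 1"
    unfolding eventually_nhds_metric L0 by (auto simp: dist_norm)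
  define F where "F s = s * exp (L s)" for s
  have Fhol: "F holomorphic_on ball 0 \<eta>0"
    unfolding F_def by (intro holomorphic_intros Lhol)
  have "(F has_field_derivative 1) (at 0)"
    unfolding F_def[abs_def] using holomorphic_derivI[OF Lhol open_ball, of 0] \<eta>0 L0
    by (auto intro!: derivative_eq_intros)
  then have F'0: "deriv F 0 = 1" by (rule DERIV_imp_deriv)
  obtain \<eta>1 where \<eta>1: "\<eta>1 > 0" "ball (0::complex) \<eta>1 \<subseteq> ball 0 \<eta>0 \<inter> ball 0 d2" "inj_on F (ball 0 \<eta>1)"
  proof (rule has_complex_derivative_locally_injective[of F "ball 0 \<eta>0 \<inter> ball 0 d2" 0])
    show "F holomorphic_on ball 0 \<eta>0 \<inter> ball 0 d2" by (rule holomorphic_on_subset[OF Fhol]) simp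
  qed (use \<eta>0 d2(1) F'0 in auto)
  define V where "V = ball (0::complex) \<eta>1"
  have FV: "F holomorphic_on V" unfolding V_def by (rule holomorphic_on_subset[OF Fhol]) (use \<eta>1(2) in blast)
  obtain \<Psi> where \<Psi>: "\<Psi> holomorphic_on F ` V" "\<And>z. z \<in> V \<Longrightarrow> deriv F z * deriv \<Psi> (F z) = 1"
      "\<And>z. z \<in> V \<Longrightarrow> \<Psi> (F z) = z"
    using holomorphic_has_inverse[OF FV _ \<eta>1(3)[folded V_def]] by (auto simp: V_def)
  have oFV: "open (F ` V)"
    by (rule open_mapping_thm3[OF FV _ \<eta>1(3)[folded V_def]]) (simp add: V_def)
  have F0: "F 0 = 0" "0 \<in> V" using \<eta>1 by (auto simp: F_def V_def)
  then obtain r where r: "r > 0" "ball 0 r \<subseteq> F ` V"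
    using oFV unfolding open_contains_ball by (metis image_eqI)
  have \<Psi>V: "\<Psi> v \<in> V" "F (\<Psi> v) = v" if "v \<in> ball 0 r" for v
    using r(2) that \<Psi>(3) by auto
  have VF: "norm (L s) < 1" "s \<in> ball 0 \<eta>0" "s \<in> ball 0 \<delta>" if "s \<in> V" for s
  proof -
    have "s \<in> ball 0 \<eta>0" "s \<in> ball 0 d2" using that \<eta>1(2) unfolding V_def by blast+
    then show "norm (L s) < 1" "s \<in> ball 0 \<eta>0" "s \<in> ball 0 \<delta>" using d2(2)[of s] \<eta>0 by auto
  qed
  \<comment> \<open>Reality of \<open>c * G s\<close> is not enough for a real logarithm; positivity
    comes from its avoiding the branch cut.\<close>
  have Freal: "F s \<in> \<real>" if "s \<in> \<real>" "s \<in> V" for s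
  proof -
    have "of_real c * G s \<in> \<real>" using G(2)[OF that(1) VF(3)[OF that(2)]] by (intro Reals_mult) auto
    then obtain t where t: "of_real c * G s = of_real t" by (auto elim: Reals_cases)
    have "t > 0" using nonneg[OF VF(2)[OF that(2)]] unfolding t by (simp add: complex_nonpos_Reals_iff)
    then have "Ln (of_real c * G s) \<in> \<real>" unfolding t by (simp add: Ln_of_real)
    then have "L s \<in> \<real>" unfolding L_def by (intro Reals_divide) auto
    then have "exp (L s) \<in> \<real>" by (auto elim!: Reals_cases simp: exp_of_real)
    then show ?thesis unfolding F_def using that(1) by (intro Reals_mult)
  qed
  have \<Psi>hol: "\<Psi> holomorphic_on ball 0 r" using holomorphic_on_subset[OF \<Psi>(1) r(2)] .
  have \<Psi>cont: "isCont \<Psi> v" if "v \<in> ball 0 r" for v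
    using \<Psi>hol that by (intro holomorphic_on_imp_isCont[OF _ open_ball])
  have Im_nz: "Im (\<Psi> v) \<noteq> 0" if "v \<in> ball 0 r" "Im v \<noteq> 0" for v
    using Freal[of "\<Psi> v"] \<Psi>V[OF that(1)] that(2) by (auto simp: complex_is_Real_iff)
  have der1: "(\<Psi> has_field_derivative 1) (at 0)"
    using holomorphic_derivI[OF \<Psi>hol open_ball, of 0] r \<Psi>(2)[OF F0(2)] F0(1) F'0 by simp
  have conn: "connected ((\<lambda>v. Im (\<Psi> v)) ` S)" if "convex S" "S \<subseteq> ball 0 r" for S
    using that by (intro connected_continuous_image convex_connected continuous_on_Im
        holomorphic_on_imp_continuous_on[OF holomorphic_on_subset[OF \<Psi>hol]])
  have \<Psi>0: "\<Psi> 0 = 0" using \<Psi>(3)[OF F0(2)] F0(1) by simp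
  have ratio: "((\<lambda>v. \<Psi> v / v) \<longlongrightarrow> 1) (at 0)"
    using der1 unfolding has_field_derivative_iff by (simp add: \<Psi>0)
  \<comment> \<open>\<Psi> takes no non-real point to the real axis, so \<open>Im (\<Psi> v)\<close>
    has constant sign on each half of the disc and one test point decides it. At modulus
    \<open>y0\<close> the quotient \<open>\<Psi> v / v\<close> is close to 1, so the sign there is
    that of \<open>Im v\<close>.\<close>
  obtain y0 where y0: "0 < y0" "y0 < r" "\<And>v. norm v = y0 \<Longrightarrow> norm (\<Psi> v / v - 1) < 1"
  proof -
    have "\<forall>\<^sub>F v in at 0. dist (\<Psi> v / v) 1 < 1" using ratio by (rule tendstoD) simp
    then obtain d where d: "d > 0" "\<And>v. v \<noteq> 0 \<Longrightarrow> norm v < d \<Longrightarrow> norm (\<Psi> v / v - 1) < 1"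
      unfolding eventually_at by (auto simp: dist_norm)
    show ?thesis
    proof (rule that[of "min d r / 2"])
      fix v :: complex assume v: "norm v = min d r / 2"
      then have "norm v < d" "norm v \<noteq> 0" using d(1) r(1) by auto
      then show "norm (\<Psi> v / v - 1) < 1" by (intro d(2)) auto
    qed (use d(1) r(1) in auto)
  qed
  have Re_ratio: "Re (\<Psi> v / v) > 0" if "norm v = y0" for v
    using y0(3)[OF that] abs_Re_le_cmod[of "\<Psi> v / v - 1"] by simp
  have upper: "Im (\<Psi> v) > 0" if v: "v \<in> ball 0 r" "Im v > 0" for v
  proof (rule ccontr)
    assume n: "\<not> Im (\<Psi> v) > 0"
    let ?S = "ball 0 r \<inter> {s. Im s > 0}"
    let ?p = "\<i> * of_real y0"
    have p: "?p \<in> ?S" using y0 by (simp add: norm_mult)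
    have "Re (\<Psi> ?p / ?p) > 0" using y0 by (intro Re_ratio) (simp add: norm_mult)
    then have "Im (\<Psi> ?p) > 0" using y0(1) by (simp add: Re_divide zero_less_divide_iff divide_less_0_iff power2_eq_square)
    then have "0 \<in> (\<lambda>v. Im (\<Psi> v)) ` ?S"
      using n p v connectedD_interval[OF conn[OF upper_half_disc(2)[of r]], of "Im (\<Psi> v)" "Im (\<Psi> ?p)" 0] by auto
    then show False using Im_nz by force
  qed
  have lower: "Im (\<Psi> v) < 0" if v: "v \<in> ball 0 r" "Im v < 0" for v
  proof (rule ccontr)
    assume n: "\<not> Im (\<Psi> v) < 0"
    let ?S = "ball 0 r \<inter> {s. Im s < 0}"
    let ?p = "- \<i> * of_real y0"
    have S: "convex ?S" by (intro convex_Int convex_ball convex_halfspace_Im_lt)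
    have p: "?p \<in> ?S" using y0 by (simp add: norm_mult)
    have "Re (\<Psi> ?p / ?p) > 0" using y0 by (intro Re_ratio) (simp add: norm_mult)
    then have "Im (\<Psi> ?p) < 0" using y0(1) by (simp add: Re_divide zero_less_divide_iff divide_less_0_iff power2_eq_square)
    then have "0 \<in> (\<lambda>v. Im (\<Psi> v)) ` ?S"
      using n p v connectedD_interval[OF conn[OF S], of "Im (\<Psi> ?p)" "Im (\<Psi> v)" 0] by auto
    then show False using Im_nz by force
  qed
  \<comment> \<open>A real point is a limit of points from both halves, on which
    \<open>Im (\<Psi> v)\<close> has opposite signs.\<close>
  have real: "Im (\<Psi> v) = 0" if v: "v \<in> ball 0 r" "Im v = 0" for v
  proof -
    have *: "((\<lambda>t. Im (\<Psi> (v + of_real t * u))) \<longlongrightarrow> Im (\<Psi> v)) (at_right 0)" for u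
    proof -
      have "((\<lambda>t. v + of_real t * u) \<longlongrightarrow> v) (at_right 0)" by (auto intro!: tendsto_eq_intros)
      then show ?thesis by (intro tendsto_Im isCont_tendsto_compose[OF \<Psi>cont[OF v(1)]])
    qed
    have ev: "\<forall>\<^sub>F t in at_right 0. t > 0 \<and> v + of_real t * u \<in> ball 0 r" for u
    proof (intro eventually_conj eventually_at_right_less)
      have "((\<lambda>t. v + of_real t * u) \<longlongrightarrow> v) (at_right 0)" by (auto intro!: tendsto_eq_intros)
      then show "\<forall>\<^sub>F t in at_right 0. v + of_real t * u \<in> ball 0 r"
        using v(1) by (intro topological_tendstoD[of _ v]) auto
    qed
    have "Im (\<Psi> v) \<ge> 0"
      by (rule tendsto_lowerbound[OF *[of \<i>]])
         (use ev[of \<i>] v in \<open>auto elim!: eventually_mono intro!: less_imp_le upper\<close>)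
    moreover have "Im (\<Psi> v) \<le> 0"
      by (rule tendsto_upperbound[OF *[of "- \<i>"]])
         (use ev[of "- \<i>"] v in \<open>auto elim!: eventually_mono intro!: less_imp_le lower\<close>)
    ultimately show ?thesis by simp
  qed
  have \<Psi>H: "\<Psi> v \<in> H'" if "v \<in> ball 0 r" "Im v > 0" for v
    using VF(3)[OF \<Psi>V(1)[OF that(1)]] upper[OF that] by (simp add: H'_def)
  have \<phi>\<Psi>: "\<phi> (\<Psi> v) = w + C / of_real c * v powr of_real c" if v: "v \<in> ball 0 r" "Im v > 0" for v
  proof -
    define s where "s = \<Psi> v"
    have s: "s \<in> H'" "s \<in> V" "F s = v" using \<Psi>H[OF v] \<Psi>V[OF v(1)] by (auto simp: s_def)
    then have ims: "Im s > 0" "s \<noteq> 0" by (auto simp: H'_def)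
    have v0: "v \<noteq> 0" using v by auto
    have "exp (Ln v) = exp (Ln s + L s)" using s(3) ims v0 by (simp add: exp_add F_def)
    \<comment> \<open>\<open>F s = v\<close> determines the logarithms only modulo
      \<open>2 * pi * \<i>\<close>. The imaginary parts of \<open>Ln v\<close> and
      \<open>Ln s\<close> lie between 0 and pi and that of \<open>L s\<close> has modulus below 1,
      so the difference is less than \<open>2 * pi\<close> and \<open>k = 0\<close>.\<close>
    then obtain k :: int where k: "Ln v = Ln s + L s + of_int (2 * k) * pi * \<i>"
      by (auto simp: exp_eq)
    have "\<bar>Im (Ln v - Ln s - L s)\<bar> < 2 * pi"
    proof -
      have "0 < Im (Ln v)" "Im (Ln v) < pi" "0 < Im (Ln s)" "Im (Ln s) < pi"
        using v(2) ims v0 by (simp_all add: Im_Ln_pos_lt_imp Im_Ln_pos_lt)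
      moreover have "\<bar>Im (L s)\<bar> < 1" using VF(1)[OF s(2)] abs_Im_le_cmod le_less_trans by blast
      ultimately show ?thesis using pi_gt3 by (simp add: abs_less_iff)
    qed
    then have "\<bar>of_int k :: real\<bar> < 1" by (simp add: k abs_mult)
    then have "k = 0" by linarith
    then have Lnv: "Ln v = Ln s + L s" using k by simp
    have cG: "of_real c * G s \<noteq> 0" using nonneg[OF VF(2)[OF s(2)]] by auto
    have "v powr of_real c = exp (of_real c * Ln s) * exp (of_real c * L s)"
      using v0 by (simp add: powr_def Lnv distrib_left exp_add)
    also have "\<dots> = s powr of_real c * (of_real c * G s)"
      using ims cG c by (simp add: powr_def L_def)
    finally show ?thesis using w[OF s(1)] c by (simp add: s_def)
  qed
  define D where "D = C / of_real c"
  have D: "D \<noteq> 0" using C c by (simp add: D_def)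
  define \<rho> where "\<rho> = norm D * r powr c"
  define \<alpha> where "\<alpha> = Arg D"
  \<comment> \<open>The modulus of \<open>v\<close> for which the image point has distance
    \<open>x\<close> from \<open>w\<close>.\<close>
  define R where "R x = (x / norm D) powr (1 / c)" for x
  have R: "0 < R x" "R x < r" "R x powr c * norm D = x" if "0 < x" "x < \<rho>" for x
  proof -
    have x: "0 < x / norm D" "x / norm D < r powr c" using that D by (auto simp: \<rho>_def field_simps)
    show "0 < R x" using x(1) D that by (simp add: R_def)
    have "R x < (r powr c) powr (1 / c)"
      unfolding R_def using x c by (intro powr_less_mono2) auto
    then show "R x < r" using c r by (simp add: powr_powr)
    show "R x powr c * norm D = x" using x c D that by (simp add: R_def powr_powr)
  qed
  have pt: "of_real (R x) * cis t \<in> ball 0 r" "Im (of_real (R x) * cis t) > 0"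
      "\<phi> (\<Psi> (of_real (R x) * cis t)) = w + of_real x * cis (\<alpha> + c * t)"
    if x: "0 < x" "x < \<rho>" and t: "0 < t" "t < pi" for x t
  proof -
    show b: "of_real (R x) * cis t \<in> ball 0 r" using R[OF x] by (simp add: norm_mult)
    show i: "Im (of_real (R x) * cis t) > 0" using R[OF x] t by (simp add: sin_gt_zero)
    have "Ln (of_real (R x) * cis t) = of_real (ln (R x)) + \<i> * of_real t"
    proof (rule Ln_unique)
      show "exp (of_real (ln (R x)) + \<i> * of_real t) = of_real (R x) * cis t"
        using R[OF x] by (simp add: exp_add exp_of_real cis_conv_exp)
    qed (use t in auto)
    then have "(of_real (R x) * cis t) powr of_real c = of_real (R x powr c) * cis (c * t)"
      using R[OF x] by (simp add: powr_def distrib_left exp_add cis_conv_exp exp_of_real[symmetric] mult_ac)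
    moreover have "D = of_real (norm D) * cis \<alpha>"
      unfolding \<alpha>_def using rcis_cmod_Arg[of D] by (simp add: rcis_def)
    ultimately have "D * (of_real (R x) * cis t) powr of_real c =
        of_real (norm D) * cis \<alpha> * (of_real (R x powr c) * cis (c * t))" by metis
    also have "\<dots> = of_real (R x powr c * norm D) * cis (\<alpha> + c * t)"
      by (simp add: cis_mult[symmetric])
    also have "\<dots> = of_real x * cis (\<alpha> + c * t)" using R(3)[OF x] by simp
    finally show "\<phi> (\<Psi> (of_real (R x) * cis t)) = w + of_real x * cis (\<alpha> + c * t)"
      using \<phi>\<Psi>[OF b i] by (simp add: D_def)
  qed
  show ?thesis
  proof (rule that[of \<rho> w \<alpha>])
    show "\<rho> > 0" using D r by (simp add: \<rho>_def)
    show "(\<phi> \<longlongrightarrow> w) (at 0 within H)" by (rule lim0)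
    show "covers_sector \<phi> H (\<real> \<inter> ball 0 \<epsilon>) w \<alpha> (pi * c) \<rho>"
      unfolding covers_sector_def
    proof (intro conjI allI impI; elim conjE)
      fix x \<theta> assume x: "0 < x" "x < \<rho>" "\<alpha> < \<theta>" "\<theta> < \<alpha> + pi * c"
      define t where "t = (\<theta> - \<alpha>) / c"
      have t: "0 < t" "t < pi" "\<alpha> + c * t = \<theta>" using x c by (auto simp: t_def field_simps)
      show "w + of_real x * cis \<theta> \<in> \<phi> ` H"
        using pt[OF x(1,2) t(1,2)] \<Psi>H HH t(3) by (metis imageI subsetD)
    next
      fix x \<theta> assume x: "0 < x" "x < \<rho>" and \<theta>: "\<theta> = \<alpha> \<or> \<theta> = \<alpha> + pi * c"
      define t0 where "t0 = (if \<theta> = \<alpha> then 0 else pi)"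
      have t0: "\<theta> = \<alpha> + c * t0" using \<theta> by (auto simp: t0_def mult.commute)
      \<comment> \<open>The bounding rays are approached from within the sector: the angles tend to
        0 or to pi but stay strictly between them, because
        \<open>1 / (n + 1) \<le> 1 < pi\<close>.\<close>
      define \<tau> where "\<tau> n = (if \<theta> = \<alpha> then 1 / real (Suc n) else pi - 1 / real (Suc n))" for n
      have \<tau>: "0 < \<tau> n" "\<tau> n < pi" for n
      proof -
        define b where "b = 1 / real (Suc n)"
        have "0 < b" "b \<le> 1" by (auto simp: b_def)
        moreover have "\<tau> n = (if \<theta> = \<alpha> then b else pi - b)" by (simp add: \<tau>_def b_def)
        ultimately show "0 < \<tau> n" "\<tau> n < pi" using pi_gt3 by auto
      qed
      have \<tau>lim: "\<tau> \<longlonglongrightarrow> t0"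
      proof -
        have *: "(\<lambda>n. 1 / real (Suc n)) \<longlonglongrightarrow> 0" using LIMSEQ_inverse_real_of_nat by (simp add: inverse_eq_divide)
        show ?thesis
          using * tendsto_diff[OF tendsto_const[of pi] *] by (cases "\<theta> = \<alpha>") (simp_all add: \<tau>_def[abs_def] t0_def)
      qed
      have cislim: "(\<lambda>n. cis (f n)) \<longlonglongrightarrow> cis f0" if "f \<longlonglongrightarrow> f0" for f f0
        unfolding cis_conv_exp by (intro tendsto_intros that)
      have b0: "of_real (R x) * cis t0 \<in> ball 0 r" using R[OF x] by (simp add: norm_mult)
      show "\<exists>\<sigma> s0. (\<forall>n::nat. \<sigma> n \<in> H) \<and> \<sigma> \<longlonglongrightarrow> s0 \<and> s0 \<in> \<real> \<inter> ball 0 \<epsilon> \<and>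
          (\<lambda>n. \<phi> (\<sigma> n)) \<longlonglongrightarrow> w + of_real x * cis \<theta>"
      proof (intro exI conjI allI)
        show "\<Psi> (of_real (R x) * cis (\<tau> n)) \<in> H" for n
          using \<Psi>H[OF pt(1,2)[OF x \<tau>]] HH by blast
        show "(\<lambda>n. \<Psi> (of_real (R x) * cis (\<tau> n))) \<longlonglongrightarrow> \<Psi> (of_real (R x) * cis t0)"
          by (intro isCont_tendsto_compose[OF \<Psi>cont[OF b0]] tendsto_intros cislim \<tau>lim)
        show "\<Psi> (of_real (R x) * cis t0) \<in> \<real> \<inter> ball 0 \<epsilon>"
          using real[OF b0] VF(3)[OF \<Psi>V(1)[OF b0]] \<delta> by (simp add: complex_is_Real_iff t0_def)
        have "(\<lambda>n. w + of_real x * cis (\<alpha> + c * \<tau> n)) \<longlonglongrightarrow> w + of_real x * cis \<theta>"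
          unfolding t0 by (intro tendsto_intros cislim \<tau>lim)
        then show "(\<lambda>n. \<phi> (\<Psi> (of_real (R x) * cis (\<tau> n)))) \<longlonglongrightarrow> w + of_real x * cis \<theta>"
          by (simp only: pt(3)[OF x \<tau>])
      qed
    qed
  qed
qed

text \<open>Reality of \<open>K\<close> is asked only away from 0, since the boundary condition on
  \<open>f\<close> cannot be stated at the singular point; at 0 it follows by continuity.
  Boundedness of the image then makes the exponent positive, as Frobenius' method requires.\<close>

lemma half_disc_corner:
  fixes \<phi> K :: "complex \<Rightarrow> complex" and \<epsilon> :: real
  defines "H \<equiv> ball 0 \<epsilon> \<inter> {s. Im s > 0}"
  assumes \<epsilon>: "\<epsilon> > 0" and hol: "\<phi> holomorphic_on H" and inj: "inj_on \<phi> H" and bd: "bounded (\<phi> ` H)"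
    and K: "K holomorphic_on ball 0 \<epsilon>" "\<And>x. x \<in> \<real> \<Longrightarrow> x \<in> ball 0 \<epsilon> \<Longrightarrow> x \<noteq> 0 \<Longrightarrow> K x \<in> \<real>"
    and ode: "\<And>s. s \<in> H \<Longrightarrow> deriv (deriv \<phi>) s / deriv \<phi> s = K s / s"
  obtains c w \<alpha> \<rho> where "c > 0" "K 0 = of_real (c - 1)" "\<rho> > 0" "(\<phi> \<longlongrightarrow> w) (at 0 within H)"
    "covers_sector \<phi> H (\<real> \<inter> ball 0 \<epsilon>) w \<alpha> (pi * c) \<rho>"
proof -
  have "isCont K 0"
    using K(1) \<epsilon> by (intro holomorphic_on_imp_isCont[OF _ open_ball]) auto
  moreover have "(\<lambda>n. complex_of_real (\<epsilon> / 2 * inverse (real (Suc n)))) \<longlonglongrightarrow> of_real (\<epsilon> / 2 * 0)"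
    by (intro tendsto_intros LIMSEQ_inverse_real_of_nat)
  ultimately have lim: "(\<lambda>n. K (of_real (\<epsilon> / 2 * inverse (real (Suc n))))) \<longlonglongrightarrow> K 0"
    by (intro isCont_tendsto_compose[of _ K]) simp_all
  have "K (of_real (\<epsilon> / 2 * inverse (real (Suc n)))) \<in> \<real>" for n
  proof (rule K(2))
    have "\<epsilon> / 2 * inverse (real (Suc n)) \<le> \<epsilon> / 2 * 1"
      using \<epsilon> by (intro mult_left_mono) (auto simp: inverse_le_1_iff)
    then have "\<bar>\<epsilon> / 2 * inverse (real (Suc n))\<bar> < \<epsilon>" using \<epsilon> by (simp del: of_nat_Suc)
    then show "complex_of_real (\<epsilon> / 2 * inverse (real (Suc n))) \<in> ball 0 \<epsilon>"
      unfolding mem_ball dist_0_norm norm_of_real .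
    have "\<epsilon> / 2 * inverse (real (Suc n)) \<noteq> 0" using \<epsilon> by (simp del: of_nat_Suc)
    then show "complex_of_real (\<epsilon> / 2 * inverse (real (Suc n))) \<noteq> 0" by (simp only: of_real_eq_0_iff not_False_eq_True)
  qed simp
  then have "K 0 \<in> \<real>" by (rule closed_sequentially[OF closed_complex_Reals _ lim])
  then obtain k where "K 0 = of_real k" by (auto elim: Reals_cases)
  then have c: "K 0 = of_real ((k + 1) - 1)" by simp
  have Kr: "K x \<in> \<real>" if "x \<in> \<real>" "x \<in> ball 0 \<epsilon>" for x
    using K(2)[OF that] \<open>K 0 \<in> \<real>\<close> by (cases "x = 0") auto
  obtain C g where g: "C \<noteq> 0" "g holomorphic_on ball 0 \<epsilon>" "g 0 = 1"
    "\<And>x. x \<in> \<real> \<Longrightarrow> x \<in> ball 0 \<epsilon> \<Longrightarrow> g x \<in> \<real>"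
    "\<And>s. s \<in> H \<Longrightarrow> deriv \<phi> s = C * s powr of_real ((k + 1) - 1) * g s"
    using fuchsian_deriv_form[OF \<epsilon> hol[unfolded H_def] inj[unfolded H_def] K(1) Kr c ode[unfolded H_def]]
    unfolding H_def by blast
  have cp: "k + 1 > 0"
    by (rule bounded_fuchsian_exponent_pos[OF \<epsilon> hol[unfolded H_def] bd[unfolded H_def] g(1,2,3) g(5)[unfolded H_def]])
  show ?thesis
    using fuchsian_corner_sector[OF \<epsilon> hol[unfolded H_def] cp g(1,2,3,4) g(5)[unfolded H_def]]
      that[OF cp c] unfolding H_def by blast
qed

section \<open>Passage from the half disc to the unit disc by a Cayley map\<close>

lemma one_minus_i_mult_nonzero:
  fixes s :: complex
  assumes "norm s < 1"
  shows "1 - \<i> * s \<noteq> 0"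
proof
  assume "1 - \<i> * s = 0"
  then have "norm (\<i> * s) = norm (1::complex)" by simp
  then show False using assms by (simp add: norm_mult)
qed

text \<open>The numerator and the denominator have the moduli \<open>dist s \<i>\<close> and
  \<open>dist s (- \<i>)\<close>, whose squares differ by \<open>4 * Im s\<close>.\<close>

lemma cayley_norm_less_iff:
  fixes s :: complex
  assumes "norm s < 1"
  shows "norm ((1 + \<i> * s) / (1 - \<i> * s)) < 1 \<longleftrightarrow> Im s > 0"
    and "norm ((1 + \<i> * s) / (1 - \<i> * s)) = 1 \<longleftrightarrow> Im s = 0"
proof -
  have "1 - \<i> * s \<noteq> 0" by (rule one_minus_i_mult_nonzero[OF assms])
  then have p: "norm (1 - \<i> * s) > 0" by simp
  have sq: "(norm (1 - \<i> * s))\<^sup>2 - (norm (1 + \<i> * s))\<^sup>2 = 4 * Im s"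
    unfolding cmod_power2 by (simp add: power2_eq_square algebra_simps)
  have "norm ((1 + \<i> * s) / (1 - \<i> * s)) < 1 \<longleftrightarrow> norm (1 + \<i> * s) < norm (1 - \<i> * s)"
    using p by (simp add: norm_divide)
  also have "\<dots> \<longleftrightarrow> (norm (1 + \<i> * s))\<^sup>2 < (norm (1 - \<i> * s))\<^sup>2"
    using power2_less_imp_less power_strict_mono by (metis norm_ge_zero zero_less_numeral)
  finally show "norm ((1 + \<i> * s) / (1 - \<i> * s)) < 1 \<longleftrightarrow> Im s > 0" using sq by linarith
  have "norm ((1 + \<i> * s) / (1 - \<i> * s)) = 1 \<longleftrightarrow> norm (1 - \<i> * s) = norm (1 + \<i> * s)"
    using p by (auto simp: norm_divide)
  also have "\<dots> \<longleftrightarrow> (norm (1 - \<i> * s))\<^sup>2 = (norm (1 + \<i> * s))\<^sup>2" by simp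
  finally show "norm ((1 + \<i> * s) / (1 - \<i> * s)) = 1 \<longleftrightarrow> Im s = 0" using sq by linarith
qed

text \<open>Pulling back by the Cayley map \<open>Z\<close> multiplies the pre-Schwarzian by
  \<open>Z'\<close> and adds \<open>Z'' / Z' = 2 * \<i> / (1 - \<i> * s)\<close>. The added term
  cancels the real part \<open>- 1\<close> on the circle and so makes the coefficient real on the
  axis. The order \<open>m\<close> is arbitrary at the outset; \<open>m = 0\<close> covers boundary
  points at which the equation is regular.\<close>

lemma disc_corner:
  fixes f k :: "complex \<Rightarrow> complex" and \<zeta> :: complex and \<epsilon> :: real and m :: nat
  assumes hol: "f holomorphic_on ball 0 1 - {0}" and inj: "inj_on f (ball 0 1 - {0})"
    and \<zeta>: "norm \<zeta> = 1" and \<epsilon>: "0 < \<epsilon>" and bd: "bounded (f ` (ball 0 1 \<inter> ball \<zeta> \<epsilon> - {0}))"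
    and k: "k holomorphic_on ball \<zeta> \<epsilon>" "m > 0 \<Longrightarrow> k \<zeta> \<noteq> 0"
    and ode: "\<And>z. z \<in> ball 0 1 \<inter> ball \<zeta> \<epsilon> - {0} \<Longrightarrow> deriv (deriv f) z / deriv f z = k z / (z - \<zeta>) ^ m"
    and Re: "\<And>z. norm z = 1 \<Longrightarrow> z \<in> ball \<zeta> \<epsilon> \<Longrightarrow> z \<noteq> \<zeta> \<Longrightarrow> Re (z * (k z / (z - \<zeta>) ^ m)) = - 1"
  obtains c w \<alpha> \<rho> where "c > 0" "m \<le> 1" "of_real (c - 1) = (if m = 0 then 0 else k \<zeta>)" "\<rho> > 0"
    "(f \<longlongrightarrow> w) (at \<zeta> within ball 0 1)"
    "covers_sector f (ball 0 1 - {0}) (sphere 0 1) w \<alpha> (pi * c) \<rho>"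
proof -
  let ?D = "ball 0 1 - {0::complex}"
  have oD: "open ?D" by (intro open_Diff) auto
  have \<zeta>0: "\<zeta> \<noteq> 0" using \<zeta> by auto
  define Z where "Z s = \<zeta> * ((1 + \<i> * s) / (1 - \<i> * s))" for s
  \<comment> \<open>The image of the small disc lies within \<open>4 * \<delta>\<close> of \<zeta>:
    at most \<epsilon>, to stay in the ball, and at most 1, to avoid the pole at 0.\<close>
  define \<delta> where "\<delta> = min (1 / 4) (\<epsilon> / 4)"
  have \<delta>: "0 < \<delta>" "\<delta> \<le> 1 / 4" "\<delta> \<le> \<epsilon> / 4" using \<epsilon> by (auto simp: \<delta>_def)
  define H where "H = ball 0 \<delta> \<inter> {s. Im s > 0}"
  have oH: "open H" unfolding H_def by (intro open_Int open_ball open_halfspace_Im_gt)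
  have ne: "1 - \<i> * s \<noteq> 0" if "norm s < 1" for s
    by (rule one_minus_i_mult_nonzero[OF that])
  have Z\<zeta>: "Z s - \<zeta> = \<zeta> * (2 * \<i> * s / (1 - \<i> * s))" if "norm s < 1" for s
    using ne[OF that] by (simp add: Z_def field_simps)
  have Znear: "Z s \<in> ball \<zeta> \<epsilon> - {0}" if s: "s \<in> ball 0 \<delta>" for s
  proof -
    have s1: "norm s < 1" "norm s < \<delta>" using s \<delta> by auto
    have "norm (1 - \<i> * s) \<ge> 1 - norm s" using norm_triangle_ineq2[of 1 "\<i> * s"] by (simp add: norm_mult)
    then have n: "norm (1 - \<i> * s) \<ge> 3 / 4" using s1 \<delta> by simp
    have "norm (Z s - \<zeta>) = 2 * norm s / norm (1 - \<i> * s)"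
      using \<zeta> by (simp add: Z\<zeta>[OF s1(1)] norm_mult norm_divide)
    also have "\<dots> \<le> 2 * norm s / (3 / 4)" using n by (intro divide_left_mono) auto
    also have "\<dots> < 4 * \<delta>" using s1 \<delta> by simp
    finally have d: "norm (Z s - \<zeta>) < 4 * \<delta>" .
    then have "Z s \<noteq> 0" using \<zeta> \<delta> by auto
    moreover have "dist \<zeta> (Z s) < \<epsilon>" using d \<delta> by (simp add: dist_norm norm_minus_commute)
    ultimately show ?thesis by simp
  qed
  have Zn: "norm (Z s) = norm ((1 + \<i> * s) / (1 - \<i> * s))" for s unfolding Z_def norm_mult \<zeta> by simp
  have ZD: "Z s \<in> ball 0 1 \<inter> ball \<zeta> \<epsilon> - {0}" if "s \<in> H" for s
    using that Znear[of s] cayley_norm_less_iff(1)[of s] \<delta> unfolding H_def by (simp add: Zn)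
  have Z1: "norm (Z s) = 1" if "s \<in> \<real>" "norm s < 1" for s
    using that cayley_norm_less_iff(2)[of s] by (simp add: Zn complex_is_Real_iff)
  have inv: "\<i> * s = (Z s - \<zeta>) / (Z s + \<zeta>)" if "norm s < 1" for s
  proof -
    have "Z s + \<zeta> = \<zeta> * (2 / (1 - \<i> * s))" using ne[OF that] by (simp add: Z_def field_simps)
    then show ?thesis using ne[OF that] \<zeta>0 by (simp add: Z\<zeta>[OF that])
  qed
  have Zinj: "s = t" if "norm s < 1" "norm t < 1" "Z s = Z t" for s t
  proof -
    have "\<i> * s = \<i> * t" by (simp only: inv[OF that(1)] inv[OF that(2)] that(3))
    then show ?thesis by simp
  qed
  have Z': "(Z has_field_derivative 2 * \<i> * \<zeta> / (1 - \<i> * s)\<^sup>2) (at s)" if "norm s < 1" for s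
    unfolding Z_def[abs_def] using ne[OF that]
    by (auto intro!: derivative_eq_intros simp: field_simps power2_eq_square)
  have Z'': "((\<lambda>s. 2 * \<i> * \<zeta> / (1 - \<i> * s)\<^sup>2) has_field_derivative
      2 * \<i> * \<zeta> / (1 - \<i> * s)\<^sup>2 * (2 * \<i> / (1 - \<i> * s))) (at s)" if "norm s < 1" for s
  proof -
    define u where "u s = 1 - \<i> * s" for s
    have u: "u s \<noteq> 0" "(u has_field_derivative - \<i>) (at s)"
      using ne[OF that] by (auto simp: u_def[abs_def] intro!: derivative_eq_intros)
    have "((\<lambda>s. 2 * \<i> * \<zeta> / (u s)\<^sup>2) has_field_derivative 2 * \<i> * \<zeta> / (u s)\<^sup>2 * (2 * \<i> / u s)) (at s)"
      using u by (auto intro!: derivative_eq_intros simp: field_simps power2_eq_square)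
    then show ?thesis by (simp only: u_def)
  qed
  define \<phi> where "\<phi> s = f (Z s)" for s
  have Hn: "norm s < 1" if "s \<in> H" for s using that \<delta> by (simp add: H_def)
  have \<phi>': "(\<phi> has_field_derivative deriv f (Z s) * (2 * \<i> * \<zeta> / (1 - \<i> * s)\<^sup>2)) (at s)" if s: "s \<in> H" for s
    unfolding \<phi>_def[abs_def]
    by (rule DERIV_chain2[OF holomorphic_derivI[OF hol oD] Z'[OF Hn[OF s]]]) (use ZD[OF s] in auto)
  have \<phi>hol: "\<phi> holomorphic_on H"
    unfolding holomorphic_on_open[OF oH] using \<phi>' by blast
  have d\<phi>: "deriv \<phi> s = deriv f (Z s) * (2 * \<i> * \<zeta> / (1 - \<i> * s)\<^sup>2)" if "s \<in> H" for s
    using \<phi>'[OF that] by (rule DERIV_imp_deriv)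
  have freg: "deriv f z \<noteq> 0" if "z \<in> ?D" for z
    by (rule holomorphic_injective_imp_regular[OF hol oD inj that])
  \<comment> \<open>\<open>q s / s ^ m\<close> is the contribution of \<open>f'' / f'\<close> after
    the substitution. For \<open>m = 1\<close> the constants cancel and
    \<open>q 0 = k \<zeta>\<close>.\<close>
  define q where "q s = k (Z s) * ((1 - \<i> * s) ^ m / (2 * \<i> * \<zeta>) ^ m) * (2 * \<i> * \<zeta> / (1 - \<i> * s)\<^sup>2)" for s
  have qdef: "k (Z s) / (Z s - \<zeta>) ^ m * (2 * \<i> * \<zeta> / (1 - \<i> * s)\<^sup>2) = q s / s ^ m" if "norm s < 1" for s
    using ne[OF that] by (simp add: q_def Z\<zeta>[OF that] power_mult_distrib power_divide mult_ac)
  have ode\<phi>: "deriv (deriv \<phi>) s / deriv \<phi> s = q s / s ^ m + 2 * \<i> / (1 - \<i> * s)" if s: "s \<in> H" for s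
  proof -
    have zD: "Z s \<in> ?D" using ZD[OF s] by auto
    have "((\<lambda>s. deriv f (Z s) * (2 * \<i> * \<zeta> / (1 - \<i> * s)\<^sup>2)) has_field_derivative
       deriv (deriv f) (Z s) * (2 * \<i> * \<zeta> / (1 - \<i> * s)\<^sup>2) * (2 * \<i> * \<zeta> / (1 - \<i> * s)\<^sup>2) +
       2 * \<i> * \<zeta> / (1 - \<i> * s)\<^sup>2 * (2 * \<i> / (1 - \<i> * s)) * deriv f (Z s)) (at s)"
      by (rule DERIV_mult[OF DERIV_chain2[OF holomorphic_derivI[OF holomorphic_deriv[OF hol oD] oD zD]
            Z'[OF Hn[OF s]]] Z''[OF Hn[OF s]]])
    then have "(deriv \<phi> has_field_derivative
       deriv (deriv f) (Z s) * (2 * \<i> * \<zeta> / (1 - \<i> * s)\<^sup>2) * (2 * \<i> * \<zeta> / (1 - \<i> * s)\<^sup>2) +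
       2 * \<i> * \<zeta> / (1 - \<i> * s)\<^sup>2 * (2 * \<i> / (1 - \<i> * s)) * deriv f (Z s)) (at s)"
      by (rule has_field_derivative_transform_within_open[OF _ oH s]) (simp add: d\<phi>)
    then have dd: "deriv (deriv \<phi>) s =
       deriv (deriv f) (Z s) * (2 * \<i> * \<zeta> / (1 - \<i> * s)\<^sup>2) * (2 * \<i> * \<zeta> / (1 - \<i> * s)\<^sup>2) +
       2 * \<i> * \<zeta> / (1 - \<i> * s)\<^sup>2 * (2 * \<i> / (1 - \<i> * s)) * deriv f (Z s)"
      by (rule DERIV_imp_deriv)
    define A where "A = 2 * \<i> * \<zeta> / (1 - \<i> * s)\<^sup>2"
    have A: "A \<noteq> 0" using ne[OF Hn[OF s]] \<zeta>0 by (simp add: A_def)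
    have "deriv (deriv \<phi>) s / deriv \<phi> s = deriv (deriv f) (Z s) / deriv f (Z s) * A + 2 * \<i> / (1 - \<i> * s)"
      unfolding dd d\<phi>[OF s] A_def[symmetric] using A freg[OF zD] by (simp add: field_simps)
    also have "deriv (deriv f) (Z s) / deriv f (Z s) * A = q s / s ^ m"
      unfolding ode[OF ZD[OF s]] A_def by (rule qdef[OF Hn[OF s]])
    finally show ?thesis .
  qed
  have Zhol: "Z holomorphic_on ball 0 \<delta>"
    unfolding holomorphic_on_open[OF open_ball] using Z' \<delta> by force
  have qhol: "q holomorphic_on ball 0 \<delta>"
    unfolding q_def
  proof (intro holomorphic_intros)
    have "Z ` ball 0 \<delta> \<subseteq> ball \<zeta> \<epsilon>" using Znear by blast
    then show "(\<lambda>s. k (Z s)) holomorphic_on ball 0 \<delta>"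
      using holomorphic_on_compose_gen[OF Zhol k(1)] by (simp only: o_def)
    show "(2 * \<i> * \<zeta>) ^ m \<noteq> 0" using \<zeta>0 by simp
    show "(1 - \<i> * s)\<^sup>2 \<noteq> 0" if "s \<in> ball 0 \<delta>" for s using ne[of s] that \<delta> by simp
  qed
  have ihol: "(\<lambda>s. 2 * \<i> / (1 - \<i> * s)) holomorphic_on ball 0 \<delta>"
    using ne \<delta> by (intro holomorphic_intros) force
  have \<phi>inj: "inj_on \<phi> H"
  proof
    fix s t assume st: "s \<in> H" "t \<in> H" "\<phi> s = \<phi> t"
    then have "Z s = Z t" using inj_onD[OF inj, of "Z s" "Z t"] ZD[of s] ZD[of t] by (simp add: \<phi>_def)
    then show "s = t" using Zinj Hn st by blast
  qed
  have Z0: "Z 0 = \<zeta>" by (simp add: Z_def)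
  have m: "m \<le> 1"
  proof (cases "m = 0")
    case False
    show ?thesis
    proof (rule univalent_pre_schwarzian_pole_order_le_1[OF \<delta>(1) \<phi>hol[unfolded H_def] \<phi>inj[unfolded H_def]])
      show "(\<lambda>s. q s + s ^ m * (2 * \<i> / (1 - \<i> * s))) holomorphic_on ball 0 \<delta>"
        by (intro holomorphic_intros qhol ihol)
      show "q 0 + 0 ^ m * (2 * \<i> / (1 - \<i> * 0)) \<noteq> 0"
      proof -
        have z: "(0::complex) ^ m = 0" using False by simp
        have "q 0 \<noteq> 0" using k(2) False \<zeta>0 by (simp add: q_def Z0)
        then show ?thesis unfolding z by simp
      qed
      show "deriv (deriv \<phi>) s / deriv \<phi> s = (q s + s ^ m * (2 * \<i> / (1 - \<i> * s))) / s ^ m"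
        if s: "s \<in> ball 0 \<delta> \<inter> {s. Im s > 0}" for s
      proof -
        have "s \<noteq> 0" using s by auto
        then show ?thesis using ode\<phi>[of s] s by (simp add: H_def add_divide_distrib)
      qed
    qed
  qed simp
  \<comment> \<open>Both admissible orders are written as a simple pole: \<open>K 0\<close> is
    \<open>k \<zeta>\<close> for \<open>m = 1\<close> and 0 for \<open>m = 0\<close>.\<close>
  define K where "K s = q s * s ^ (1 - m) + s * (2 * \<i> / (1 - \<i> * s))" for s
  have Ks: "K s / s = q s / s ^ m + 2 * \<i> / (1 - \<i> * s)" if "s \<noteq> 0" for s
  proof -
    have "m = 0 \<or> m = 1" using m by auto
    then show ?thesis using that by (auto simp: K_def add_divide_distrib)
  qed
  have Khol: "K holomorphic_on ball 0 \<delta>" unfolding K_def by (intro holomorphic_intros qhol ihol)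
  have Kreal: "K x \<in> \<real>" if x: "x \<in> \<real>" "x \<in> ball 0 \<delta>" "x \<noteq> 0" for x
  proof -
    obtain t where t: "x = of_real t" using x(1) by (auto elim: Reals_cases)
    have x1: "norm x < 1" using x \<delta> by simp
    define R where "R = Z x * (k (Z x) / (Z x - \<zeta>) ^ m)"
    have "Z x \<noteq> \<zeta>" using Zinj[OF x1, of 0] x(3) by (auto simp: Z0)
    then have "Re R = - 1" unfolding R_def using Znear[OF x(2)] by (intro Re Z1[OF x(1) x1]) auto
    \<comment> \<open>Now \<open>R + (1 + \<i> * x)\<close> equals
      \<open>\<i> * (\<tau> + t)\<close>, so its product with \<open>2 * \<i>\<close> is real, and
      so is the denominator \<open>1 + t * t\<close>.\<close>
    then obtain \<tau> where \<tau>: "R = - 1 + \<i> * of_real \<tau>" by (metis complex_eq mult.commute of_real_1 of_real_minus)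
    have n1: "1 - \<i> * x \<noteq> 0" "1 + \<i> * x \<noteq> 0" using ne[OF x1] ne[of "- x"] x1 by simp_all
    have "2 * \<i> * \<zeta> / (1 - \<i> * x)\<^sup>2 = Z x * (2 * \<i> / ((1 - \<i> * x) * (1 + \<i> * x)))"
    proof -
      have "2 * \<i> * \<zeta> / u\<^sup>2 = \<zeta> * (v / u) * (2 * \<i> / (u * v))" if "u \<noteq> 0" "v \<noteq> 0" for u v :: complex
        using that by (simp add: field_simps power2_eq_square)
      from this[OF n1] show ?thesis by (simp only: Z_def)
    qed
    then have "q x / x ^ m = R * (2 * \<i> / ((1 - \<i> * x) * (1 + \<i> * x)))"
      unfolding qdef[OF x1, symmetric] R_def by (simp only: mult_ac)
    then have "K x / x = R * (2 * \<i> / ((1 - \<i> * x) * (1 + \<i> * x))) + 2 * \<i> / (1 - \<i> * x)"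
      using Ks[OF x(3)] by simp
    also have "\<dots> = 2 * \<i> * (R + (1 + \<i> * x)) / ((1 - \<i> * x) * (1 + \<i> * x))"
    proof -
      have "R * (2 * \<i> / (u * v)) + 2 * \<i> / u = 2 * \<i> * (R + v) / (u * v)" if "u \<noteq> 0" "v \<noteq> 0" for u v :: complex
        using that by (simp add: field_simps)
      from this[OF n1] show ?thesis .
    qed
    also have "2 * \<i> * (R + (1 + \<i> * x)) = of_real (- 2 * (\<tau> + t))"
      unfolding \<tau> t by (simp add: algebra_simps)
    also have "(1 - \<i> * x) * (1 + \<i> * x) = of_real (1 + t * t)"
      unfolding t by (simp add: algebra_simps)
    finally have "K x / x \<in> \<real>" by (simp only: Reals_of_real Reals_divide)
    then have "K x / x * x \<in> \<real>" using x(1) by (rule Reals_mult)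
    then show ?thesis using x(3) by simp
  qed
  have "\<phi> ` H \<subseteq> f ` (ball 0 1 \<inter> ball \<zeta> \<epsilon> - {0})" using ZD by (auto simp: \<phi>_def)
  then have \<phi>bd: "bounded (\<phi> ` H)" using bd bounded_subset by blast
  have ode': "deriv (deriv \<phi>) s / deriv \<phi> s = K s / s" if "s \<in> H" for s
  proof -
    have "s \<noteq> 0" using that by (auto simp: H_def)
    then show ?thesis using ode\<phi>[OF that] Ks[of s] by simp
  qed
  obtain c w \<alpha> \<rho> where cw: "c > 0" "K 0 = of_real (c - 1)" "\<rho> > 0" "(\<phi> \<longlongrightarrow> w) (at 0 within H)"
    "covers_sector \<phi> H (\<real> \<inter> ball 0 \<delta>) w \<alpha> (pi * c) \<rho>"
  proof (rule half_disc_corner[OF \<delta>(1) \<phi>hol[unfolded H_def] \<phi>inj[unfolded H_def] \<phi>bd[unfolded H_def] Khol])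
    show "K x \<in> \<real>" if "x \<in> \<real>" "x \<in> ball 0 \<delta>" "x \<noteq> 0" for x using that by (rule Kreal)
    show "deriv (deriv \<phi>) s / deriv \<phi> s = K s / s" if "s \<in> ball 0 \<delta> \<inter> {s. 0 < Im s}" for s
      using ode'[of s] that unfolding H_def .
  qed (rule that, unfold H_def)
  show ?thesis
  proof (rule that[OF cw(1) m _ cw(3)])
    have "m = 0 \<or> m = 1" using m by auto
    then show "of_real (c - 1) = (if m = 0 then 0 else k \<zeta>)"
      unfolding cw(2)[symmetric] using \<zeta>0 by (auto simp: K_def q_def Z0)
    \<comment> \<open>The inverse of \<open>Z\<close>, which carries the limit at 0 in the half disc
      back to a limit at \<zeta> in the whole disc.\<close>
    define S where "S z = (z - \<zeta>) / (\<i> * (z + \<zeta>))" for z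
    have "(S \<longlongrightarrow> (\<zeta> - \<zeta>) / (\<i> * (\<zeta> + \<zeta>))) (at \<zeta> within ball 0 1)"
      unfolding S_def using \<zeta>0 by (intro tendsto_intros) auto
    then have S0: "(S \<longlongrightarrow> 0) (at \<zeta> within ball 0 1)" by simp
    have "\<forall>\<^sub>F z in at \<zeta> within ball 0 1. S z \<in> ball 0 \<delta>"
      using S0 \<delta>(1) by (intro topological_tendstoD) auto
    moreover have "\<forall>\<^sub>F z in at \<zeta> within ball 0 1. z \<in> ball 0 1"
      by (simp add: eventually_at_filter)
    ultimately have ev: "\<forall>\<^sub>F z in at \<zeta> within ball 0 1. S z \<in> H \<and> Z (S z) = z"
    proof eventually_elim
      case (elim z)
      have s1: "norm (S z) < 1" using elim(1) \<delta> by simp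
      have z\<zeta>: "z + \<zeta> \<noteq> 0" using elim(2) \<zeta> by (auto simp: add_eq_0_iff)
      have iS: "\<i> * S z = (z - \<zeta>) / (z + \<zeta>)" using z\<zeta> by (simp add: S_def)
      have "1 + (z - \<zeta>) / (z + \<zeta>) = 2 * z / (z + \<zeta>)" "1 - (z - \<zeta>) / (z + \<zeta>) = 2 * \<zeta> / (z + \<zeta>)"
        using z\<zeta> by (simp_all add: field_simps)
      then have "Z (S z) = z" unfolding Z_def iS using z\<zeta> \<zeta>0 by simp
      moreover from this have "Im (S z) > 0"
        using cayley_norm_less_iff(1)[OF s1] Zn[of "S z"] elim(2) by simp
      ultimately show ?case using elim(1) by (simp add: H_def)
    qed
    have "filterlim S (at 0 within H) (at \<zeta> within ball 0 1)"
      unfolding filterlim_at using S0 ev by (auto elim!: eventually_mono simp: H_def)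
    then have "((\<lambda>z. \<phi> (S z)) \<longlongrightarrow> w) (at \<zeta> within ball 0 1)" by (rule filterlim_compose[OF cw(4)])
    moreover have "\<forall>\<^sub>F z in at \<zeta> within ball 0 1. \<phi> (S z) = f z"
      using ev by eventually_elim (simp add: \<phi>_def)
    ultimately show "(f \<longlongrightarrow> w) (at \<zeta> within ball 0 1)" by (rule Lim_transform_eventually)
    show "covers_sector f ?D (sphere 0 1) w \<alpha> (pi * c) \<rho>"
      unfolding covers_sector_def
    proof (intro conjI allI impI; elim conjE)
      fix x \<theta> assume "0 < x" "x < \<rho>" "\<alpha> < \<theta>" "\<theta> < \<alpha> + pi * c"
      then have "w + of_real x * cis \<theta> \<in> \<phi> ` H" using cw(5) by (simp add: covers_sector_def)
      then show "w + of_real x * cis \<theta> \<in> f ` ?D" using ZD by (auto simp: \<phi>_def)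
    next
      fix x \<theta> assume "0 < x" "x < \<rho>" "\<theta> = \<alpha> \<or> \<theta> = \<alpha> + pi * c"
      then obtain \<sigma> s0 where \<sigma>: "\<And>n::nat. \<sigma> n \<in> H" "\<sigma> \<longlonglongrightarrow> s0" "s0 \<in> \<real>" "norm s0 < \<delta>"
        "(\<lambda>n. \<phi> (\<sigma> n)) \<longlonglongrightarrow> w + of_real x * cis \<theta>"
        using cw(5) unfolding covers_sector_def by (metis IntE dist_0_norm mem_ball)
      have s1: "norm s0 < 1" using \<sigma>(4) \<delta> by simp
      then have Zc: "isCont Z s0" using Z' DERIV_isCont by blast
      show "\<exists>\<sigma> z0. (\<forall>n::nat. \<sigma> n \<in> ?D) \<and> \<sigma> \<longlonglongrightarrow> z0 \<and> z0 \<in> sphere 0 1 \<and>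
          (\<lambda>n. f (\<sigma> n)) \<longlonglongrightarrow> w + of_real x * cis \<theta>"
      proof (intro exI conjI allI)
        show "Z (\<sigma> n) \<in> ?D" for n using ZD[OF \<sigma>(1)] by blast
        show "(\<lambda>n. Z (\<sigma> n)) \<longlonglongrightarrow> Z s0" by (rule isCont_tendsto_compose[OF Zc \<sigma>(2)])
        show "Z s0 \<in> sphere 0 1" using Z1[OF \<sigma>(3) s1] by simp
        show "(\<lambda>n. f (Z (\<sigma> n))) \<longlonglongrightarrow> w + of_real x * cis \<theta>" using \<sigma>(5) by (simp add: \<phi>_def)
      qed
    qed
  qed
qed

section \<open>Sectors and interior angles\<close>

text \<open>The window of angles may start anywhere, so that its seam can be put on a bounding ray
  of a sector.\<close>

lemma polar_coordinates_at:
  fixes z w :: complex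
  assumes "z \<noteq> w"
  obtains x \<theta> where "x = dist w z" "0 < x" "\<alpha> \<le> \<theta>" "\<theta> < \<alpha> + 2 * pi" "z = w + of_real x * cis \<theta>"
proof (rule that[of "dist w z" "\<alpha> + Arg2pi ((z - w) / cis \<alpha>)"])
  define u where "u = (z - w) / cis \<alpha>"
  have "z - w = cis \<alpha> * u" by (simp add: u_def)
  also have "u = of_real (norm u) * cis (Arg2pi u)"
    using Arg2pi_eq[of u] by (simp add: cis_conv_exp)
  also have "norm u = dist w z" by (simp add: u_def norm_divide dist_norm norm_minus_commute)
  finally show "z = w + of_real (dist w z) * cis (\<alpha> + Arg2pi ((z - w) / cis \<alpha>))"
    by (simp add: u_def cis_mult[symmetric] algebra_simps)
qed (use assms Arg2pi_ge_0 Arg2pi_lt_2pi in auto)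

lemma polar_eq_imp:
  assumes "of_real x * cis \<theta> = of_real x' * cis \<theta>'" "0 < x" "0 \<le> x'"
  obtains k :: int where "x' = x" "\<theta>' = \<theta> + 2 * pi * of_int k"
proof -
  have "norm (of_real x * cis \<theta>) = norm (of_real x' * cis \<theta>')" using assms(1) by simp
  then have x: "x' = x" using assms(2,3) by (simp add: norm_mult)
  then have "cis \<theta>' = cis \<theta>" using assms by simp
  then have "sin \<theta>' = sin \<theta> \<and> cos \<theta>' = cos \<theta>" by (simp add: complex_eq_iff)
  then obtain k :: int where "\<theta>' = \<theta> + 2 * pi * k"
    unfolding sin_cos_eq_iff by (auto simp: algebra_simps)
  with x show ?thesis by (rule that)
qed

lemma int_shift_cases:
  fixes k :: int
  assumes "\<alpha> \<le> \<theta>" "\<theta> \<le> \<alpha> + 2 * pi" "\<alpha> \<le> \<theta>'" "\<theta>' \<le> \<alpha> + 2 * pi" "\<theta>' = \<theta> + 2 * pi * of_int k"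
  shows "k = 0 \<or> k = 1 \<and> \<theta> = \<alpha> \<and> \<theta>' = \<alpha> + 2 * pi \<or> k = - 1 \<and> \<theta>' = \<alpha> \<and> \<theta> = \<alpha> + 2 * pi"
proof -
  have "2 * pi * of_int k \<le> 2 * pi * 1" "2 * pi * (- 1) \<le> 2 * pi * of_int k"
    using assms by linarith+
  then have "k \<le> 1" "- 1 \<le> k"
    using mult_le_cancel_left_pos[of "2 * pi" "of_int k" 1]
      mult_le_cancel_left_pos[of "2 * pi" "- 1" "of_int k"] by simp_all
  then consider "k = 0" | "k = 1" | "k = - 1" by linarith
  then show ?thesis using assms by cases auto
qed

lemma compact_sector:
  "compact {w + of_real x * cis \<theta> |x \<theta>. 0 \<le> x \<and> x \<le> \<rho> \<and> a \<le> \<theta> \<and> \<theta> \<le> b}"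
proof -
  have "compact ((\<lambda>(x, \<theta>). w + of_real x * cis \<theta>) ` ({0..\<rho>} \<times> {a..b}))"
    by (intro compact_continuous_image compact_Times compact_Icc)
       (auto simp: case_prod_unfold intro!: continuous_intros)
  also have "(\<lambda>(x, \<theta>). w + of_real x * cis \<theta>) ` ({0..\<rho>} \<times> {a..b}) =
      {w + of_real x * cis \<theta> |x \<theta>. 0 \<le> x \<and> x \<le> \<rho> \<and> a \<le> \<theta> \<and> \<theta> \<le> b}"
    by (auto simp: image_iff) blast
  finally show ?thesis .
qed

lemma connected_open_sector:
  "connected {w + of_real x * cis \<theta> |x \<theta>. 0 < x \<and> x < \<rho> \<and> a < \<theta> \<and> \<theta> < b}"
proof -
  have "connected ((\<lambda>(x, \<theta>). w + of_real x * cis \<theta>) ` ({0<..<\<rho>} \<times> {a<..<b}))"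
    by (intro connected_continuous_image connected_Times connected_Ioo)
       (auto simp: case_prod_unfold intro!: continuous_intros)
  also have "(\<lambda>(x, \<theta>). w + of_real x * cis \<theta>) ` ({0<..<\<rho>} \<times> {a<..<b}) =
      {w + of_real x * cis \<theta> |x \<theta>. 0 < x \<and> x < \<rho> \<and> a < \<theta> \<and> \<theta> < b}"
    by (auto simp: image_iff) blast
  finally show ?thesis .
qed

text \<open>The closed sector \<open>A\<close> and the complementary one \<open>B\<close> cover the
  ball and meet only at the apex and on the two bounding rays, all outside \<open>E\<close>. Hence
  the connected set \<open>E \<inter> ball w \<rho>\<close>, which meets \<open>A\<close>, misses
  \<open>B\<close>. For \<open>L = 2 * pi\<close> the set \<open>B\<close> shrinks to a segment,
  which is the tip of a slit with angle 0.\<close>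

lemma has_interior_angle_complement_sector:
  assumes conn: "connected (E \<inter> ball w \<rho>)" and w: "w \<notin> E" and \<rho>: "0 < \<rho>" and L: "0 < L"
    and sub: "\<And>x \<theta>. 0 < x \<Longrightarrow> x < \<rho> \<Longrightarrow> \<alpha> < \<theta> \<Longrightarrow> \<theta> < \<alpha> + L \<Longrightarrow> w + of_real x * cis \<theta> \<in> E"
    and rays: "\<And>x \<theta>. 0 < x \<Longrightarrow> x < \<rho> \<Longrightarrow> \<theta> = \<alpha> \<or> \<theta> = \<alpha> + L \<Longrightarrow> w + of_real x * cis \<theta> \<notin> E"
  shows "has_interior_angle (- E) w (2 * pi - L)"
proof -
  \<comment> \<open>A wider sector would contain the ray at angle \<open>\<alpha> + 2 * pi\<close>,
    which is the excluded ray at \<alpha>.\<close>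
  have L2: "L \<le> 2 * pi"
  proof (rule ccontr)
    assume "\<not> L \<le> 2 * pi"
    then have "w + of_real (\<rho> / 2) * cis (\<alpha> + 2 * pi) \<in> E"
      using \<rho> by (intro sub) auto
    then have "w + of_real (\<rho> / 2) * cis \<alpha> \<in> E" by (simp flip: cis_mult)
    then show False using rays[of "\<rho> / 2" \<alpha>] \<rho> by simp
  qed
  define A where "A = {w + of_real x * cis \<theta> |x \<theta>. 0 \<le> x \<and> x \<le> \<rho> \<and> \<alpha> \<le> \<theta> \<and> \<theta> \<le> \<alpha> + L}"
  define B where "B = {w + of_real x * cis \<theta> |x \<theta>. 0 \<le> x \<and> x \<le> \<rho> \<and> \<alpha> + L \<le> \<theta> \<and> \<theta> \<le> \<alpha> + 2 * pi}"
  have cl: "closed A" "closed B"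
    unfolding A_def B_def by (intro compact_imp_closed compact_sector)+
  let ?S = "E \<inter> ball w \<rho>"
  have polar: "\<exists>x \<theta>. 0 < x \<and> x < \<rho> \<and> \<alpha> \<le> \<theta> \<and> \<theta> < \<alpha> + 2 * pi \<and> z = w + of_real x * cis \<theta>"
    if "z \<in> ball w \<rho>" "z \<noteq> w" for z
    by (rule polar_coordinates_at[OF that(2), of \<alpha>]) (use that(1) in auto)
  have cover: "?S \<subseteq> A \<union> B"
  proof
    fix z assume z: "z \<in> ?S"
    then obtain x \<theta> where x: "0 < x" "x < \<rho>" "\<alpha> \<le> \<theta>" "\<theta> < \<alpha> + 2 * pi" "z = w + of_real x * cis \<theta>"
      using polar[of z] w by blast
    show "z \<in> A \<union> B"
    proof (cases "\<theta> \<le> \<alpha> + L")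
      case True
      then have "z \<in> A" unfolding A_def using x by (intro CollectI exI[of _ x] exI[of _ \<theta>]) auto
      then show ?thesis ..
    next
      case False
      then have "z \<in> B" unfolding B_def using x by (intro CollectI exI[of _ x] exI[of _ \<theta>]) auto
      then show ?thesis ..
    qed
  qed
  have disj: "A \<inter> B \<inter> ?S = {}"
  proof (rule ccontr)
    assume "A \<inter> B \<inter> ?S \<noteq> {}"
    then obtain z where z: "z \<in> A" "z \<in> B" "z \<in> E" "z \<in> ball w \<rho>" by blast
    obtain x \<theta> where x: "0 \<le> x" "\<alpha> \<le> \<theta>" "\<theta> \<le> \<alpha> + L" "z = w + of_real x * cis \<theta>"
      using z(1) unfolding A_def by blast
    obtain x' \<theta>' where x': "0 \<le> x'" "\<alpha> + L \<le> \<theta>'" "\<theta>' \<le> \<alpha> + 2 * pi" "z = w + of_real x' * cis \<theta>'"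
      using z(2) unfolding B_def by blast
    have xp: "0 < x" using x w z(3) by (cases "x = 0") auto
    have x\<rho>: "x < \<rho>" using z(4) x by (auto simp: dist_norm norm_mult)
    obtain k :: int where k: "x' = x" "\<theta>' = \<theta> + 2 * pi * of_int k"
      by (rule polar_eq_imp[of x \<theta> x' \<theta>']) (use x x' xp in auto)
    have "k = 0 \<or> k = 1 \<and> \<theta> = \<alpha> \<and> \<theta>' = \<alpha> + 2 * pi \<or> k = - 1 \<and> \<theta>' = \<alpha> \<and> \<theta> = \<alpha> + 2 * pi"
      by (rule int_shift_cases[OF _ _ _ _ k(2)]) (use x x' L L2 in auto)
    then have "\<theta> = \<alpha> \<or> \<theta> = \<alpha> + L" using x x' k L L2 by auto
    then show False using rays[OF xp x\<rho>] x z by blast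
  qed
  have "w + of_real (\<rho> / 2) * cis (\<alpha> + L / 2) \<in> A \<inter> ?S"
  proof (intro IntI)
    show "w + of_real (\<rho> / 2) * cis (\<alpha> + L / 2) \<in> A"
      unfolding A_def using \<rho> L by (intro CollectI exI[of _ "\<rho> / 2"] exI[of _ "\<alpha> + L / 2"]) auto
    show "w + of_real (\<rho> / 2) * cis (\<alpha> + L / 2) \<in> E"
      using \<rho> L by (intro sub) auto
  qed (use \<rho> in \<open>simp add: dist_norm norm_mult\<close>)
  then have "B \<inter> ?S = {}"
    using conn cover disj cl unfolding connected_closed by blast
  have main: "- E \<inter> ball w \<rho> = {w + of_real x * cis \<theta> |x \<theta>. 0 \<le> x \<and> x < \<rho> \<and> \<alpha> + L \<le> \<theta> \<and> \<theta> \<le> \<alpha> + L + (2 * pi - L)}"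
    (is "_ = ?C")
  proof (intro subset_antisym subsetI)
    fix z assume z: "z \<in> - E \<inter> ball w \<rho>"
    show "z \<in> ?C"
    proof (cases "z = w")
      case True
      then show ?thesis using \<rho> L2 by (intro CollectI exI[of _ 0] exI[of _ "\<alpha> + L"]) auto
    next
      case False
      then obtain x \<theta> where x: "0 < x" "x < \<rho>" "\<alpha> \<le> \<theta>" "\<theta> < \<alpha> + 2 * pi" "z = w + of_real x * cis \<theta>"
        using polar[of z] z by blast
      show ?thesis
      proof (cases "\<theta> = \<alpha>")
        case True
        then have "z = w + of_real x * cis (\<alpha> + 2 * pi)" using x by (simp flip: cis_mult)
        then show ?thesis using x L2 by (intro CollectI exI[of _ x] exI[of _ "\<alpha> + 2 * pi"]) auto
      next
        case False
        then have "\<alpha> + L \<le> \<theta>" using sub[of x \<theta>] x z by force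
        then show ?thesis using x by (intro CollectI exI[of _ x] exI[of _ \<theta>]) auto
      qed
    qed
  next
    fix z assume "z \<in> ?C"
    then obtain x \<theta> where x: "0 \<le> x" "x < \<rho>" "\<alpha> + L \<le> \<theta>" "\<theta> \<le> \<alpha> + 2 * pi" "z = w + of_real x * cis \<theta>"
      by auto
    have "z \<in> ball w \<rho>" using x by (simp add: dist_norm norm_mult)
    moreover have "z \<in> B" unfolding B_def using x by (intro CollectI exI[of _ x] exI[of _ \<theta>]) auto
    ultimately show "z \<in> - E \<inter> ball w \<rho>" using \<open>B \<inter> ?S = {}\<close> by blast
  qed
  show ?thesis unfolding has_interior_angle_def
    using L L2 \<rho> main by (intro conjI exI[of _ "\<alpha> + L"] exI[of _ \<rho>]) auto
qed

section \<open>The exterior of a polygon near a vertex\<close>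

text \<open>Index \<open>k\<close> stands for \<open>k + 1\<close> edges. The edge back to the first
  vertex is added separately, since an arc becomes a closed curve only at that moment.\<close>

primrec polyline :: "complex list \<Rightarrow> nat \<Rightarrow> real \<Rightarrow> complex" where
  "polyline vs 0 = linepath (vs ! 0) (vs ! 1)"
| "polyline vs (Suc k) = polyline vs k +++ linepath (vs ! Suc k) (vs ! Suc (Suc k))"

lemma polygon_edge_Int:
  assumes "polygon vs" "length vs > 2" "i < length vs" "j < length vs" "i \<noteq> j"
  shows "closed_segment (vs ! i) (vs ! (Suc i mod length vs)) \<inter>
      closed_segment (vs ! j) (vs ! (Suc j mod length vs))
      \<subseteq> {vs ! i, vs ! (Suc i mod length vs)} \<inter> {vs ! j, vs ! (Suc j mod length vs)}"
  using assms unfolding polygon_def by blast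

lemma polygon_nth_eq_iff:
  assumes "polygon vs" "i < length vs" "j < length vs"
  shows "vs ! i = vs ! j \<longleftrightarrow> i = j"
  using assms by (simp add: polygon_def nth_eq_iff_index_eq)

lemma polyline_arc:
  assumes vs: "polygon vs" "length vs > 2" and k: "Suc k < length vs"
  shows "arc (polyline vs k) \<and> pathstart (polyline vs k) = vs ! 0 \<and> pathfinish (polyline vs k) = vs ! Suc k \<and>
    path_image (polyline vs k) = (\<Union>i\<le>k. closed_segment (vs ! i) (vs ! (Suc i mod length vs)))"
  using k
proof (induction k)
  case 0
  have "0 < length vs" using 0 by linarith
  then have "vs ! 0 \<noteq> vs ! Suc 0" using 0 polygon_nth_eq_iff[OF vs(1), of 0 "Suc 0"] by simp
  then show ?case using 0 by (simp add: arc_linepath)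
next
  case (Suc k)
  let ?N = "length vs"
  have IH: "arc (polyline vs k)" "pathstart (polyline vs k) = vs ! 0" "pathfinish (polyline vs k) = vs ! Suc k"
    "path_image (polyline vs k) = (\<Union>i\<le>k. closed_segment (vs ! i) (vs ! (Suc i mod ?N)))"
    using Suc by auto
  have ne: "vs ! Suc k \<noteq> vs ! Suc (Suc k)"
    using Suc.prems polygon_nth_eq_iff[OF vs(1), of "Suc k" "Suc (Suc k)"] by simp
  have sub: "path_image (polyline vs k) \<inter> closed_segment (vs ! Suc k) (vs ! Suc (Suc k)) \<subseteq> {vs ! Suc k}"
  proof
    fix z assume z: "z \<in> path_image (polyline vs k) \<inter> closed_segment (vs ! Suc k) (vs ! Suc (Suc k))"
    then obtain i where i: "i \<le> k" "z \<in> closed_segment (vs ! i) (vs ! Suc i)"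
      using Suc.prems by (auto simp: IH(4))
    have "z \<in> {vs ! i, vs ! Suc i} \<inter> {vs ! Suc k, vs ! Suc (Suc k)}"
      using polygon_edge_Int[OF vs, of i "Suc k"] i z Suc.prems by auto
    moreover have "vs ! i \<noteq> vs ! Suc k" "vs ! i \<noteq> vs ! Suc (Suc k)" "vs ! Suc i \<noteq> vs ! Suc (Suc k)"
      using i Suc.prems polygon_nth_eq_iff[OF vs(1)] by simp_all
    ultimately show "z \<in> {vs ! Suc k}" by auto
  qed
  have "arc (polyline vs (Suc k))"
    unfolding polyline.simps
    by (rule arc_join) (use IH ne sub in \<open>auto simp: arc_linepath\<close>)
  moreover have "path_image (polyline vs (Suc k)) = (\<Union>i\<le>Suc k. closed_segment (vs ! i) (vs ! (Suc i mod ?N)))"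
    using IH Suc.prems by (simp add: path_image_join atMost_Suc Un_commute)
  ultimately show ?case using IH by simp
qed

text \<open>Jordan's theorem speaks of simple closed paths, whereas the polygon is given as a union
  of segments.\<close>

lemma polygon_boundary_simple_path:
  assumes vs: "polygon vs" "length vs > 2"
  obtains c where "simple_path c" "pathfinish c = pathstart c" "path_image c = polygon_boundary vs"
proof -
  let ?N = "length vs"
  obtain m where m: "?N = Suc (Suc (Suc m))"
    using vs(2) by (auto simp: numeral_2_eq_2 less_Suc_eq_0_disj dest!: less_imp_Suc_add)
  define p where "p = polyline vs (Suc m)"
  have p: "arc p" "pathstart p = vs ! 0" "pathfinish p = vs ! Suc (Suc m)"
    "path_image p = (\<Union>i\<le>Suc m. closed_segment (vs ! i) (vs ! (Suc i mod ?N)))"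
    using polyline_arc[OF vs, of "Suc m"] m by (auto simp: p_def)
  have ne: "vs ! Suc (Suc m) \<noteq> vs ! 0"
    using polygon_nth_eq_iff[OF vs(1), of "Suc (Suc m)" 0] m by simp
  have sub: "path_image p \<inter> closed_segment (vs ! Suc (Suc m)) (vs ! 0) \<subseteq> {vs ! 0, vs ! Suc (Suc m)}"
  proof
    fix z assume z: "z \<in> path_image p \<inter> closed_segment (vs ! Suc (Suc m)) (vs ! 0)"
    then obtain i where i: "i \<le> Suc m" "z \<in> closed_segment (vs ! i) (vs ! (Suc i mod ?N))"
      by (auto simp: p(4))
    show "z \<in> {vs ! 0, vs ! Suc (Suc m)}"
      using polygon_edge_Int[OF vs, of i "Suc (Suc m)"] i z m by auto
  qed
  show ?thesis
  proof (rule that)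
    show "simple_path (p +++ linepath (vs ! Suc (Suc m)) (vs ! 0))"
      by (rule simple_path_join_loop) (use p ne sub in \<open>auto simp: arc_linepath\<close>)
    show "path_image (p +++ linepath (vs ! Suc (Suc m)) (vs ! 0)) = polygon_boundary vs"
    proof -
      have "{..<?N} = insert (Suc (Suc m)) {..Suc m}" using m by auto
      then have "polygon_boundary vs = closed_segment (vs ! Suc (Suc m)) (vs ! (Suc (Suc (Suc m)) mod ?N)) \<union> path_image p"
        unfolding polygon_boundary_def p(4) by simp
      moreover have "Suc (Suc (Suc m)) mod ?N = 0" using m by simp
      ultimately show ?thesis using p by (simp add: path_image_join Un_commute)
    qed
  qed (use p in simp)
qed

lemma polygon_exterior_disjoint: "polygon_exterior vs \<inter> polygon_boundary vs = {}"
  unfolding polygon_exterior_def using outside_no_overlap by blast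

lemma vertex_in_polygon_boundary: "w \<in> set vs \<Longrightarrow> w \<in> polygon_boundary vs"
  unfolding polygon_boundary_def by (auto simp: in_set_conv_nth)

lemma polygon_boundary_2:
  assumes "length vs = 2"
  shows "polygon_boundary vs = closed_segment (vs ! 0) (vs ! 1)"
proof -
  have "{..<length vs} = {0, 1}" using assms by auto
  then show ?thesis using assms by (simp add: polygon_boundary_def closed_segment_commute)
qed

text \<open>A Jordan curve is the frontier of its outside; for two vertices the exterior is the
  complement of a segment, which is dense.\<close>

lemma vertex_in_closure_polygon_exterior:
  assumes vs: "polygon vs" and w: "w \<in> set vs"
  shows "w \<in> closure (polygon_exterior vs)"
proof (cases "length vs > 2")
  case True
  obtain c where c: "simple_path c" "pathfinish c = pathstart c" "path_image c = polygon_boundary vs"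
    using polygon_boundary_simple_path[OF vs True] by blast
  have "w \<in> frontier (polygon_exterior vs)"
    using Jordan_inside_outside[OF c(1,2)] vertex_in_polygon_boundary[OF w]
    unfolding c(3) polygon_exterior_def by blast
  then show ?thesis by (simp add: frontier_def)
next
  case False
  then have "length vs = 2" using vs by (simp add: polygon_def)
  then have "polygon_exterior vs = - closed_segment (vs ! 0) (vs ! 1)"
    using outside_convex[of "closed_segment (vs ! 0) (vs ! 1)"]
    by (simp add: polygon_exterior_def polygon_boundary_2)
  moreover have "closure (- closed_segment (vs ! 0) (vs ! 1)) = UNIV"
    by (simp add: closure_complement interior_closed_segment_ge2)
  ultimately show ?thesis by simp
qed

text \<open>Only the two incident edges pass through a vertex, and the remaining ones form a closed
  set that keeps a positive distance. For the degenerate polygon the incident edges coincide, hence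
  the clause \<open>a = b\<close>.\<close>

lemma polygon_boundary_at_vertex:
  assumes vs: "polygon vs" and w: "w \<in> set vs"
  obtains a b r where "a \<noteq> w" "b \<noteq> w" "r > 0" "length vs = 2 \<Longrightarrow> a = b"
    "polygon_boundary vs \<inter> ball w r = (closed_segment w a \<union> closed_segment w b) \<inter> ball w r"
proof -
  let ?N = "length vs"
  let ?seg = "\<lambda>k. closed_segment (vs ! k) (vs ! (Suc k mod ?N))"
  have N: "?N \<ge> 2" using vs by (simp add: polygon_def)
  obtain i where i: "i < ?N" "w = vs ! i" using w by (auto simp: in_set_conv_nth)
  define j where "j = (if i = 0 then ?N - 1 else i - 1)"
  have j: "j < ?N" "Suc j mod ?N = i" "j \<noteq> i"
    using N i by (auto simp: j_def)
  have uniq: "k = i \<or> k = j" if k: "k < ?N" and wk: "w \<in> ?seg k" for k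
  proof (rule ccontr)
    assume n: "\<not> (k = i \<or> k = j)"
    have "?N > 2" using n k i j by linarith
    then have "w \<in> {vs ! k, vs ! (Suc k mod ?N)}"
      using polygon_edge_Int[OF vs, of k i] n k i wk by auto
    moreover have "Suc k mod ?N < ?N" using N by (intro mod_less_divisor) linarith
    ultimately have "Suc k mod ?N = i"
      using polygon_nth_eq_iff[OF vs] i k n by auto
    then have "Suc k mod ?N = Suc j mod ?N" using j by simp
    then have "k = j" using k j(1) by (simp add: mod_Suc split: if_splits)
    then show False using n by simp
  qed
  define K where "K = (\<Union>k\<in>{..<?N} - {i, j}. ?seg k)"
  have "closed K" unfolding K_def by (intro closed_UN) auto
  moreover have "w \<notin> K" using uniq by (auto simp: K_def)
  ultimately obtain r where r: "r > 0" "ball w r \<subseteq> - K"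
    by (metis ComplI open_Compl open_contains_ball)
  show ?thesis
  proof (rule that[of "vs ! (Suc i mod ?N)" "vs ! j" r])
    have "Suc i mod ?N \<noteq> i" using i N by (auto simp: mod_Suc)
    moreover have "Suc i mod ?N < ?N" using N by (intro mod_less_divisor) linarith
    ultimately show "vs ! (Suc i mod ?N) \<noteq> w"
      using i polygon_nth_eq_iff[OF vs, of "Suc i mod ?N" i] by auto
    show "vs ! j \<noteq> w" using i j polygon_nth_eq_iff[OF vs] by auto
    show "vs ! (Suc i mod ?N) = vs ! j" if "?N = 2"
    proof -
      have "Suc i mod 2 < 2" "Suc i mod 2 \<noteq> i" using i that by (auto simp: mod_Suc)
      then have "Suc i mod 2 = j" using i j that by linarith
      then show ?thesis using that by simp
    qed
    have "polygon_boundary vs = K \<union> (?seg i \<union> ?seg j)"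
      unfolding polygon_boundary_def K_def using i j by auto
    moreover have "?seg i = closed_segment w (vs ! (Suc i mod ?N))" "?seg j = closed_segment w (vs ! j)"
      using i j by (auto simp: closed_segment_commute)
    ultimately show "polygon_boundary vs \<inter> ball w r =
        (closed_segment w (vs ! (Suc i mod ?N)) \<union> closed_segment w (vs ! j)) \<inter> ball w r"
      using r(2) by blast
  qed (rule r(1))
qed

lemma closed_segment_Int_ball_polar:
  assumes "a = w + of_real s * cis t" "0 < \<rho>" "\<rho> \<le> s" "z \<in> ball w \<rho>"
  shows "z \<in> closed_segment w a \<longleftrightarrow> (\<exists>x. 0 \<le> x \<and> x < \<rho> \<and> z = w + of_real x * cis t)"
proof
  assume "z \<in> closed_segment w a"
  then obtain u where u: "0 \<le> u" "u \<le> 1" "z = w + of_real (u * s) * cis t"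
    unfolding in_segment assms(1) by (auto simp: scaleR_conv_of_real algebra_simps)
  then have "u * s < \<rho>" using assms by (simp add: dist_norm norm_mult)
  moreover have "0 \<le> u * s" using u assms by simp
  ultimately show "\<exists>x. 0 \<le> x \<and> x < \<rho> \<and> z = w + of_real x * cis t" using u(3) by blast
next
  assume "\<exists>x. 0 \<le> x \<and> x < \<rho> \<and> z = w + of_real x * cis t"
  then obtain x where x: "0 \<le> x" "x < \<rho>" "z = w + of_real x * cis t" by blast
  show "z \<in> closed_segment w a"
    unfolding in_segment assms(1) using x assms
    by (intro exI[of _ "x / s"]) (auto simp: scaleR_conv_of_real algebra_simps)
qed

text \<open>The two edges cut a small ball into two open sectors. Each is connected and misses the
  boundary, so it lies in the exterior or is disjoint from it. By Jordan's theorem points of the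
  inside accumulate at the vertex too, so at most one sector belongs to the exterior. At the tip of
  a slit one of the two sectors is empty.\<close>

lemma connected_polygon_exterior_at_vertex:
  assumes vs: "polygon vs" and w: "w \<in> set vs"
  obtains r where "r > 0" "\<And>\<rho>. 0 < \<rho> \<Longrightarrow> \<rho> \<le> r \<Longrightarrow> connected (polygon_exterior vs \<inter> ball w \<rho>)"
proof -
  let ?B = "polygon_boundary vs" and ?E = "polygon_exterior vs"
  obtain a b r0 where ab: "a \<noteq> w" "b \<noteq> w" "r0 > 0" "length vs = 2 \<Longrightarrow> a = b"
    "?B \<inter> ball w r0 = (closed_segment w a \<union> closed_segment w b) \<inter> ball w r0"
    by (rule polygon_boundary_at_vertex[OF vs w]) blast
  obtain sa ta where a: "0 < sa" "a = w + of_real sa * cis ta"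
    by (rule polar_coordinates_at[OF ab(1), of 0]) blast
  \<comment> \<open>The second angle is measured from the first, so the sectors are
    \<open>S ta tb\<close> and \<open>S tb (ta + 2 * pi)\<close>; taking \<open>tb = ta\<close> in
    the degenerate case makes the former empty.\<close>
  obtain sb tb where b: "0 < sb" "ta \<le> tb" "tb < ta + 2 * pi" "b = w + of_real sb * cis tb" "a = b \<Longrightarrow> tb = ta"
  proof (cases "a = b")
    case True
    then show ?thesis using that[of sa ta] a by simp
  next
    case False
    show ?thesis by (rule polar_coordinates_at[OF ab(2), of ta]) (use that False in blast)
  qed
  define r where "r = min r0 (min sa sb)"
  have r: "r > 0" "r \<le> r0" "r \<le> sa" "r \<le> sb" using a b ab by (auto simp: r_def)
  show ?thesis
  proof (rule that[OF r(1)])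
    fix \<rho> assume \<rho>: "0 < \<rho>" "\<rho> \<le> r"
    define S where "S t1 t2 = {w + of_real x * cis \<theta> |x \<theta>. 0 < x \<and> x < \<rho> \<and> t1 < \<theta> \<and> \<theta> < t2}" for t1 t2
    have Sb: "S t1 t2 \<subseteq> ball w \<rho>" for t1 t2 by (auto simp: S_def dist_norm norm_mult)
    have Bray: "z \<in> ?B \<longleftrightarrow> (\<exists>x t. 0 \<le> x \<and> x < \<rho> \<and> (t = ta \<or> t = tb) \<and> z = w + of_real x * cis t)"
      if z: "z \<in> ball w \<rho>" for z
    proof -
      have "z \<in> ball w r0" using z \<rho> r by auto
      then have "z \<in> ?B \<longleftrightarrow> z \<in> closed_segment w a \<or> z \<in> closed_segment w b" using ab(5) by blast
      also have "\<dots> \<longleftrightarrow> (\<exists>x. 0 \<le> x \<and> x < \<rho> \<and> z = w + of_real x * cis ta) \<or>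
          (\<exists>x. 0 \<le> x \<and> x < \<rho> \<and> z = w + of_real x * cis tb)"
        using closed_segment_Int_ball_polar[OF a(2) \<rho>(1) _ z]
          closed_segment_Int_ball_polar[OF b(4) \<rho>(1) _ z] \<rho> r by simp
      finally show ?thesis by blast
    qed
    have disj: "S t1 t2 \<inter> ?B = {}"
      if t: "ta \<le> t1" "t2 \<le> ta + 2 * pi" "t1 = ta \<and> t2 = tb \<or> t1 = tb \<and> t2 = ta + 2 * pi" for t1 t2
    proof (rule ccontr)
      assume "S t1 t2 \<inter> ?B \<noteq> {}"
      then obtain z where z: "z \<in> S t1 t2" "z \<in> ?B" by blast
      obtain x \<theta> where x: "0 < x" "t1 < \<theta>" "\<theta> < t2" "z = w + of_real x * cis \<theta>"
        using z(1) unfolding S_def by blast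
      obtain x' t where x': "0 \<le> x'" "t = ta \<or> t = tb" "z = w + of_real x' * cis t"
        using Bray[of z] Sb z by blast
      obtain k :: int where k: "x' = x" "t = \<theta> + 2 * pi * of_int k"
        by (rule polar_eq_imp[of x \<theta> x' t]) (use x x' in auto)
      have "k = 0 \<or> k = 1 \<and> \<theta> = ta \<and> t = ta + 2 * pi \<or> k = - 1 \<and> t = ta \<and> \<theta> = ta + 2 * pi"
        by (rule int_shift_cases[OF _ _ _ _ k(2)]) (use x x' t b in auto)
      then show False using x x' t b k by auto
    qed
    have alt: "S t1 t2 \<subseteq> ?E \<or> S t1 t2 \<inter> ?E = {}"
      if t: "ta \<le> t1" "t2 \<le> ta + 2 * pi" "t1 = ta \<and> t2 = tb \<or> t1 = tb \<and> t2 = ta + 2 * pi" for t1 t2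
    proof (rule ccontr)
      assume "\<not> (S t1 t2 \<subseteq> ?E \<or> S t1 t2 \<inter> ?E = {})"
      then obtain x y where xy: "x \<in> S t1 t2" "x \<in> ?E" "y \<in> S t1 t2" "y \<notin> ?E" by blast
      have "connected (S t1 t2)" unfolding S_def by (rule connected_open_sector)
      then have "connected_component (- ?B) x y"
        unfolding connected_component_def using disj[OF t] xy by blast
      then show False using xy outside_same_component unfolding polygon_exterior_def by blast
    qed
    have cover: "ball w \<rho> \<subseteq> ?B \<union> S ta tb \<union> S tb (ta + 2 * pi)"
    proof
      fix z assume z: "z \<in> ball w \<rho>"
      show "z \<in> ?B \<union> S ta tb \<union> S tb (ta + 2 * pi)"
      proof (cases "z = w")
        case True
        then show ?thesis using vertex_in_polygon_boundary[OF w] by simp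
      next
        case False
        obtain x \<theta> where x: "x = dist w z" "0 < x" "ta \<le> \<theta>" "\<theta> < ta + 2 * pi" "z = w + of_real x * cis \<theta>"
          using polar_coordinates_at[OF False, of ta] by blast
        have x\<rho>: "x < \<rho>" using x z by simp
        consider "\<theta> = ta \<or> \<theta> = tb" | "ta < \<theta>" "\<theta> < tb" | "tb < \<theta>" using x by linarith
        then show ?thesis
        proof cases
          case 1
          then show ?thesis using Bray[OF z] x x\<rho> by (metis UnI1 less_imp_le)
        next
          case 2
          then have "z \<in> S ta tb" unfolding S_def using x x\<rho> by blast
          then show ?thesis by blast
        next
          case 3
          then have "z \<in> S tb (ta + 2 * pi)" unfolding S_def using x x\<rho> by blast
          then show ?thesis by blast
        qed
      qed
    qed
    have "S ta tb \<inter> ?E = {} \<or> S tb (ta + 2 * pi) \<inter> ?E = {}"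
    proof (cases "length vs > 2")
      case True
      obtain c where c: "simple_path c" "pathfinish c = pathstart c" "path_image c = ?B"
        using polygon_boundary_simple_path[OF vs True] by blast
      have J: "w \<in> frontier (inside ?B)" "inside ?B \<inter> outside ?B = {}"
        using Jordan_inside_outside[OF c(1,2)] vertex_in_polygon_boundary[OF w] unfolding c(3) by blast+
      then have "w \<in> closure (inside ?B)" by (simp add: frontier_def)
      then obtain p where p: "p \<in> inside ?B" "dist p w < \<rho>" using \<rho>(1) unfolding closure_approachable by blast
      then have "p \<notin> ?B" "p \<notin> ?E" "p \<in> ball w \<rho>"
        using inside_no_overlap[of ?B] J(2) unfolding polygon_exterior_def
        by (blast, blast, simp add: dist_commute)
      then have "p \<in> S ta tb \<union> S tb (ta + 2 * pi)" using cover by blast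
      then have "\<not> (S ta tb \<subseteq> ?E \<and> S tb (ta + 2 * pi) \<subseteq> ?E)" using \<open>p \<notin> ?E\<close> by blast
      then show ?thesis using alt[of ta tb] alt[of tb "ta + 2 * pi"] b by auto
    next
      case False
      then have "length vs = 2" using vs by (simp add: polygon_def)
      then have "tb = ta" using ab(4) b(5) by blast
      then show ?thesis by (auto simp: S_def)
    qed
    moreover have "?E \<inter> ball w \<rho> = (S ta tb \<inter> ?E) \<union> (S tb (ta + 2 * pi) \<inter> ?E)"
      using cover Sb polygon_exterior_disjoint[of vs] by blast
    moreover have "connected (S t1 t2 \<inter> ?E)"
      if "ta \<le> t1" "t2 \<le> ta + 2 * pi" "t1 = ta \<and> t2 = tb \<or> t1 = tb \<and> t2 = ta + 2 * pi" for t1 t2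
      using alt[OF that] connected_open_sector[of w \<rho> t1 t2, folded S_def]
      by (auto simp: Int_absorb2)
    ultimately show "connected (?E \<inter> ball w \<rho>)" using b by auto
  qed
qed

section \<open>Roots crossing the unit circle\<close>

lemma zorder_poly_eq_order:
  fixes p :: "complex poly"
  assumes "p \<noteq> 0"
  shows "zorder (poly p) a = int (order a p)"
proof -
  obtain q where q: "p = [:- a, 1:] ^ order a p * q" "\<not> [:- a, 1:] dvd q"
    using order_decomp[OF assms] by blast
  show ?thesis
  proof (rule zorder_eqI[of UNIV _ "poly q"])
    show "poly q a \<noteq> 0" using q(2) by (simp add: poly_eq_0_iff_dvd)
    show "poly p w = poly q w * (w - a) powi int (order a p)" for w
      by (subst q(1)) (simp add: poly_power)
  qed (auto intro!: holomorphic_intros)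
qed

text \<open>On the circle \<open>norm (s * B) < norm A\<close> because \<open>s < 1\<close>, so
  \<open>A - s * B\<close> has as many zeros in the disc as \<open>A = P * R\<close>. All of those
  come from \<open>P\<close>, as \<open>R\<close> has no zero there.\<close>

lemma Rouche_roots_in_disc:
  fixes P R B :: "complex poly" and s :: real
  assumes R: "\<And>z. norm z \<le> 1 \<Longrightarrow> poly R z \<noteq> 0"
    and A: "\<And>z. norm z = 1 \<Longrightarrow> poly (P * R) z \<noteq> 0"
    and AB: "\<And>z. norm z = 1 \<Longrightarrow> norm (poly (P * R) z) = norm (poly B z)" and s: "0 \<le> s" "s < 1"
  shows "finite {z. norm z < 1 \<and> poly (P * R) z = of_real s * poly B z}"
    and "card {z. norm z < 1 \<and> poly (P * R) z = of_real s * poly B z} \<le> degree P"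
proof -
  define A' where "A' = P * R"
  define F where "F = A' - smult (of_real s) B"
  define Z where "Z = {z. norm z < 1 \<and> poly (P * R) z = of_real s * poly B z}"
  have less: "norm (poly (- smult (of_real s) B) z) < norm (poly A' z)" if "norm z = 1" for z
  proof -
    have "norm (poly B z) > 0" using A[OF that] AB[OF that] by (metis zero_less_norm_iff norm_eq_zero)
    then show ?thesis using s AB[OF that] by (simp add: A'_def norm_mult)
  qed
  have A'0: "A' \<noteq> 0" using A[of 1] by (auto simp: A'_def)
  have F0: "F \<noteq> 0"
  proof
    assume "F = 0"
    then have "poly A' 1 = poly (smult (of_real s) B) 1" by (simp add: F_def)
    then show False using less[of 1] by simp
  qed
  have Pne: "P \<noteq> 0" using A'0 by (auto simp: A'_def)
  have Feq: "poly A' z + poly (- smult (of_real s) B) z = poly F z" for z by (simp add: F_def)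
  have ZF: "Z = {z. poly F z = 0 \<and> norm z < 1}" by (auto simp: Z_def F_def A'_def)
  have finF: "finite {z. poly F z = 0}" using poly_roots_finite[OF F0] .
  have finA: "finite {z. poly A' z = 0}" using poly_roots_finite[OF A'0] .
  have finZ: "finite Z" unfolding ZF by (rule finite_subset[OF _ finF]) auto
  have w: "winding_number (circlepath 0 1) z = (if norm z < 1 then 1 else 0)" if "norm z \<noteq> 1" for z
    using that winding_number_circlepath[of z 0 1]
      winding_number_zero_outside[of "circlepath 0 1" "cball 0 1" z] by (auto simp: dist_norm)
  have Fn: "norm z \<noteq> 1" if "poly F z = 0" for z
    using less[of z] that by (auto simp: F_def)
  have An: "norm z \<noteq> 1" if "poly A' z = 0" for z
    using less[of z] that by auto
  have "(\<Sum>p\<in>{p \<in> UNIV. poly A' p + poly (- smult (of_real s) B) p = 0}.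
        winding_number (circlepath 0 1) p * zorder (\<lambda>p. poly A' p + poly (- smult (of_real s) B) p) p) =
      (\<Sum>p\<in>{p \<in> UNIV. poly A' p = 0}. winding_number (circlepath 0 1) p * zorder (poly A') p)"
  proof (rule Rouche_theorem)
    show "finite {p \<in> UNIV. poly A' p + poly (- smult (of_real s) B) p = 0}"
      using finF unfolding Feq by simp
  qed (use finA less in \<open>auto intro!: holomorphic_intros\<close>)
  then have "(\<Sum>p\<in>{p. poly F p = 0}. winding_number (circlepath 0 1) p * of_int (zorder (poly F) p)) =
      (\<Sum>p\<in>{p. poly A' p = 0}. winding_number (circlepath 0 1) p * of_int (zorder (poly A') p))"
    unfolding Feq by simp
  moreover have "(\<Sum>p\<in>{p. poly G p = 0}. winding_number (circlepath 0 1) p * of_int (zorder (poly G) p)) =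
      of_nat (\<Sum>p\<in>{p. poly G p = 0 \<and> norm p < 1}. order p G)"
    if G: "G \<noteq> 0" "\<And>z. poly G z = 0 \<Longrightarrow> norm z \<noteq> 1" for G
  proof -
    have "(\<Sum>p\<in>{p. poly G p = 0}. winding_number (circlepath 0 1) p * of_int (zorder (poly G) p)) =
      (\<Sum>p\<in>{p. poly G p = 0}. if norm p < 1 then of_nat (order p G) else 0)"
      by (rule sum.cong) (use w G in \<open>auto simp: zorder_poly_eq_order\<close>)
    also have "\<dots> = (\<Sum>p\<in>{p \<in> {p. poly G p = 0}. norm p < 1}. of_nat (order p G))"
      by (rule sum.inter_filter[symmetric]) (rule poly_roots_finite[OF G(1)])
    finally show ?thesis by simp
  qed
  ultimately have "(of_nat (\<Sum>p\<in>Z. order p F) :: complex) = of_nat (\<Sum>p\<in>{p. poly A' p = 0 \<and> norm p < 1}. order p A')"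
    using F0 A'0 Fn An by (simp add: ZF)
  then have eq: "(\<Sum>p\<in>Z. order p F) = (\<Sum>p\<in>{p. poly A' p = 0 \<and> norm p < 1}. order p A')"
    by (simp only: of_nat_eq_iff)
  \<comment> \<open>Roots of \<open>F\<close> are counted once here and with multiplicity in the
    next line, hence an inequality.\<close>
  have "card Z = (\<Sum>p\<in>Z. 1)" by simp
  also have "\<dots> \<le> (\<Sum>p\<in>Z. order p F)"
    using F0 by (intro sum_mono) (auto simp: ZF order_root Suc_le_eq)
  also have "\<dots> = (\<Sum>p\<in>{p. poly A' p = 0 \<and> norm p < 1}. order p P)"
    unfolding eq
  proof (rule sum.cong)
    fix p assume "p \<in> {p. poly A' p = 0 \<and> norm p < 1}"
    then have "order p R = 0" using R[of p] by (intro order_0I) simp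
    then show "order p A' = order p P" using A'0 unfolding A'_def by (simp add: order_mult)
  qed simp
  also have "\<dots> \<le> (\<Sum>p | poly P p = 0. order p P)"
    using R by (intro sum_mono2 poly_roots_finite[OF Pne]) (auto simp: A'_def)
  also have "\<dots> \<le> degree P" by (rule sum_order_le_degree[OF Pne])
  finally show "card {z. norm z < 1 \<and> poly (P * R) z = of_real s * poly B z} \<le> degree P"
    unfolding Z_def .
  show "finite {z. norm z < 1 \<and> poly (P * R) z = of_real s * poly B z}"
    using finZ unfolding Z_def .
qed

text \<open>
  The solution of \<open>A = (1 - t) * B\<close> near \<open>\<zeta>\<close> leaves \<open>\<zeta>\<close> with velocity \<open>- B / (A' - B')\<close>, which points
  into the disc.
\<close>

lemma boundary_root_enters_disc:
  fixes A B :: "complex poly"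
  assumes \<zeta>: "norm \<zeta> = 1" "poly A \<zeta> = poly B \<zeta>"
    and v: "Re (poly B \<zeta> / (\<zeta> * poly (pderiv (A - B)) \<zeta>)) > 0" and e: "e > 0"
  shows "\<forall>\<^sub>F t in at_right 0. \<exists>z. norm z < 1 \<and> dist z \<zeta> < e \<and> poly A z = of_real (1 - t) * poly B z"
proof -
  have B0: "poly B \<zeta> \<noteq> 0" and D0: "poly (pderiv (A - B)) \<zeta> \<noteq> 0" using v by auto
  have \<zeta>0: "\<zeta> \<noteq> 0" using \<zeta> by auto
  define U where "U = ball \<zeta> e - {z. poly B z = 0}"
  have "B \<noteq> 0" using B0 by auto
  then have oU: "open U" unfolding U_def
    by (intro open_Diff open_ball finite_imp_closed poly_roots_finite)
  have \<zeta>U: "\<zeta> \<in> U" using e B0 by (simp add: U_def)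
  \<comment> \<open>The sought root is the point where \<open>u\<close> takes the value
    \<open>1 - t\<close>. It is followed by the local inverse \<open>g\<close>, whose derivative at
    1 is \<open>B / (A - B)'\<close>.\<close>
  define u where "u z = poly A z / poly B z" for z
  have uhol: "u holomorphic_on U" unfolding u_def by (intro holomorphic_intros) (auto simp: U_def)
  have "(u has_field_derivative (poly (pderiv A) \<zeta> * poly B \<zeta> - poly A \<zeta> * poly (pderiv B) \<zeta>) / (poly B \<zeta> * poly B \<zeta>)) (at \<zeta>)"
    unfolding u_def[abs_def] by (intro DERIV_divide poly_DERIV B0)
  also have "(poly (pderiv A) \<zeta> * poly B \<zeta> - poly A \<zeta> * poly (pderiv B) \<zeta>) / (poly B \<zeta> * poly B \<zeta>) =
      poly (pderiv (A - B)) \<zeta> / poly B \<zeta>"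
    using B0 by (simp add: \<zeta>(2) pderiv_diff field_simps)
  finally have du: "deriv u \<zeta> = poly (pderiv (A - B)) \<zeta> / poly B \<zeta>" by (rule DERIV_imp_deriv)
  then have "deriv u \<zeta> \<noteq> 0" using B0 D0 by simp
  from has_complex_derivative_locally_injective[OF uhol \<zeta>U oU this]
  obtain r where r: "r > 0" "ball \<zeta> r \<subseteq> U" "inj_on u (ball \<zeta> r)" by blast
  define V where "V = ball \<zeta> r"
  have uV: "u holomorphic_on V" using holomorphic_on_subset[OF uhol r(2)] by (simp add: V_def)
  obtain g where g: "g holomorphic_on u ` V" "\<And>z. z \<in> V \<Longrightarrow> deriv u z * deriv g (u z) = 1"
      "\<And>z. z \<in> V \<Longrightarrow> g (u z) = z"
    using holomorphic_has_inverse[OF uV _ r(3)[folded V_def]] by (auto simp: V_def)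
  have ouV: "open (u ` V)"
    by (rule open_mapping_thm3[OF uV _ r(3)[folded V_def]]) (simp add: V_def)
  have \<zeta>V: "\<zeta> \<in> V" "u \<zeta> = 1" using r \<zeta> B0 by (auto simp: V_def u_def)
  have "1 \<in> u ` V" using \<zeta>V by force
  have g1: "(g has_field_derivative deriv g 1) (at 1)"
    by (rule holomorphic_derivI[OF g(1) ouV \<open>1 \<in> u ` V\<close>])
  have dg: "deriv g 1 = poly B \<zeta> / poly (pderiv (A - B)) \<zeta>"
    using g(2)[OF \<zeta>V(1)] B0 D0 unfolding du \<zeta>V(2) by (simp add: field_simps)
  have gz: "g 1 = \<zeta>" using g(3)[OF \<zeta>V(1)] \<zeta>V(2) by simp
  define G where "G t = g (1 - of_real t)" for t :: real
  have "((\<lambda>z. g (1 - z)) has_field_derivative deriv g 1 * (- 1)) (at (of_real 0))"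
    by (rule DERIV_chain2[where g="\<lambda>z. 1 - z"]) (use g1 in \<open>auto intro!: derivative_eq_intros\<close>)
  from has_vector_derivative_real_field[OF this]
  have G': "(G has_vector_derivative - deriv g 1) (at 0)" by (simp add: G_def[abs_def])
  have dRe: "((\<lambda>t. Re (G t)) has_real_derivative Re (- deriv g 1)) (at 0)"
    using bounded_linear.has_vector_derivative[OF bounded_linear_Re G']
    by (simp add: has_real_derivative_iff_has_vector_derivative)
  have dIm: "((\<lambda>t. Im (G t)) has_real_derivative Im (- deriv g 1)) (at 0)"
    using bounded_linear.has_vector_derivative[OF bounded_linear_Im G']
    by (simp add: has_real_derivative_iff_has_vector_derivative)
  have G0: "G 0 = \<zeta>" by (simp add: G_def gz)
  \<comment> \<open>The squared modulus of the root has derivative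
    \<open>- 2 * Re (cnj \<zeta> * g' 1)\<close> at 0. On the circle
    \<open>cnj \<zeta> = 1 / \<zeta>\<close>, so the hypothesis on the real part makes it
    negative.\<close>
  have dn: "((\<lambda>t. (Re (G t))\<^sup>2 + (Im (G t))\<^sup>2) has_real_derivative
      - (2 * (Re \<zeta> * Re (deriv g 1) + Im \<zeta> * Im (deriv g 1)))) (at 0)"
    using DERIV_add[OF DERIV_mult[OF dRe dRe] DERIV_mult[OF dIm dIm]]
    by (simp add: G0 power2_eq_square algebra_simps)
  have "Re \<zeta> * Re (deriv g 1) + Im \<zeta> * Im (deriv g 1) = Re (cnj \<zeta> * deriv g 1)" by simp
  also have "cnj \<zeta> = 1 / \<zeta>" using \<zeta>(1) by (simp add: divide_conv_cnj)
  also have "Re (1 / \<zeta> * deriv g 1) > 0" using v unfolding dg by (simp add: mult.commute)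
  finally obtain d where d: "d > 0" "\<And>h. 0 < h \<Longrightarrow> h < d \<Longrightarrow> (Re (G (0 + h)))\<^sup>2 + (Im (G (0 + h)))\<^sup>2 < (Re (G 0))\<^sup>2 + (Im (G 0))\<^sup>2"
    using DERIV_neg_dec_right[OF dn] by auto
  have "((\<lambda>t. 1 - complex_of_real t) \<longlongrightarrow> 1 - of_real 0) (at_right 0)" by (intro tendsto_intros)
  then have "\<forall>\<^sub>F t in at_right 0. 1 - complex_of_real t \<in> u ` V"
    using ouV \<open>1 \<in> u ` V\<close> by (intro topological_tendstoD) auto
  moreover have "\<forall>\<^sub>F t in at_right 0. t < d" using d(1) by (rule eventually_at_right_real[THEN eventually_mono]) auto
  moreover have "\<forall>\<^sub>F t :: real in at_right 0. 0 < t" by (rule eventually_at_right_less)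
  ultimately show ?thesis
  proof eventually_elim
    case (elim t)
    obtain z where z: "z \<in> V" "u z = 1 - of_real t" using elim(1) by force
    have Gt: "G t = z" using g(3)[OF z(1)] z(2) by (simp add: G_def)
    have "(norm (G t))\<^sup>2 < (norm (G 0))\<^sup>2" using d(2)[OF elim(3,2)] by (simp only: cmod_power2 add_0)
    then have "norm z < 1" using \<zeta>(1) by (simp add: Gt G0 power_less_one_iff abs_square_less_1)
    moreover have zU: "z \<in> U" using z(1) r(2) by (auto simp: V_def)
    moreover have "poly A z = of_real (1 - t) * poly B z"
      using z(2) zU by (simp add: u_def U_def field_simps)
    ultimately show ?case by (intro exI[of _ z]) (auto simp: U_def dist_commute)
  qed
qed

lemma finite_separated:
  fixes N :: "'a::metric_space set"
  assumes "finite N"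
  obtains e where "e > 0" "\<And>x y. x \<in> N \<Longrightarrow> y \<in> N \<Longrightarrow> x \<noteq> y \<Longrightarrow> 2 * e \<le> dist x y"
proof -
  \<comment> \<open>The element 1 keeps the minimum meaningful when there are no two distinct
    points.\<close>
  define S where "S = insert 1 ((\<lambda>(x, y). dist x y) ` {(x, y) \<in> N \<times> N. x \<noteq> y})"
  have fin: "finite S"
    unfolding S_def using assms by (intro finite.insertI finite_imageI finite_subset[OF _ finite_cartesian_product[OF assms assms]]) auto
  have pos: "x > 0" if "x \<in> S" for x using that by (auto simp: S_def)
  have "Min S \<in> S" by (rule Min_in[OF fin]) (simp add: S_def)
  then have "Min S > 0" by (rule pos)
  moreover have "Min S \<le> dist x y" if "x \<in> N" "y \<in> N" "x \<noteq> y" for x y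
    by (rule Min_le[OF fin]) (use that in \<open>auto simp: S_def\<close>)
  ultimately show ?thesis by (intro that[of "Min S / 2"]) auto
qed

text \<open>Finiteness of \<open>N\<close> lets one value of \<open>t\<close> serve all its points.
  The roots found stay in disjoint discs around those points, so they are distinct.\<close>

lemma card_entering_boundary_roots_le:
  fixes P R B :: "complex poly"
  assumes R: "\<And>z. norm z \<le> 1 \<Longrightarrow> poly R z \<noteq> 0"
    and A: "\<And>z. norm z = 1 \<Longrightarrow> poly (P * R) z \<noteq> 0"
    and AB: "\<And>z. norm z = 1 \<Longrightarrow> norm (poly (P * R) z) = norm (poly B z)"
    and N: "finite N"
    and NN: "\<And>\<zeta>. \<zeta> \<in> N \<Longrightarrow> norm \<zeta> = 1 \<and> poly (P * R) \<zeta> = poly B \<zeta> \<and>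
      Re (poly B \<zeta> / (\<zeta> * poly (pderiv (P * R - B)) \<zeta>)) > 0"
  shows "card N \<le> degree P"
proof -
  obtain e where e: "e > 0" "\<And>x y. x \<in> N \<Longrightarrow> y \<in> N \<Longrightarrow> x \<noteq> y \<Longrightarrow> 2 * e \<le> dist x y"
    using finite_separated[OF N] by blast
  have "\<forall>\<^sub>F t in at_right 0. \<forall>\<zeta>\<in>N. \<exists>z. norm z < 1 \<and> dist z \<zeta> < e \<and> poly (P * R) z = of_real (1 - t) * poly B z"
    using NN e(1) by (intro eventually_ball_finite[OF N] ballI boundary_root_enters_disc) auto
  moreover have "\<forall>\<^sub>F t :: real in at_right 0. t < 1" by (rule eventually_at_right_real[THEN eventually_mono]) auto
  moreover have "\<forall>\<^sub>F t :: real in at_right 0. 0 < t" by (rule eventually_at_right_less)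
  ultimately have "\<forall>\<^sub>F t in at_right 0. 0 < t \<and> t < 1 \<and>
      (\<forall>\<zeta>\<in>N. \<exists>z. norm z < 1 \<and> dist z \<zeta> < e \<and> poly (P * R) z = of_real (1 - t) * poly B z)"
    by eventually_elim auto
  then obtain t :: real where t: "0 < t" "t < 1"
      "\<forall>\<zeta>\<in>N. \<exists>z. norm z < 1 \<and> dist z \<zeta> < e \<and> poly (P * R) z = of_real (1 - t) * poly B z"
    using eventually_happens'[OF trivial_limit_at_right_real] by blast
  then obtain h where h: "\<And>\<zeta>. \<zeta> \<in> N \<Longrightarrow> norm (h \<zeta>) < 1 \<and> dist (h \<zeta>) \<zeta> < e \<and>
      poly (P * R) (h \<zeta>) = of_real (1 - t) * poly B (h \<zeta>)"
    by metis
  let ?Z = "{z. norm z < 1 \<and> poly (P * R) z = of_real (1 - t) * poly B z}"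
  have s: "0 \<le> 1 - t" "1 - t < 1" using t by auto
  have "inj_on h N"
  proof
    fix x y assume xy: "x \<in> N" "y \<in> N" "h x = h y"
    have "dist x y \<le> dist (h x) x + dist (h y) y"
      using dist_triangle2[of x y "h x"] xy(3) by (simp add: dist_commute)
    also have "\<dots> < 2 * e" using h[OF xy(1)] h[OF xy(2)] by simp
    finally show "x = y" using e(2)[OF xy(1,2)] by force
  qed
  then have "card N = card (h ` N)" by (simp add: card_image)
  also have "\<dots> \<le> card ?Z"
    by (rule card_mono[OF Rouche_roots_in_disc(1)[OF R A AB s]]) (use h in auto)
  also have "\<dots> \<le> degree P" by (rule Rouche_roots_in_disc(2)[OF R A AB s])
  finally show ?thesis .
qed

section \<open>Prevertices\<close>

text \<open>If \<open>e = f z1\<close>, the image of a small ball around \<open>z1\<close> is a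
  neighbourhood of \<open>e\<close>. Injectivity then forces the sequence into that ball, so its
  limit would lie in \<open>S\<close>.\<close>

lemma boundary_cluster_value_notin_image:
  fixes f :: "complex \<Rightarrow> complex"
  assumes hol: "f holomorphic_on S" and S: "open S" and inj: "inj_on f S"
    and \<sigma>: "\<And>n::nat. \<sigma> n \<in> S" "\<sigma> \<longlonglongrightarrow> z0" "z0 \<notin> S" and lim: "(\<lambda>n. f (\<sigma> n)) \<longlonglongrightarrow> e"
  shows "e \<notin> f ` S"
proof
  assume "e \<in> f ` S"
  then obtain z1 where z1: "z1 \<in> S" "e = f z1" by blast
  obtain d where d: "d > 0" "cball z1 d \<subseteq> S" using S z1(1) by (auto simp: open_contains_cball)
  have sub: "ball z1 d \<subseteq> S" using d(2) ball_subset_cball by blast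
  have "open (f ` ball z1 d)"
    by (rule open_mapping_thm3[OF holomorphic_on_subset[OF hol sub] open_ball inj_on_subset[OF inj sub]])
  then have "\<forall>\<^sub>F n in sequentially. f (\<sigma> n) \<in> f ` ball z1 d"
    using d(1) z1(2) by (intro topological_tendstoD[OF lim]) auto
  then have "\<forall>\<^sub>F n in sequentially. \<sigma> n \<in> cball z1 d"
  proof eventually_elim
    case (elim n)
    then obtain y where y: "y \<in> ball z1 d" "f (\<sigma> n) = f y" by blast
    then have "\<sigma> n = y" using inj_onD[OF inj] \<sigma>(1) sub by blast
    then show ?case using y(1) by auto
  qed
  then have "z0 \<in> cball z1 d"
    by (rule Lim_in_closed_set[OF closed_cball _ _ \<sigma>(2)]) simp
  then show False using d(2) \<sigma>(3) by blast
qed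

text \<open>\<open>1 / f\<close> is an open map at the pole, so the values taken near the pole fill
  a neighbourhood of infinity; injectivity leaves only bounded values elsewhere.\<close>

lemma bounded_univalent_away_from_pole:
  fixes f :: "complex \<Rightarrow> complex"
  assumes hol: "f holomorphic_on ball 0 1 - {0}" and inj: "inj_on f (ball 0 1 - {0})" and pole: "is_pole f 0"
  obtains r where "0 < r" "r < 1" "bounded (f ` (ball 0 1 - ball 0 r))"
proof -
  have "\<forall>\<^sub>F z in at 0. f z \<noteq> 0" using pole by (rule non_zero_neighbour_pole)
  then obtain d where d: "d > 0" "\<And>z. z \<noteq> 0 \<Longrightarrow> dist z 0 < d \<Longrightarrow> f z \<noteq> 0"
    unfolding eventually_at by auto
  define r where "r = min d 1 / 2"
  have r: "0 < r" "r < 1" "r < d" using d(1) by (auto simp: r_def)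
  define h where "h z = (if z = 0 then 0 else inverse (f z))" for z
  have "f holomorphic_on ball 0 r - {0}" by (rule holomorphic_on_subset[OF hol]) (use r in auto)
  then have hhol: "h holomorphic_on ball 0 r"
    unfolding h_def using r d(2) by (intro is_pole_inverse_holomorphic[OF open_ball _ pole]) auto
  have "open (h ` ball 0 r)"
  proof (rule open_mapping_thm[OF hhol open_ball connected_ball open_ball order_refl])
    show "\<not> h constant_on ball 0 r"
    proof
      assume "h constant_on ball 0 r"
      then obtain y where y: "\<And>z. z \<in> ball 0 r \<Longrightarrow> h z = y" unfolding constant_on_def by blast
      have "complex_of_real (r / 2) \<in> ball 0 r" using r by simp
      then have "h (of_real (r / 2)) = h 0" using y r by simp
      moreover have "f (of_real (r / 2)) \<noteq> 0" using r by (intro d(2)) auto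
      ultimately show False using r by (simp add: h_def)
    qed
  qed
  moreover have "0 \<in> h ` ball 0 r" using r by (force simp: h_def)
  ultimately obtain \<eta> where \<eta>: "\<eta> > 0" "ball 0 \<eta> \<subseteq> h ` ball 0 r" unfolding open_contains_ball by blast
  have "norm (f z) \<le> 1 / \<eta>" if z: "z \<in> ball 0 1 - ball 0 r" for z
  proof (rule ccontr)
    assume n: "\<not> norm (f z) \<le> 1 / \<eta>"
    then have fz: "f z \<noteq> 0" using \<eta>(1) by auto
    have "norm (inverse (f z)) < \<eta>"
      unfolding norm_inverse using n \<eta>(1) fz by (simp add: field_simps)
    then obtain y where y: "y \<in> ball 0 r" "inverse (f z) = h y" using \<eta>(2) by (auto simp: subset_iff image_iff)
    have y0: "y \<noteq> 0" using y(2) fz by (auto simp: h_def)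
    have "f y = f z" using y(2) y0 by (simp add: h_def)
    moreover have "z \<noteq> 0" using z r by auto
    ultimately have "y = z" using inj_onD[OF inj, of y z] y y0 z r by auto
    then show False using y z by simp
  qed
  then have "bounded (f ` (ball 0 1 - ball 0 r))" unfolding bounded_iff by blast
  with r show ?thesis using that by blast
qed

section \<open>Blaschke products on the unit circle\<close>

lemma norm_diff_eq_norm_one_minus_cnj_mult:
  assumes "norm z = 1"
  shows "norm (z - a) = norm (1 - cnj a * z)"
proof -
  have "z * cnj z = 1" using assms complex_norm_square[of z] by simp
  then have "1 - cnj a * z = z * cnj (z - a)" by (simp add: algebra_simps)
  then have "norm (1 - cnj a * z) = norm z * norm (cnj (z - a))" by (simp only: norm_mult)
  then show ?thesis using assms by (simp only: complex_mod_cnj mult_1)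
qed

text \<open>\<open>finite_blaschke\<close> prescribes values only inside the disc. The polynomials
  carry the quotient over to the circle and beyond, where the prevertices are studied.\<close>

lemma finite_blaschke_polys:
  assumes "finite_blaschke d B"
  obtains p q where "degree p = d" "p \<noteq> 0" "\<And>z. norm z \<le> 1 \<Longrightarrow> poly q z \<noteq> 0"
    "\<And>z. norm z = 1 \<Longrightarrow> norm (poly p z) = norm (poly q z)"
    "\<And>z. z \<in> ball 0 1 \<Longrightarrow> B z = poly p z / poly q z"
proof -
  obtain c a where c: "norm c = 1" and a: "\<And>k. k < d \<Longrightarrow> norm (a k) < 1"
    and B: "\<And>z. z \<in> ball 0 1 \<Longrightarrow> B z = c * (\<Prod>k<d. (z - a k) / (1 - cnj (a k) * z))"
    using assms unfolding finite_blaschke_def by blast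
  define p where "p = smult c (\<Prod>k<d. [:- a k, 1:])"
  define q where "q = (\<Prod>k<d. [:1, - cnj (a k):])"
  have p: "poly p z = c * (\<Prod>k<d. z - a k)" for z by (simp add: p_def poly_prod)
  have q: "poly q z = (\<Prod>k<d. 1 - cnj (a k) * z)" for z by (simp add: q_def poly_prod mult.commute)
  have c0: "c \<noteq> 0" using c by auto
  show ?thesis
  proof (rule that)
    have "degree (\<Prod>k<d. [:- a k, 1:]) = (\<Sum>k<d. degree [:- a k, 1:])"
      by (intro degree_prod_sum_eq) auto
    then show "degree p = d" using c0 by (simp add: p_def)
    show "p \<noteq> 0" using c0 by (simp add: p_def)
    show "poly q z \<noteq> 0" if "norm z \<le> 1" for z
    proof -
      have "1 - cnj (a k) * z \<noteq> 0" if "k < d" for k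
      proof
        assume "1 - cnj (a k) * z = 0"
        then have "norm (cnj (a k) * z) = norm (1::complex)" by simp
        then have "norm (a k) * norm z = 1" by (simp add: norm_mult)
        moreover have "norm (a k) * norm z \<le> norm (a k) * 1" using \<open>norm z \<le> 1\<close> by (intro mult_left_mono) auto
        ultimately show False using a[OF that] by simp
      qed
      then show ?thesis by (simp add: q)
    qed
    show "norm (poly p z) = norm (poly q z)" if "norm z = 1" for z
      using c norm_diff_eq_norm_one_minus_cnj_mult[OF that]
      by (simp add: p q norm_mult prod_norm[symmetric])
    show "B z = poly p z / poly q z" if "z \<in> ball 0 1" for z
      using B[OF that] by (simp add: p q prod_dividef)
  qed
qed

text \<open>The Moebius map \<open>2 / (w - 1)\<close> sends 1 to infinity and the unit circle to
  the vertical line through \<open>- 1\<close>.\<close>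

lemma Re_two_div_unimodular_minus_1:
  assumes "norm w = 1" "w \<noteq> 1"
  shows "Re (2 / (w - 1)) = - 1"
proof -
  have sq: "(Re w)\<^sup>2 + (Im w)\<^sup>2 = 1" using assms(1) by (simp add: norm_complex_def)
  have "Re w \<noteq> 1"
  proof
    assume "Re w = 1"
    then have "w = 1" using sq by (simp add: complex_eq_iff)
    then show False using assms(2) by simp
  qed
  moreover have "(Re w - 1)\<^sup>2 + (Im w)\<^sup>2 = 2 * (1 - Re w)" using sq by (simp add: power2_eq_square algebra_simps)
  ultimately show ?thesis by (simp add: Re_divide field_simps)
qed

lemma pole_not_affine:
  fixes f :: "complex \<Rightarrow> complex"
  assumes hol: "f holomorphic_on ball 0 1 - {0}" and pole: "is_pole f 0" and K: "finite K"
    and dd: "\<And>z. z \<in> ball 0 1 - {0} - K \<Longrightarrow> deriv (deriv f) z = 0"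
  shows False
proof -
  let ?D = "ball 0 1 - {0::complex}"
  have D: "open ?D" "connected ?D"
    by (auto intro!: open_Diff connected_open_delete)
  have h1: "deriv f holomorphic_on ?D" by (rule holomorphic_deriv[OF hol D(1)])
  obtain C where C: "\<And>z. z \<in> ?D \<Longrightarrow> deriv f z = C"
  proof (rule DERIV_zero_connected_constant[OF D(2,1) K holomorphic_on_imp_continuous_on[OF h1]])
    show "\<forall>z\<in>?D - K. (deriv f has_field_derivative 0) (at z)"
      using dd holomorphic_derivI[OF h1 D(1)] by force
  qed blast
  have c: "continuous_on ?D (\<lambda>z. f z - C * z)"
    by (intro continuous_intros holomorphic_on_imp_continuous_on[OF hol])
  obtain b where b: "\<And>z. z \<in> ?D \<Longrightarrow> f z - C * z = b"
  proof (rule DERIV_zero_connected_constant[OF D(2,1) finite.emptyI c])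
    show "\<forall>z\<in>?D - {}. ((\<lambda>z. f z - C * z) has_field_derivative 0) (at z)"
    proof
      fix z assume z: "z \<in> ?D - {}"
      have "((\<lambda>z. f z - C * z) has_field_derivative deriv f z - C * 1) (at z)"
        by (intro DERIV_diff DERIV_cmult DERIV_ident holomorphic_derivI[OF hol D(1)]) (use z in simp)
      then show "((\<lambda>z. f z - C * z) has_field_derivative 0) (at z)" using C[of z] z by simp
    qed
  qed blast
  have "((\<lambda>z. b + C * z) \<longlongrightarrow> b + C * 0) (at 0)" by (intro tendsto_intros)
  moreover have "\<forall>\<^sub>F z in at 0. b + C * z = f z"
    unfolding eventually_at using b by (intro exI[of _ 1]) (force simp: algebra_simps)
  ultimately have "(f \<longlongrightarrow> b + C * 0) (at 0)" by (rule Lim_transform_eventually)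
  then show False using pole not_tendsto_and_filterlim_at_infinity[of "at (0::complex)"]
    unfolding is_pole_def by auto
qed

text \<open>The order of \<zeta> as a zero of \<open>B - A\<close> is the pole order of the
  pre-Schwarzian. \<zeta> is any point of the circle, because a cluster point of preimages is not
  known in advance to be such a zero. At the other points the order is 0 and
  \<open>c = 1\<close>.\<close>

lemma exterior_map_corner:
  fixes f :: "complex \<Rightarrow> complex" and A B :: "complex poly"
  assumes hol: "f holomorphic_on ball 0 1 - {0}" and inj: "inj_on f (ball 0 1 - {0})" and pole: "is_pole f 0"
    and A: "\<And>z. norm z = 1 \<Longrightarrow> poly A z \<noteq> 0" and AB: "\<And>z. norm z = 1 \<Longrightarrow> norm (poly B z) = norm (poly A z)"
    and ne: "B \<noteq> A"
    and ode: "\<And>z. z \<in> ball 0 1 - {0} \<Longrightarrow> poly A z \<noteq> 0 \<Longrightarrow> poly B z \<noteq> poly A z \<Longrightarrow>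
      deriv (deriv f) z / deriv f z = 2 * poly A z / (z * (poly B z - poly A z))"
    and \<zeta>: "norm \<zeta> = 1"
  obtains c w \<alpha> \<rho> where "c > 0" "\<rho> > 0" "(f \<longlongrightarrow> w) (at \<zeta> within ball 0 1)"
    "covers_sector f (ball 0 1 - {0}) (sphere 0 1) w \<alpha> (pi * c) \<rho>"
    "c \<noteq> 1 \<longrightarrow> poly B \<zeta> = poly A \<zeta> \<and>
       of_real (c - 1) = 2 * poly A \<zeta> / (\<zeta> * poly (pderiv (B - A)) \<zeta>)"
proof -
  define Q where "Q = B - A"
  have Q0: "Q \<noteq> 0" using ne by (simp add: Q_def)
  define m where "m = order \<zeta> Q"
  obtain R where R: "Q = [:- \<zeta>, 1:] ^ m * R" "\<not> [:- \<zeta>, 1:] dvd R"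
    using order_decomp[OF Q0] unfolding m_def by blast
  have R\<zeta>: "poly R \<zeta> \<noteq> 0" using R(2) by (simp add: poly_eq_0_iff_dvd)
  have \<zeta>0: "\<zeta> \<noteq> 0" using \<zeta> by auto
  have Qpoly: "poly B z - poly A z = (z - \<zeta>) ^ m * poly R z" for z
  proof -
    have "poly B z - poly A z = poly Q z" by (simp add: Q_def)
    also have "\<dots> = (z - \<zeta>) ^ m * poly R z" by (subst R(1)) (simp add: poly_power)
    finally show ?thesis .
  qed
  obtain r where r: "0 < r" "r < 1" "bounded (f ` (ball 0 1 - ball 0 r))"
    using bounded_univalent_away_from_pole[OF hol inj pole] by blast
  have "open (- {z. poly (A * R) z = 0})"
    using A[OF \<zeta>] R\<zeta> by (intro open_Compl finite_imp_closed poly_roots_finite) auto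
  moreover have "\<zeta> \<in> - {z. poly (A * R) z = 0}" using A[OF \<zeta>] R\<zeta> by simp
  ultimately obtain e where e: "e > 0" "ball \<zeta> e \<subseteq> - {z. poly (A * R) z = 0}"
    unfolding open_contains_ball by blast
  \<comment> \<open>The radius \<open>e\<close> avoids the zeros of \<open>A\<close> and of the
    cofactor \<open>R\<close>; \<open>1 - r\<close> avoids the disc around the pole on which
    \<open>f\<close> is unbounded.\<close>
  define \<epsilon> where "\<epsilon> = min e (1 - r)"
  have \<epsilon>: "\<epsilon> > 0" using e r by (simp add: \<epsilon>_def)
  have near: "z \<noteq> 0" "z \<notin> ball 0 r" "poly A z \<noteq> 0" "poly R z \<noteq> 0" if "z \<in> ball \<zeta> \<epsilon>" for z
  proof -
    have "norm (\<zeta> - z) < 1 - r" using that by (simp add: \<epsilon>_def dist_norm)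
    moreover have "norm \<zeta> \<le> norm (\<zeta> - z) + norm z" using norm_triangle_ineq[of "\<zeta> - z" z] by simp
    ultimately have "norm z > r" using \<zeta> by simp
    then show "z \<noteq> 0" "z \<notin> ball 0 r" using r by auto
    have "z \<in> ball \<zeta> e" using that by (simp add: \<epsilon>_def)
    then show "poly A z \<noteq> 0" "poly R z \<noteq> 0" using e(2) by auto
  qed
  define k where "k z = 2 * poly A z / (z * poly R z)" for z
  have kdiv: "2 * poly A z / (z * (poly B z - poly A z)) = k z / (z - \<zeta>) ^ m" for z
    by (simp add: k_def Qpoly mult_ac)
  obtain c w \<alpha> \<rho> where cw: "c > 0" "m \<le> 1" "of_real (c - 1) = (if m = 0 then 0 else k \<zeta>)" "\<rho> > 0"
    "(f \<longlongrightarrow> w) (at \<zeta> within ball 0 1)"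
    "covers_sector f (ball 0 1 - {0}) (sphere 0 1) w \<alpha> (pi * c) \<rho>"
  proof (rule disc_corner[OF hol inj \<zeta> \<epsilon>])
    show "bounded (f ` (ball 0 1 \<inter> ball \<zeta> \<epsilon> - {0}))"
      by (rule bounded_subset[OF r(3)]) (use near in blast)
    show "k holomorphic_on ball \<zeta> \<epsilon>"
      unfolding k_def using near by (intro holomorphic_intros) auto
    show "k \<zeta> \<noteq> 0" using A[OF \<zeta>] \<zeta>0 R\<zeta> by (simp add: k_def)
    show "deriv (deriv f) z / deriv f z = k z / (z - \<zeta>) ^ m" if z: "z \<in> ball 0 1 \<inter> ball \<zeta> \<epsilon> - {0}" for z
    proof -
      have "z \<noteq> \<zeta>" using z \<zeta> by auto
      then have "poly B z \<noteq> poly A z" using Qpoly[of z] near[of z] z by auto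
      then show ?thesis using ode[of z] near[of z] z kdiv by simp
    qed
    show "Re (z * (k z / (z - \<zeta>) ^ m)) = - 1" if z: "norm z = 1" "z \<in> ball \<zeta> \<epsilon>" "z \<noteq> \<zeta>" for z
    proof -
      have nz: "poly B z \<noteq> poly A z" using Qpoly[of z] near[OF z(2)] z(3) by auto
      have "z * (k z / (z - \<zeta>) ^ m) = 2 * poly A z / (poly B z - poly A z)"
        unfolding kdiv[symmetric] using near(1)[OF z(2)] by simp
      also have "\<dots> = 2 / (poly B z / poly A z - 1)"
        using near(3)[OF z(2)] nz by (simp add: field_simps)
      also have "Re \<dots> = - 1"
        using AB[OF z(1)] A[OF z(1)] nz by (intro Re_two_div_unimodular_minus_1) (auto simp: norm_divide)
      finally show ?thesis .
    qed
  qed blast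
  show ?thesis
  proof (rule that[OF cw(1,4,5,6)], rule impI)
    assume "c \<noteq> 1"
    then have m1: "m = 1" using cw(2,3) by (cases "m = 0") auto
    have "poly B \<zeta> - poly A \<zeta> = 0" unfolding Qpoly m1 by simp
    moreover have "poly (pderiv (B - A)) \<zeta> = poly R \<zeta>"
    proof -
      have "B - A = [:- \<zeta>, 1:] * R" using R(1) by (simp add: Q_def m1)
      then show ?thesis by (simp only: pderiv_mult) (simp add: pderiv_pCons)
    qed
    ultimately show "poly B \<zeta> = poly A \<zeta> \<and>
       of_real (c - 1) = 2 * poly A \<zeta> / (\<zeta> * poly (pderiv (B - A)) \<zeta>)"
      using cw(3) by (simp add: m1 k_def)
  qed
qed

lemma vertex_prevertex:
  fixes f :: "complex \<Rightarrow> complex" and A B :: "complex poly"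
  assumes vs: "polygon vs" and conf: "conformal_onto_exterior f vs"
    and A: "\<And>z. norm z = 1 \<Longrightarrow> poly A z \<noteq> 0" and AB: "\<And>z. norm z = 1 \<Longrightarrow> norm (poly B z) = norm (poly A z)"
    and ne: "B \<noteq> A"
    and ode: "\<And>z. z \<in> ball 0 1 - {0} \<Longrightarrow> poly A z \<noteq> 0 \<Longrightarrow> poly B z \<noteq> poly A z \<Longrightarrow>
      deriv (deriv f) z / deriv f z = 2 * poly A z / (z * (poly B z - poly A z))"
    and v: "v \<in> set vs"
  obtains \<zeta> where "norm \<zeta> = 1" "(f \<longlongrightarrow> v) (at \<zeta> within ball 0 1)" "poly B \<zeta> = poly A \<zeta>"
    "of_real (angle_beta (polygon_region vs) v) = poly A \<zeta> / (\<zeta> * poly (pderiv (B - A)) \<zeta>)"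
proof -
  let ?D = "ball 0 1 - {0::complex}"
  let ?E = "polygon_exterior vs"
  have f: "f holomorphic_on ?D" "is_pole f 0" "inj_on f ?D" "f ` ?D = ?E"
    using conf by (auto simp: conformal_onto_exterior_def)
  have oD: "open ?D" by (intro open_Diff) auto
  have vE: "v \<notin> ?E" using vertex_in_polygon_boundary[OF v] polygon_exterior_disjoint by blast
  obtain e where e: "\<And>n. e n \<in> ?E" "e \<longlonglongrightarrow> v"
    using vertex_in_closure_polygon_exterior[OF vs v] unfolding closure_sequential by blast
  have "\<exists>x. x \<in> ?D \<and> f x = e n" for n
  proof -
    have "e n \<in> f ` ?D" using e(1)[of n] by (simp only: f(4))
    then obtain y where "e n = f y" "y \<in> ?D" by (rule imageE)
    then show ?thesis by (intro exI[of _ y]) simp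
  qed
  then obtain x where x: "\<And>n. x n \<in> ?D" "\<And>n. f (x n) = e n" by metis
  have "\<forall>n. x n \<in> cball 0 1" using x(1) by (auto simp: less_imp_le)
  then obtain \<zeta> h where h: "\<zeta> \<in> cball 0 1" "strict_mono h" "(x \<circ> h) \<longlonglongrightarrow> \<zeta>"
    using compact_cball[of "0::complex" 1] unfolding compact_def by meson
  have fx: "(\<lambda>n. f ((x \<circ> h) n)) \<longlonglongrightarrow> v"
    using LIMSEQ_subseq_LIMSEQ[OF e(2) h(2)] by (simp add: o_def x(2))
  \<comment> \<open>At an interior point the limit of values would be a value, but the vertex is not
    in the exterior; at the pole the values would tend to infinity.\<close>
  have "\<zeta> \<notin> ?D"
  proof
    assume z: "\<zeta> \<in> ?D"
    then have "isCont f \<zeta>" by (rule holomorphic_on_imp_isCont[OF f(1) oD])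
    then have "(\<lambda>n. f ((x \<circ> h) n)) \<longlonglongrightarrow> f \<zeta>" using h(3) by (rule isCont_tendsto_compose)
    then have "f \<zeta> = v" using fx LIMSEQ_unique by blast
    then show False using vE z f(4) by blast
  qed
  moreover have "\<zeta> \<noteq> 0"
  proof
    assume "\<zeta> = 0"
    then have "filterlim (x \<circ> h) (at 0) sequentially"
      unfolding filterlim_at using h(3) x(1) by (auto simp: o_def)
    then have "filterlim (\<lambda>n. f ((x \<circ> h) n)) at_infinity sequentially"
      using f(2) unfolding is_pole_def by (rule filterlim_compose[rotated])
    then show False using fx not_tendsto_and_filterlim_at_infinity[OF sequentially_bot] by blast
  qed
  ultimately have \<zeta>: "norm \<zeta> = 1" using h(1) by auto
  obtain c w \<alpha> \<rho> where c: "c > 0" "\<rho> > 0" "(f \<longlongrightarrow> w) (at \<zeta> within ball 0 1)"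
    "covers_sector f ?D (sphere 0 1) w \<alpha> (pi * c) \<rho>"
    "c \<noteq> 1 \<longrightarrow> poly B \<zeta> = poly A \<zeta> \<and>
       of_real (c - 1) = 2 * poly A \<zeta> / (\<zeta> * poly (pderiv (B - A)) \<zeta>)"
    by (rule exterior_map_corner[OF f(1,3,2) _ _ ne _ \<zeta>])
      (rule A, assumption | rule AB, assumption | rule ode, assumption+ | rule that, assumption+)+
  have "x n \<noteq> \<zeta>" for n using x(1)[of n] \<zeta> by auto
  then have "filterlim (x \<circ> h) (at \<zeta> within ball 0 1) sequentially"
    unfolding filterlim_at using h(3) x(1) by (auto simp: o_def)
  then have "(\<lambda>n. f ((x \<circ> h) n)) \<longlonglongrightarrow> w" by (rule filterlim_compose[OF c(3)])
  then have wv: "w = v" using fx LIMSEQ_unique by blast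
  obtain r where r: "r > 0" "\<And>\<rho>. 0 < \<rho> \<Longrightarrow> \<rho> \<le> r \<Longrightarrow> connected (?E \<inter> ball v \<rho>)"
    using connected_polygon_exterior_at_vertex[OF vs v] by blast
  define \<rho>' where "\<rho>' = min r \<rho>"
  have \<rho>': "0 < \<rho>'" "\<rho>' \<le> r" "\<rho>' \<le> \<rho>" using r(1) c(2) by (auto simp: \<rho>'_def)
  have "has_interior_angle (- ?E) v (2 * pi - pi * c)"
  proof (rule has_interior_angle_complement_sector[OF r(2)[OF \<rho>'(1,2)] vE \<rho>'(1)])
    show "0 < pi * c" using c(1) by simp
    show "v + of_real t * cis \<theta> \<in> ?E" if "0 < t" "t < \<rho>'" "\<alpha> < \<theta>" "\<theta> < \<alpha> + pi * c" for t \<theta>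
      using c(4) that \<rho>'(3) unfolding covers_sector_def wv f(4) by force
    \<comment> \<open>A point of a bounding ray is a limit of values along a sequence tending to the
      circle, and such a limit cannot be a value of \<open>f\<close>.\<close>
    show "v + of_real t * cis \<theta> \<notin> ?E" if t: "0 < t" "t < \<rho>'" "\<theta> = \<alpha> \<or> \<theta> = \<alpha> + pi * c" for t \<theta>
    proof -
      have "0 < t \<and> t < \<rho> \<and> (\<theta> = \<alpha> \<or> \<theta> = \<alpha> + pi * c)" using t \<rho>'(3) by auto
      then obtain \<sigma> z0 where s: "\<And>n::nat. \<sigma> n \<in> ?D" "\<sigma> \<longlonglongrightarrow> z0" "z0 \<in> sphere 0 1"
        "(\<lambda>n. f (\<sigma> n)) \<longlonglongrightarrow> v + of_real t * cis \<theta>"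
        using c(4) unfolding covers_sector_def wv by blast
      have "z0 \<notin> ?D" using s(3) by auto
      from boundary_cluster_value_notin_image[OF f(1) oD f(3) s(1,2) this s(4)]
      show ?thesis unfolding f(4) .
    qed
  qed
  then have "interior_angle (polygon_region vs) v = 2 * pi - pi * c"
    unfolding polygon_region_def by (rule interior_angle_eq)
  then have beta: "angle_beta (polygon_region vs) v = (c - 1) / 2"
    by (simp add: angle_beta_def field_simps)
  have "angle_beta (polygon_region vs) v \<noteq> 0" using vs v by (auto simp: polygon_def)
  \<comment> \<open>The ban on straight angles is what makes \<zeta> a zero of
    \<open>B - A\<close>.\<close>
  then have "c \<noteq> 1" using beta by auto
  with c(5) have q: "poly B \<zeta> = poly A \<zeta>"
    "complex_of_real (c - 1) = 2 * poly A \<zeta> / (\<zeta> * poly (pderiv (B - A)) \<zeta>)"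
    by blast+
  show ?thesis
  proof (rule that[OF \<zeta> c(3)[unfolded wv]])
    have "of_real (angle_beta (polygon_region vs) v) = complex_of_real (c - 1) / 2" by (simp add: beta)
    also have "\<dots> = 2 * poly A \<zeta> / (\<zeta> * poly (pderiv (B - A)) \<zeta>) / 2" unfolding q(2) ..
    also have "\<dots> = poly A \<zeta> / (\<zeta> * poly (pderiv (B - A)) \<zeta>)" by simp
    finally show "of_real (angle_beta (polygon_region vs) v) = poly A \<zeta> / (\<zeta> * poly (pderiv (B - A)) \<zeta>)" .
  qed (rule q(1))
qed

lemma at_within_disc_neq_bot:
  fixes \<zeta> :: complex
  assumes "norm \<zeta> = 1"
  shows "at \<zeta> within ball 0 1 \<noteq> bot"
proof -
  have "\<zeta> \<in> closure (ball 0 1)" using assms by (simp add: closure_ball)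
  then have "\<zeta> islimpt ball 0 1" using assms by (auto simp: closure_def)
  then show ?thesis by (simp add: trivial_limit_within)
qed

theorem theorem3:
  fixes f B1 B2 :: "complex \<Rightarrow> complex"
    and vs :: "complex list"
    and n d1 d2 :: nat
  assumes "polygon vs"
    and "length vs = n + 2"
    and "conformal_onto_exterior f vs"
    and "finite_blaschke d1 B1"
    and "finite_blaschke d2 B2"
    and "d1 + d2 = n"
    and "\<forall>z\<in>ball 0 1. \<not> (B1 z = 0 \<and> B2 z = 0)"
    and "\<forall>z\<in>ball 0 1. z \<noteq> 0 \<and> B2 z \<noteq> 0 \<longrightarrow>
           z * (deriv (deriv f) z / deriv f z) = 2 / (z\<^sup>2 * (B1 z / B2 z) - 1)"
  shows "d2 = card {w \<in> set vs. concave_vertex (polygon_region vs) w} \<and>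
         d1 + 2 = card {w \<in> set vs. convex_vertex (polygon_region vs) w}"
proof -
  let ?\<beta> = "angle_beta (polygon_region vs)"
  obtain p1 q1 where pq1: "degree p1 = d1" "p1 \<noteq> 0" "\<And>z. norm z \<le> 1 \<Longrightarrow> poly q1 z \<noteq> 0"
    "\<And>z. norm z = 1 \<Longrightarrow> norm (poly p1 z) = norm (poly q1 z)"
    "\<And>z. z \<in> ball 0 1 \<Longrightarrow> B1 z = poly p1 z / poly q1 z"
    using finite_blaschke_polys[OF assms(4)] by blast
  obtain p2 q2 where pq2: "degree p2 = d2" "p2 \<noteq> 0" "\<And>z. norm z \<le> 1 \<Longrightarrow> poly q2 z \<noteq> 0"
    "\<And>z. norm z = 1 \<Longrightarrow> norm (poly p2 z) = norm (poly q2 z)"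
    "\<And>z. z \<in> ball 0 1 \<Longrightarrow> B2 z = poly p2 z / poly q2 z"
    using finite_blaschke_polys[OF assms(5)] by blast
  \<comment> \<open>The factor \<open>z\<^sup>2\<close> accounts for the 2 in
    \<open>d1 + 2\<close>.\<close>
  define P where "P = monom 1 2 * p1"
  define A where "A = p2 * q1"
  define B where "B = P * q2"
  have degP: "degree P = d1 + 2" using pq1(1,2) by (simp add: P_def degree_mult_eq degree_monom_eq)
  have P: "poly P z = z\<^sup>2 * poly p1 z" for z by (simp add: P_def poly_monom)
  have p_nz: "poly p1 z \<noteq> 0" "poly p2 z \<noteq> 0" "poly q1 z \<noteq> 0" "poly q2 z \<noteq> 0" if "norm z = 1" for z
    using pq1(3,4)[of z] pq2(3,4)[of z] that by auto
  have A: "poly A z \<noteq> 0" if "norm z = 1" for z using p_nz[OF that] by (simp add: A_def)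
  have B: "poly B z \<noteq> 0" if "norm z = 1" for z using p_nz[OF that] that by (auto simp: B_def P)
  have AB: "norm (poly B z) = norm (poly A z)" if "norm z = 1" for z
    using pq1(4)[OF that] pq2(4)[OF that] that by (simp add: A_def B_def P norm_mult norm_power)
  have f: "f holomorphic_on ball 0 1 - {0}" "is_pole f 0" "inj_on f (ball 0 1 - {0})"
    using assms(3) by (auto simp: conformal_onto_exterior_def)
  have rhs: "deriv (deriv f) z / deriv f z = 2 / (poly B z / poly A z - 1) / z"
    if z: "z \<in> ball 0 1 - {0}" "poly A z \<noteq> 0" for z
  proof -
    have "z * (deriv (deriv f) z / deriv f z) = 2 / (z\<^sup>2 * (B1 z / B2 z) - 1)"
      using assms(8) z pq2(3)[of z] pq2(5)[of z] by (simp add: A_def)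
    also have "z\<^sup>2 * (B1 z / B2 z) = poly B z / poly A z"
      using z pq1(5)[of z] pq2(5)[of z] by (simp add: A_def B_def P mult_ac)
    finally have "z * (deriv (deriv f) z / deriv f z) = 2 / (poly B z / poly A z - 1)" .
    moreover have "z \<noteq> 0" using z by simp
    ultimately show ?thesis by (metis nonzero_mult_div_cancel_left)
  qed
  \<comment> \<open>If \<open>B = A\<close>, the right-hand side of the equation is a division by
    zero, whose value is 0, so \<open>f''\<close> would vanish off the zeros of
    \<open>A\<close>.\<close>
  have ne: "B \<noteq> A"
  proof
    assume BA: "B = A"
    have "A \<noteq> 0" using A[of 1] by auto
    then have fin: "finite {z. poly A z = 0}" by (rule poly_roots_finite)
    show False
    proof (rule pole_not_affine[OF f(1,2) fin])
      fix z assume z: "z \<in> ball 0 1 - {0} - {z. poly A z = 0}"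
      have "deriv f z \<noteq> 0"
        by (rule holomorphic_injective_imp_regular[OF f(1) _ f(3)]) (use z in \<open>auto intro: open_Diff\<close>)
      moreover have "deriv (deriv f) z / deriv f z = 0" using rhs[of z] z by (simp add: BA)
      ultimately show "deriv (deriv f) z = 0" by simp
    qed
  qed
  have ode: "deriv (deriv f) z / deriv f z = 2 * poly A z / (z * (poly B z - poly A z))"
    if z: "z \<in> ball 0 1 - {0}" "poly A z \<noteq> 0" "poly B z \<noteq> poly A z" for z
  proof -
    have "poly B z / poly A z - 1 = (poly B z - poly A z) / poly A z" using z(2) by (simp add: diff_divide_distrib)
    then show ?thesis unfolding rhs[OF z(1,2)] by (simp add: mult.commute)
  qed
  have "\<exists>\<zeta>. norm \<zeta> = 1 \<and> (f \<longlongrightarrow> v) (at \<zeta> within ball 0 1) \<and> poly B \<zeta> = poly A \<zeta> \<and>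
      of_real (?\<beta> v) = poly A \<zeta> / (\<zeta> * poly (pderiv (B - A)) \<zeta>)" if v: "v \<in> set vs" for v
    using vertex_prevertex[OF assms(1,3) A AB ne ode v] by blast
  then obtain \<zeta> where \<zeta>: "\<And>v. v \<in> set vs \<Longrightarrow> norm (\<zeta> v) = 1"
    "\<And>v. v \<in> set vs \<Longrightarrow> (f \<longlongrightarrow> v) (at (\<zeta> v) within ball 0 1)"
    "\<And>v. v \<in> set vs \<Longrightarrow> poly B (\<zeta> v) = poly A (\<zeta> v)"
    "\<And>v. v \<in> set vs \<Longrightarrow> of_real (?\<beta> v) = poly A (\<zeta> v) / (\<zeta> v * poly (pderiv (B - A)) (\<zeta> v))"
    by metis
  have inj: "inj_on \<zeta> (set vs)"
  proof
    fix v w assume vw: "v \<in> set vs" "w \<in> set vs" "\<zeta> v = \<zeta> w"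
    show "v = w"
      using tendsto_unique[OF at_within_disc_neq_bot[OF \<zeta>(1)[OF vw(1)]] \<zeta>(2)[OF vw(1)]] \<zeta>(2)[OF vw(2)] vw(3) by simp
  qed
  let ?concave = "{w \<in> set vs. concave_vertex (polygon_region vs) w}"
  let ?convex = "{w \<in> set vs. convex_vertex (polygon_region vs) w}"
  \<comment> \<open>In \<open>A = p2 * q1\<close> the factor \<open>q1\<close> has no zero in the
    closed disc, so only the degree of \<open>p2\<close> counts. Differentiating
    \<open>A - B\<close> rather than \<open>B - A\<close> flips the sign: a root enters the disc
    when \<open>- \<beta> > 0\<close>.\<close>
  have "card (\<zeta> ` ?concave) \<le> degree p2"
  proof (rule card_entering_boundary_roots_le[of q1 p2 B])
    fix z assume "z \<in> \<zeta> ` ?concave"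
    then obtain v where v: "v \<in> set vs" "?\<beta> v < 0" "z = \<zeta> v" by (auto simp: concave_vertex_def)
    have "pderiv (A - B) = - pderiv (B - A)" by (simp flip: pderiv_minus)
    then have "poly B z / (z * poly (pderiv (A - B)) z) = - of_real (?\<beta> v)"
      using \<zeta>(3,4)[OF v(1)] by (simp add: v(3))
    then show "norm z = 1 \<and> poly (p2 * q1) z = poly B z \<and> Re (poly B z / (z * poly (pderiv (p2 * q1 - B)) z)) > 0"
      using \<zeta>(1,3)[OF v(1)] v unfolding A_def[symmetric] by simp
  qed (use pq1(3) A AB in \<open>auto simp: A_def\<close>)
  moreover have "card (\<zeta> ` ?concave) = card ?concave"
    by (rule card_image[OF inj_on_subset[OF inj]]) auto
  ultimately have concave: "card ?concave \<le> d2" using pq2(1) by simp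
  \<comment> \<open>With the roles of \<open>A\<close> and \<open>B\<close> exchanged,
    \<open>q2\<close> is the factor without zeros and the condition for entering the disc is
    \<open>\<beta> > 0\<close>.\<close>
  have "card (\<zeta> ` ?convex) \<le> degree P"
  proof (rule card_entering_boundary_roots_le[of q2 P A])
    fix z assume "z \<in> \<zeta> ` ?convex"
    then obtain v where v: "v \<in> set vs" "?\<beta> v > 0" "z = \<zeta> v" by (auto simp: convex_vertex_def)
    have "poly A z / (z * poly (pderiv (B - A)) z) = of_real (?\<beta> v)"
      using \<zeta>(4)[OF v(1)] by (simp add: v(3))
    then show "norm z = 1 \<and> poly (P * q2) z = poly A z \<and> Re (poly A z / (z * poly (pderiv (P * q2 - A)) z)) > 0"
      using \<zeta>(1,3)[OF v(1)] v unfolding B_def[symmetric] by simp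
  qed (use pq2(3) B AB in \<open>auto simp: B_def\<close>)
  moreover have "card (\<zeta> ` ?convex) = card ?convex"
    by (rule card_image[OF inj_on_subset[OF inj]]) auto
  ultimately have convex: "card ?convex \<le> d1 + 2" using degP by simp
  have "?\<beta> w \<noteq> 0" if "w \<in> set vs" for w using assms(1) that by (auto simp: polygon_def)
  then have "set vs = ?concave \<union> ?convex"
    by (auto simp: concave_vertex_def convex_vertex_def neq_iff)
  moreover have "card (?concave \<union> ?convex) = card ?concave + card ?convex"
    by (rule card_Un_disjoint) (auto simp: concave_vertex_def convex_vertex_def)
  moreover have "card (set vs) = n + 2" using assms(1,2) by (simp add: polygon_def distinct_card)
  ultimately have "card ?concave + card ?convex = d1 + d2 + 2" using assms(6) by simp
  then show ?thesis using concave convex by linarith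
qed

end
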